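(* Fix constants $\alpha,K,M_0,M>0$. For each $\mathcal J\in\{\mathcal G,\mathcal H\}$, along sequences $(n,d,\rho)$ in the asymptotic regime described in the context, $$ \inf_{\hat\Sigma\in\mathcal M_\rho}\ \sup_{P\in\mathcal P_\alpha^{\mathcal J}}\mathbb E_P\|\hat\Sigma-\Sigma(P)\|^2 \;\gtrsim\; \Bigl(n^{-\frac{2\alpha}{2\alpha+1}}\wedge\frac dn\Bigr)+\mathcal Q_{\alpha,d}\Bigl(\frac{d}{\rho n^2}\Bigr), $$ where, for $u>0$, $$ \mathcal Q_{\alpha,d}(u)=\sup_{\substack{1\le k\le\lfloor d/4\rfloor\\ 1\le r\le k}}\min\Bigl(\frac{k^{-2\alpha}}{r},\,ukr\Bigr),\qquad k,r\ \text{integers}. $$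
   Context: Norms: $\|\cdot\|$ is the spectral (operator) norm; $a\wedge b=\min(a,b)$. For a random variable $\xi$, $\|\xi\|_{\psi_2}=\inf\{t>0:\mathbb E e^{\xi^2/t^2}\le2\}$; for a random vector $X$, $\|X\|_{\psi_2}=\sup_{\|v\|_2=1}\|\langle X,v\rangle\|_{\psi_2}$. Privacy. Two datasets of $n$ points of $\mathbb R^d$ are adjacent if they differ in one observation. For $\lambda>1$ the R\'enyi divergence of laws $P,Q$ is $D_\lambda(P\|Q)=\frac1{\lambda-1}\log\int(\frac{dP}{dQ})^\lambda dQ$ ($=\infty$ if $P\not\ll Q$). A randomized algorithm $A$ is $\rho$-zCDP if $D_\lambda(A(S)\|A(S'))\le\rho\lambda$ for all adjacent $S,S'$ and all $\lambda\in(1,\infty)$ (divergence over the internal randomness of $A$ only). $\mathcal M_\rho$ is the set of all $\rho$-zCDP estimators (random $d\times d$ matrices) based on $n$ observations. Covariance classes. The pointwise-decay class $\mathcal H_\alpha(M_0,M)$ is the set of $d\times d$ covariance matrices with $0\preceq\Sigma\preceq M_0I_d$ and $|\Sigma_{ij}|\le M|i-j|^{-(\alpha+1)}$ for $i\ne j$. The row-tail class $\mathcal G_\alpha(M_0,M)$ is the set of $d\times d$ covariance matrices with $0\preceq\Sigma\preceq M_0I_d$ and $\max_{j}\sum_{i:|i-j|>k}|\Sigma_{ij}|\le Mk^{-\alpha}$ for all $k\ge1$. Model. For $\mathcal J\in\{\mathcal G,\mathcal H\}$, $\mathcal P_\alpha^{\mathcal J}=\mathcal P_\alpha^{\mathcal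 J}(K,M_0,M)$ is the set of distributions $P$ on $\mathbb R^d$ such that $X\sim P$ with mean $\mu$ and covariance $\Sigma(P)$ satisfies $\|X-\mu\|_{\psi_2}\le K$ and $\Sigma(P)\in\mathcal J_\alpha(M_0,M)$. $\mathbb E_P$ is expectation over $n$ i.i.d. observations from $P$ and over the randomness of the estimator. Asymptotic regime. Statements are along sequences $(n,d,\rho)=(n,d_n,\rho_n)$, $n\to\infty$, with $d\gtrsim\log n$, $0<\rho\lesssim1$ (a fixed upper bound), and $d/(\rho n^2)\to0$. $a\gtrsim b$ means $a\ge cb$ for all sufficiently large $n$ with $c>0$ not depending on $n,d,\rho$ (it may depend on $\alpha,K,M_0,M$ and on the fixed constants in the regime conditions). *)

theory Defs
  imports "HOL-Probability.Probability"
begin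

text \<open>
  The dimension \<open>d\<close> varies with the sample size, so a vector of \<open>\<real>\<^sup>d\<close> is a function on the index
  set \<open>{..<d}\<close> and a \<open>d \<times> d\<close> matrix is a function \<open>A\<close> with entries \<open>A i j\<close>, \<open>i, j < d\<close>
  (indices start at 0). Values at other indices are never used. The spaces below carry the
  product (= Borel) sigma-algebras.
\<close>

type_synonym rvec = "nat \<Rightarrow> real"
type_synonym rmat = "nat \<Rightarrow> nat \<Rightarrow> real"

definition vec_space :: "nat \<Rightarrow> rvec measure" where
  "vec_space d = PiM {..<d} (\<lambda>_. borel)"

definition mat_space :: "nat \<Rightarrow> rmat measure" where
  "mat_space d = PiM {..<d} (\<lambda>_. vec_space d)"

definition dataset_space :: "nat \<Rightarrow> nat \<Rightarrow> (nat \<Rightarrow> rvec) measure" where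
  "dataset_space n d = PiM {..<n} (\<lambda>_. vec_space d)"

definition mat_vec :: "nat \<Rightarrow> rmat \<Rightarrow> rvec \<Rightarrow> rvec" where
  "mat_vec d A x = (\<lambda>i. \<Sum>j<d. A i j * x j)"

definition spectral_norm :: "nat \<Rightarrow> rmat \<Rightarrow> real" where
  "spectral_norm d A = (SUP x\<in>{x. L2_set x {..<d} \<le> 1}. L2_set (mat_vec d A x) {..<d})"

definition psd :: "nat \<Rightarrow> rmat \<Rightarrow> bool" where
  "psd d A \<longleftrightarrow> (\<forall>i<d. \<forall>j<d. A i j = A j i) \<and>
     (\<forall>x. 0 \<le> (\<Sum>i<d. \<Sum>j<d. x i * A i j * x j))"

definition scaled_id :: "real \<Rightarrow> rmat" where
  "scaled_id c = (\<lambda>i j. if i = j then c else 0)"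


section \<open>Sub-Gaussian norms, mean and covariance\<close>

text \<open>The norms take values in \<open>ennreal\<close>, so that an empty infimum is \<open>\<infinity>\<close>.\<close>

definition psi2_norm :: "'a measure \<Rightarrow> ('a \<Rightarrow> real) \<Rightarrow> ennreal" where
  "psi2_norm \<Omega> \<xi> =
     Inf {ennreal t | t. t > 0 \<and> (\<integral>\<^sup>+ \<omega>. ennreal (exp ((\<xi> \<omega>)\<^sup>2 / t\<^sup>2)) \<partial>\<Omega>) \<le> 2}"

definition psi2_norm_vec :: "nat \<Rightarrow> 'a measure \<Rightarrow> ('a \<Rightarrow> rvec) \<Rightarrow> ennreal" where
  "psi2_norm_vec d \<Omega> X =
     (SUP v\<in>{v. L2_set v {..<d} = 1}. psi2_norm \<Omega> (\<lambda>\<omega>. \<Sum>i<d. X \<omega> i * v i))"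

definition mean_vec :: "rvec measure \<Rightarrow> rvec" where
  "mean_vec P = (\<lambda>i. \<integral>x. x i \<partial>P)"

definition cov_mat :: "rvec measure \<Rightarrow> rmat" where
  "cov_mat P = (\<lambda>i j. \<integral>x. (x i - mean_vec P i) * (x j - mean_vec P j) \<partial>P)"


section \<open>Covariance classes and the statistical model\<close>

definition decay_class :: "real \<Rightarrow> real \<Rightarrow> real \<Rightarrow> nat \<Rightarrow> rmat set" where
  "decay_class \<alpha> M0 M d = {S. psd d S \<and> psd d (\<lambda>i j. scaled_id M0 i j - S i j) \<and>
     (\<forall>i<d. \<forall>j<d. i \<noteq> j \<longrightarrow> \<bar>S i j\<bar> \<le> M * \<bar>real i - real j\<bar> powr (-(\<alpha> + 1)))}"

definition row_tail_class :: "real \<Rightarrow> real \<Rightarrow> real \<Rightarrow> nat \<Rightarrow> rmat set" where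
  "row_tail_class \<alpha> M0 M d = {S. psd d S \<and> psd d (\<lambda>i j. scaled_id M0 i j - S i j) \<and>
     (\<forall>k\<ge>1. \<forall>j<d.
        (\<Sum>i | i < d \<and> \<bar>int i - int j\<bar> > int k. \<bar>S i j\<bar>) \<le> M * real k powr (-\<alpha>))}"

text \<open>
  The finite sub-Gaussian norm forces all moments to exist, so the integrals in \<open>mean_vec\<close> and
  \<open>cov_mat\<close> never take the default value 0 of a non-integrable function for a member of the model.
\<close>

definition subgauss_model :: "real \<Rightarrow> nat \<Rightarrow> rmat set \<Rightarrow> rvec measure set" where
  "subgauss_model K d \<S> = {P. prob_space P \<and> sets P = sets (vec_space d) \<and>
     psi2_norm_vec d P (\<lambda>x i. x i - mean_vec P i) \<le> ennreal K \<and> cov_mat P \<in> \<S>}"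


section \<open>Zero-concentrated differential privacy\<close>

text \<open>
  Here \<open>RN_deriv Q P\<close> is the density dP/dQ; \<open>absolutely_continuous Q P\<close> means \<open>P \<lless> Q\<close>.
\<close>

definition renyi_integral :: "real \<Rightarrow> 'a measure \<Rightarrow> 'a measure \<Rightarrow> ennreal" where
  "renyi_integral l P Q = (\<integral>\<^sup>+ x. ennreal (enn2real (RN_deriv Q P x) powr l) \<partial>Q)"

definition renyi_div :: "real \<Rightarrow> 'a measure \<Rightarrow> 'a measure \<Rightarrow> ereal" where
  "renyi_div l P Q =
     (if absolutely_continuous Q P \<and> renyi_integral l P Q < \<infinity>
      then ereal (1 / (l - 1) * ln (enn2real (renyi_integral l P Q))) else \<infinity>)"

definition adjacent :: "nat \<Rightarrow> nat \<Rightarrow> (nat \<Rightarrow> rvec) \<Rightarrow> (nat \<Rightarrow> rvec) \<Rightarrow> bool" where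
  "adjacent n d S S' \<longleftrightarrow> S \<in> space (dataset_space n d) \<and> S' \<in> space (dataset_space n d) \<and>
     card {i. i < n \<and> S i \<noteq> S' i} = 1"

text \<open>
  A randomized estimator is a Markov kernel from datasets to matrices: \<open>A S\<close> is the law of the
  output on the dataset \<open>S\<close> over the internal randomness only. Outputs need not be symmetric.
\<close>

definition zcdp_estimators :: "real \<Rightarrow> nat \<Rightarrow> nat \<Rightarrow> ((nat \<Rightarrow> rvec) \<Rightarrow> rmat measure) set" where
  "zcdp_estimators \<rho> n d =
     {A. A \<in> measurable (dataset_space n d) (prob_algebra (mat_space d)) \<and>
        (\<forall>S S'. adjacent n d S S' \<longrightarrow>
           (\<forall>l>1. renyi_div l (A S) (A S') \<le> ereal (\<rho> * l)))}"


section \<open>Minimax risk and rate\<close>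

definition risk :: "nat \<Rightarrow> nat \<Rightarrow> ((nat \<Rightarrow> rvec) \<Rightarrow> rmat measure) \<Rightarrow> rvec measure \<Rightarrow> ennreal" where
  "risk n d A P =
     (\<integral>\<^sup>+ S. (\<integral>\<^sup>+ B. ennreal ((spectral_norm d (\<lambda>i j. B i j - cov_mat P i j))\<^sup>2) \<partial>A S)
        \<partial>(PiM {..<n} (\<lambda>_. P)))"

definition minimax_risk :: "real \<Rightarrow> nat \<Rightarrow> nat \<Rightarrow> rvec measure set \<Rightarrow> ennreal" where
  "minimax_risk \<rho> n d \<P> = (INF A\<in>zcdp_estimators \<rho> n d. SUP P\<in>\<P>. risk n d A P)"

text \<open>
  The index set is empty for \<open>d < 4\<close>, where the real-valued supremum is unspecified; this does
  not occur in the asymptotic regime, in which \<open>d\<close> tends to infinity.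
\<close>

definition Q_fun :: "real \<Rightarrow> nat \<Rightarrow> real \<Rightarrow> real" where
  "Q_fun \<alpha> d u =
     (SUP (k, r)\<in>{(k::nat, r::nat). 1 \<le> k \<and> k \<le> d div 4 \<and> 1 \<le> r \<and> r \<le> k}.
        min (real k powr (-2 * \<alpha>) / real r) (u * real k * real r))"

text \<open>
  \<open>a\<close> is the constant in \<open>d \<greaterapprox> log n\<close> and \<open>b\<close> the fixed upper bound on \<open>\<rho>\<close>.
\<close>

definition regime :: "real \<Rightarrow> real \<Rightarrow> (nat \<Rightarrow> nat) \<Rightarrow> (nat \<Rightarrow> real) \<Rightarrow> bool" where
  "regime a b d \<rho> \<longleftrightarrow>
     (\<forall>\<^sub>F n in sequentially. real (d n) \<ge> a * ln (real n)) \<and>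
     (\<forall>\<^sub>F n in sequentially. 0 < \<rho> n \<and> \<rho> n \<le> b) \<and>
     (\<lambda>n. real (d n) / (\<rho> n * (real n)\<^sup>2)) \<longlonglongrightarrow> 0"

end

theory Submission
  imports Defs
begin

text \<open>
The sum on the right is bounded by bounding each of its two terms, up to a constant, by the risk
of an arbitrary private estimator. Both bounds use one family of laws and one Bayesian argument;
only the last estimate differs.

The coordinates are cut into blocks of length \<open>2k\<close>. In each block the second
half consists of independent fair signs, the predictors, of which \<open>r\<close> groups of \<open>m = k div r\<close>
consecutive ones are used. The first half consists of signs, the responses, which are independent
given the predictors; the response \<open>i\<close> has conditional mean \<open>a\<close> times the sum over the groups \<open>q\<close>
of \<open>\<theta> (i, q)\<close> times the sum of group \<open>q\<close>. Coordinates after the last full block are further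
independent fair signs. The parameter \<open>\<theta>\<close> ranges over \<open>[-1, 1]\<close> to the number
\<open>N\<close> of pairs of a response and a group, and the data are these signs times a small constant \<open>s\<close>.
The covariance of response \<open>i\<close> and a predictor in group \<open>q\<close> is exactly \<open>s\<^sup>2 a \<theta> (i, q)\<close>, so
\<open>a \<le> (2k) powr -(\<alpha> + 1)\<close> puts the covariance matrix into both classes. The same bound gives
\<open>a k \<le> 1/2\<close>, which keeps the conditional means in \<open>[-1/2, 1/2]\<close> and the laws sub-Gaussian
(\<open>law_in_model\<close>). The parameter acts through the column sums over groups, so a spectral error
controls the squared parameter error: one group in one block gives a unit vector that sees \<open>k\<close>
parameters, and averaging over all groups and blocks loses only the factor \<open>1 / (B r)\<close> for \<open>B\<close>
blocks (\<open>spectral_error_ge\<close>).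

Let \<open>\<theta>\<close> be uniform on the cube and let the estimate \<open>g\<close> have
conditional mean \<open>G\<close> given the data. Integrating \<open>d/dt ((1 - t\<^sup>2) f(t))\<close> over \<open>[-1, 1]\<close> gives zero;
with \<open>f\<close> the expectation of \<open>G\<close> as a function of one parameter, this turns \<open>2 E (\<theta>\<^sub>j G\<^sub>j)\<close> into the
expectation of \<open>(1 - \<theta>\<^sub>j\<^sup>2) G\<^sub>j\<close> times the score. An estimate close to \<open>\<theta>\<close> must therefore correlate
with the score, and if the total correlation is at most \<open>N / 6\<close> for every \<open>\<theta>\<close>, some \<open>\<theta>\<close> has squared
error at least \<open>N / 12\<close> (\<open>bayes_correlation\<close>).

The Fisher information matrix of one observation is at most
\<open>\<I> = (4/3) a\<^sup>2 m\<close> times the identity. For every estimator the correlation is at most \<open>N / 6\<close> once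
\<open>36 n \<I> \<le> 1\<close> (\<open>correlation_le_of_small_information\<close>). For a private estimator, replacing one
observation by a fresh copy changes the law of the output only by a chi-square distance of order
\<open>\<rho>\<close>, and after the replacement the output is independent of the score of that observation. This
fingerprinting argument gives \<open>N / 6\<close> once \<open>n\<^sup>2 \<rho> \<I>\<close> is at most a constant times \<open>N\<close>
(\<open>correlation_le_of_privacy\<close>); since \<open>N\<close> is of order \<open>d r\<close>, the information of a parameter may be
larger by this factor than a test of a single parameter would allow.

Together the risk is at least of order \<open>a\<^sup>2 k\<^sup>2 / r\<close> (\<open>block_design_risk\<close>). With \<open>r = 1\<close>,
\<open>a\<^sup>2\<close> of order \<open>1 / (n k)\<close> and \<open>k\<close> of order \<open>min (n powr (1 / (2\<alpha> + 1))) d\<close> this is the first term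
(\<open>sampling_lower_bound\<close>). With arbitrary \<open>k\<close> and \<open>r\<close> and \<open>a\<^sup>2\<close> of order
\<open>min (k powr (-2\<alpha> - 2)) (d r\<^sup>2 / (\<rho> n\<^sup>2 k))\<close> it is the corresponding member of the supremum in \<open>Q_fun\<close>
(\<open>privacy_lower_bound\<close>).
\<close>

section \<open>The uniform prior on a cube\<close>

text \<open>
The uniform law on \<open>[-1, 1]\<close> as a measure whose space is the interval itself, so that points of
the product space satisfy the parameter constraint everywhere and not just almost everywhere.
\<close>

definition unif_coord :: "real measure" where
  "unif_coord = density (restrict_space lborel {-1..1}) (\<lambda>_. ennreal (1/2))"

lemma space_unif_coord [simp]: "space unif_coord = {-1..1}"
  by (simp add: unif_coord_def space_restrict_space)

lemma prob_space_unif_coord: "prob_space unif_coord"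
proof (rule prob_spaceI)
  have "emeasure unif_coord {-1..1} = ennreal (1/2) * emeasure (restrict_space lborel {-1..1}) {-1..1::real}"
    unfolding unif_coord_def by (rule emeasure_density_const) (auto simp: sets_restrict_space)
  also have "\<dots> = ennreal (1/2) * ennreal 2"
    by (subst emeasure_restrict_space) auto
  also have "\<dots> = 1" by (subst ennreal_mult''[symmetric]) auto
  finally show "emeasure unif_coord (space unif_coord) = 1" by simp
qed

lemma integral_unif_coord_FTC:
  assumes "\<And>t. t \<in> {-1..1} \<Longrightarrow> (F has_real_derivative f t) (at t)"
    and "\<And>t. t \<in> {-1..1} \<Longrightarrow> isCont f t"
  shows "(\<integral>t. f t \<partial>unif_coord) = (F 1 - F (-1)) / 2"
proof -
  have "continuous_on {-1..1} f"
    using assms(2) by (intro continuous_at_imp_continuous_on) auto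
  then have [measurable]: "f \<in> borel_measurable (restrict_space lborel {-1..1})"
    using borel_measurable_continuous_on_restrict
    by (subst measurable_cong_sets[OF sets_restrict_space_cong[OF sets_lborel] refl])
  have "(\<integral>t. f t \<partial>unif_coord) = (\<integral>t. (1/2) *\<^sub>R f t \<partial>restrict_space lborel {-1..1})"
    unfolding unif_coord_def by (rule integral_density) auto
  also have "\<dots> = (\<integral>t. f t \<partial>restrict_space lborel {-1..1}) / 2" by simp
  also have "(\<integral>t. f t \<partial>restrict_space lborel {-1..1}) = (\<integral>t. f t * indicator {-1..1} t \<partial>lborel)"
    by (subst integral_restrict_space) (auto simp: mult.commute)
  also have "\<dots> = F 1 - F (-1)"
    using assms by (intro integral_FTC_Icc_real) auto
  finally show ?thesis .
qed

definition cube_prior :: "'j set \<Rightarrow> ('j \<Rightarrow> real) measure" where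
  "cube_prior J = PiM J (\<lambda>_. unif_coord)"

lemma space_cube_prior: "space (cube_prior J) = PiE J (\<lambda>_. {-1..1})"
  by (simp add: cube_prior_def space_PiM)

lemma prob_space_cube_prior: "prob_space (cube_prior J)"
  unfolding cube_prior_def by (rule prob_space_PiM) (rule prob_space_unif_coord)

lemma measurable_cube_prior_component:
  assumes "j \<in> J"
  shows "(\<lambda>\<theta>. \<theta> j) \<in> borel_measurable (cube_prior J)"
proof -
  have "(\<lambda>t. t) \<in> borel_measurable unif_coord"
    unfolding unif_coord_def by (simp add: measurable_restrict_space1)
  from measurable_compose[OF measurable_component_singleton[OF assms] this]
  show ?thesis unfolding cube_prior_def by simp
qed

lemma integral_cube_prior_coord:
  fixes F :: "('j \<Rightarrow> real) \<Rightarrow> real"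
  assumes "finite J" "j \<in> J" "integrable (cube_prior J) F"
  shows "(\<integral>\<theta>. F \<theta> \<partial>cube_prior J) =
    (\<integral>\<eta>. (\<integral>t. F (\<eta>(j := t)) \<partial>unif_coord) \<partial>cube_prior (J - {j}))"
proof -
  interpret product_sigma_finite "\<lambda>_. unif_coord"
    by (simp add: product_sigma_finite_def prob_space_imp_sigma_finite prob_space_unif_coord)
  have J: "insert j (J - {j}) = J" using assms(2) by auto
  show ?thesis
    using product_integral_insert[of "J - {j}" j F] assms(1,3) unfolding cube_prior_def J by simp
qed

lemma integrable_cube_prior_square:
  assumes "j \<in> J"
  shows "integrable (cube_prior J) (\<lambda>\<theta>. (\<theta> j)\<^sup>2)"
proof -
  interpret prob_space "cube_prior J" by (rule prob_space_cube_prior)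
  note [measurable] = measurable_cube_prior_component[OF assms]
  have "\<bar>\<theta> j\<bar> \<le> 1" if "\<theta> \<in> space (cube_prior J)" for \<theta>
    using that assms by (auto simp: space_cube_prior PiE_iff abs_le_iff)
  then have "norm ((\<theta> j)\<^sup>2) \<le> 1" if "\<theta> \<in> space (cube_prior J)" for \<theta>
    using that by (simp add: abs_square_le_1)
  then show ?thesis
    by (intro integrable_const_bound[where B=1] AE_I2) simp_all
qed

lemma integral_cube_prior_square:
  assumes "finite J" "j \<in> J"
  shows "(\<integral>\<theta>. (\<theta> j)\<^sup>2 \<partial>cube_prior J) = 1/3"
proof -
  interpret R: prob_space "cube_prior (J - {j})" by (rule prob_space_cube_prior)
  note int = integrable_cube_prior_square[OF assms(2)]
  have "(\<integral>t. t\<^sup>2 \<partial>unif_coord) = (1^3/3 - (-1)^3/3) / (2::real)"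
    by (rule integral_unif_coord_FTC) (auto intro!: derivative_eq_intros)
  then show ?thesis
    by (subst integral_cube_prior_coord[OF assms int]) (simp add: R.prob_space)
qed

text \<open>
The weight \<open>1 - t\<^sup>2\<close> vanishes at both ends of \<open>[-1, 1]\<close>, so the derivative of \<open>(1 - t\<^sup>2) F\<close> in one
coordinate integrates to zero. This is the step that makes a derivative, hence a score, appear.
\<close>

lemma cube_prior_integration_by_parts:
  fixes F F' :: "('j \<Rightarrow> real) \<Rightarrow> real"
  assumes J: "finite J" "j \<in> J"
    and int: "integrable (cube_prior J) (\<lambda>\<theta>. \<theta> j * F \<theta>)"
      "integrable (cube_prior J) (\<lambda>\<theta>. (1 - (\<theta> j)\<^sup>2) * F' \<theta>)"
    and der: "\<And>\<theta> t. ((\<lambda>t. F (\<theta>(j := t))) has_real_derivative F' (\<theta>(j := t))) (at t)"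
    and cont: "\<And>\<theta> t. isCont (\<lambda>t. F' (\<theta>(j := t))) t"
  shows "(\<integral>\<theta>. (1 - (\<theta> j)\<^sup>2) * F' \<theta> \<partial>cube_prior J) = 2 * (\<integral>\<theta>. \<theta> j * F \<theta> \<partial>cube_prior J)"
proof -
  let ?D = "\<lambda>\<theta>. (1 - (\<theta> j)\<^sup>2) * F' \<theta> - 2 * (\<theta> j * F \<theta>)"
  have intD: "integrable (cube_prior J) ?D"
    using int by (intro Bochner_Integration.integrable_diff integrable_mult_right) auto
  have "(\<integral>t. ?D (\<eta>(j := t)) \<partial>unif_coord) = 0" for \<eta>
  proof -
    let ?F = "\<lambda>t. (1 - t\<^sup>2) * F (\<eta>(j := t))"
    have cF: "isCont (\<lambda>t. F (\<eta>(j := t))) t" for t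
      using der by (rule DERIV_isCont)
    have "(\<integral>t. ?D (\<eta>(j := t)) \<partial>unif_coord) = (?F 1 - ?F (-1)) / 2"
    proof (rule integral_unif_coord_FTC)
      fix t :: real
      show "(?F has_real_derivative ?D (\<eta>(j := t))) (at t)"
        by (auto intro!: derivative_eq_intros der)
      show "isCont (\<lambda>t. ?D (\<eta>(j := t))) t"
        unfolding fun_upd_same by (intro continuous_intros cont cF)
    qed
    then show ?thesis by simp
  qed
  then have "(\<integral>\<theta>. ?D \<theta> \<partial>cube_prior J) = 0"
    by (subst integral_cube_prior_coord[OF J intD]) simp
  then show ?thesis
    using int by simp
qed

section \<open>Smooth statistical models and the Bayes bound\<close>

text \<open>
An observation and an independent fresh copy of it can be exchanged: the map
\<open>(S, x) \<mapsto> (S(i := x), S i)\<close> is an involution that preserves the product weight.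
\<close>

lemma sum_PiE_resample:
  fixes p :: "'x \<Rightarrow> real" and F :: "('i \<Rightarrow> 'x) \<Rightarrow> 'x \<Rightarrow> real"
  assumes I: "finite I" "i \<in> I"
  shows "(\<Sum>S\<in>PiE I (\<lambda>_. \<Omega>). \<Sum>x\<in>\<Omega>. (\<Prod>l\<in>I. p (S l)) * p x * F (S(i := x)) (S i)) =
         (\<Sum>S\<in>PiE I (\<lambda>_. \<Omega>). \<Sum>x\<in>\<Omega>. (\<Prod>l\<in>I. p (S l)) * p x * F S x)"
proof -
  let ?X = "PiE I (\<lambda>_. \<Omega>) \<times> \<Omega>"
  let ?h = "\<lambda>(S, x). (S(i := x), S i)"
  have rest: "(\<Prod>l\<in>I. p ((S(i := x)) l)) * p (S i) = (\<Prod>l\<in>I. p (S l)) * p x" for S x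
  proof -
    have "(\<Prod>l\<in>I - {i}. p ((S(i := x)) l)) = (\<Prod>l\<in>I - {i}. p (S l))"
      by (intro prod.cong) auto
    then show ?thesis
      using prod.remove[OF I, of "\<lambda>l. p (S l)"] prod.remove[OF I, of "\<lambda>l. p ((S(i := x)) l)"]
      by simp
  qed
  have swap: "?h z \<in> ?X" "?h (?h z) = z" if "z \<in> ?X" for z
    using I that by (auto simp: PiE_iff extensional_def split: prod.splits)
  have weight: "(case ?h z of (S, x) \<Rightarrow> (\<Prod>l\<in>I. p (S l)) * p x * F S x) =
      (case z of (S, x) \<Rightarrow> (\<Prod>l\<in>I. p (S l)) * p x * F (S(i := x)) (S i))" for z
    by (simp only: rest split_beta fst_conv snd_conv)
  have "(\<Sum>(S, x)\<in>?X. (\<Prod>l\<in>I. p (S l)) * p x * F (S(i := x)) (S i)) =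
        (\<Sum>(S, x)\<in>?X. (\<Prod>l\<in>I. p (S l)) * p x * F S x)"
    by (rule sum.reindex_bij_witness[where i = ?h and j = ?h]) ((rule swap, assumption) | rule weight)+
  then show ?thesis by (simp add: sum.cartesian_product)
qed

text \<open>
A family of probability vectors on a finite set, indexed by the cube \<open>[-1, 1]\<close> to the \<open>J\<close>, that is
affine in each single parameter; \<open>dp\<close> holds the partial derivatives and \<open>sc\<close> the scores. The last
condition says that the Fisher information matrix is at most \<open>\<I>\<close> times the identity. Affinity is
required for all real parameter values, so that two-sided derivatives exist at the ends of the
interval.
\<close>

locale smooth_model =
  fixes \<Omega> :: "'x set" and J :: "'j set"
    and p :: "('j \<Rightarrow> real) \<Rightarrow> 'x \<Rightarrow> real"
    and dp :: "('j \<Rightarrow> real) \<Rightarrow> 'x \<Rightarrow> 'j \<Rightarrow> real"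
    and sc :: "('j \<Rightarrow> real) \<Rightarrow> 'x \<Rightarrow> 'j \<Rightarrow> real"
    and \<I> :: real
  assumes finite_\<Omega>: "finite \<Omega>" and finite_J: "finite J" and info_nonneg: "0 \<le> \<I>"
    and p_nonneg: "\<And>\<theta> x. \<theta> \<in> PiE J (\<lambda>_. {-1..1}) \<Longrightarrow> x \<in> \<Omega> \<Longrightarrow> 0 \<le> p \<theta> x"
    and p_sum: "\<And>\<theta>. \<theta> \<in> PiE J (\<lambda>_. {-1..1}) \<Longrightarrow> (\<Sum>x\<in>\<Omega>. p \<theta> x) = 1"
    and p_measurable: "\<And>x. x \<in> \<Omega> \<Longrightarrow> (\<lambda>\<theta>. p \<theta> x) \<in> borel_measurable (cube_prior J)"
    and dp_measurable: "\<And>x j. x \<in> \<Omega> \<Longrightarrow> j \<in> J \<Longrightarrow> (\<lambda>\<theta>. dp \<theta> x j) \<in> borel_measurable (cube_prior J)"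
    and p_affine: "\<And>\<theta> x j t. x \<in> \<Omega> \<Longrightarrow> j \<in> J \<Longrightarrow> p (\<theta>(j := t)) x = p \<theta> x + (t - \<theta> j) * dp \<theta> x j"
    and dp_upd: "\<And>\<theta> x j t. x \<in> \<Omega> \<Longrightarrow> j \<in> J \<Longrightarrow> dp (\<theta>(j := t)) x j = dp \<theta> x j"
    and dp_score: "\<And>\<theta> x j. \<theta> \<in> PiE J (\<lambda>_. {-1..1}) \<Longrightarrow> x \<in> \<Omega> \<Longrightarrow> j \<in> J \<Longrightarrow> dp \<theta> x j = p \<theta> x * sc \<theta> x j"
    and score_mean: "\<And>\<theta> j. \<theta> \<in> PiE J (\<lambda>_. {-1..1}) \<Longrightarrow> j \<in> J \<Longrightarrow> (\<Sum>x\<in>\<Omega>. p \<theta> x * sc \<theta> x j) = 0"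
    and fisher: "\<And>\<theta> c. \<theta> \<in> PiE J (\<lambda>_. {-1..1}) \<Longrightarrow>
       (\<Sum>x\<in>\<Omega>. p \<theta> x * (\<Sum>j\<in>J. c j * sc \<theta> x j)\<^sup>2) \<le> \<I> * (\<Sum>j\<in>J. (c j)\<^sup>2)"
begin

abbreviation params :: "('j \<Rightarrow> real) set" where "params \<equiv> PiE J (\<lambda>_. {-1..1})"
abbreviation datasets :: "nat \<Rightarrow> (nat \<Rightarrow> 'x) set" where "datasets n \<equiv> PiE {..<n} (\<lambda>_. \<Omega>)"

definition joint :: "nat \<Rightarrow> ('j \<Rightarrow> real) \<Rightarrow> (nat \<Rightarrow> 'x) \<Rightarrow> real" where
  "joint n \<theta> S = (\<Prod>i<n. p \<theta> (S i))"

definition joint_deriv :: "nat \<Rightarrow> ('j \<Rightarrow> real) \<Rightarrow> (nat \<Rightarrow> 'x) \<Rightarrow> 'j \<Rightarrow> real" where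
  "joint_deriv n \<theta> S j = (\<Sum>i<n. dp \<theta> (S i) j * (\<Prod>l\<in>{..<n} - {i}. p \<theta> (S l)))"

lemma datasets_mem: "S \<in> datasets n \<Longrightarrow> i < n \<Longrightarrow> S i \<in> \<Omega>"
  by (auto simp: PiE_iff)

lemma joint_nonneg: "\<theta> \<in> params \<Longrightarrow> S \<in> datasets n \<Longrightarrow> 0 \<le> joint n \<theta> S"
  unfolding joint_def by (intro prod_nonneg) (auto intro!: p_nonneg dest: datasets_mem)

lemma joint_sum: "\<theta> \<in> params \<Longrightarrow> (\<Sum>S\<in>datasets n. joint n \<theta> S) = 1"
  unfolding joint_def using prod_sum_PiE[of "{..<n}" "\<lambda>_. \<Omega>" "\<lambda>_. p \<theta>"]
  by (simp add: finite_\<Omega> p_sum)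

lemma p_le_1: "\<theta> \<in> params \<Longrightarrow> x \<in> \<Omega> \<Longrightarrow> p \<theta> x \<le> 1"
  using member_le_sum[of x \<Omega> "p \<theta>"] by (simp add: p_nonneg p_sum finite_\<Omega>)

lemma dp_bound:
  assumes "\<theta> \<in> params" "x \<in> \<Omega>" "j \<in> J"
  shows "\<bar>dp \<theta> x j\<bar> \<le> 1"
proof -
  have "\<theta>(j := t) \<in> params" if "t \<in> {-1..1}" for t
    using assms that by (auto simp: PiE_iff extensional_def)
  then have "p (\<theta>(j := 1)) x \<in> {0..1}" "p (\<theta>(j := -1)) x \<in> {0..1}"
    using assms p_nonneg[of _ x] p_le_1[of _ x] by force+
  moreover have "p (\<theta>(j := 1)) x - p (\<theta>(j := -1)) x = 2 * dp \<theta> x j"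
    using assms p_affine[of x j \<theta> 1] p_affine[of x j \<theta> "-1"] by (simp add: algebra_simps)
  ultimately show ?thesis by auto
qed

lemma joint_deriv_score:
  assumes "\<theta> \<in> params" "S \<in> datasets n" "j \<in> J"
  shows "joint_deriv n \<theta> S j = joint n \<theta> S * (\<Sum>i<n. sc \<theta> (S i) j)"
  unfolding joint_deriv_def joint_def sum_distrib_left
proof (rule sum.cong[OF refl])
  fix i assume i: "i \<in> {..<n}"
  show "dp \<theta> (S i) j * (\<Prod>l\<in>{..<n} - {i}. p \<theta> (S l)) = (\<Prod>l<n. p \<theta> (S l)) * sc \<theta> (S i) j"
    using i assms by (subst prod.remove[of "{..<n}" i]) (auto simp: dp_score datasets_mem)
qed

lemma joint_has_deriv:
  assumes "S \<in> datasets n" "j \<in> J"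
  shows "((\<lambda>t. joint n (\<theta>(j := t)) S) has_real_derivative joint_deriv n (\<theta>(j := t)) S j) (at t)"
  unfolding joint_def joint_deriv_def
proof (rule has_field_derivative_prod)
  fix i assume "i \<in> {..<n}"
  then have S: "S i \<in> \<Omega>" using assms by (auto dest: datasets_mem)
  have "((\<lambda>t. p \<theta> (S i) + (t - \<theta> j) * dp \<theta> (S i) j) has_real_derivative dp \<theta> (S i) j) (at t)"
    by (auto intro!: derivative_eq_intros)
  then show "((\<lambda>t. p (\<theta>(j := t)) (S i)) has_real_derivative dp (\<theta>(j := t)) (S i) j) (at t)"
    using S assms by (simp only: p_affine dp_upd)
qed

lemma joint_deriv_cont:
  assumes "S \<in> datasets n" "j \<in> J"
  shows "isCont (\<lambda>t. joint_deriv n (\<theta>(j := t)) S j) t"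
proof -
  have "joint_deriv n (\<theta>(j := t)) S j = (\<Sum>i<n. dp \<theta> (S i) j * (\<Prod>l\<in>{..<n} - {i}. p \<theta> (S l) + (t - \<theta> j) * dp \<theta> (S l) j))" for t
    unfolding joint_deriv_def using assms
    by (intro sum.cong arg_cong2[where f="(*)"] prod.cong) (auto simp: p_affine dp_upd datasets_mem)
  then show ?thesis by (simp only:) (intro continuous_intros)
qed

lemma joint_bound:
  assumes "\<theta> \<in> params" "S \<in> datasets n"
  shows "\<bar>joint n \<theta> S\<bar> \<le> 1"
proof -
  have "joint n \<theta> S \<le> 1"
    unfolding joint_def using assms
    by (intro prod_le_1) (auto simp: p_nonneg p_le_1 datasets_mem)
  then show ?thesis using joint_nonneg[OF assms] by simp
qed

lemma joint_deriv_bound: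
  assumes "\<theta> \<in> params" "S \<in> datasets n" "j \<in> J"
  shows "\<bar>joint_deriv n \<theta> S j\<bar> \<le> real n"
proof -
  have "\<bar>joint_deriv n \<theta> S j\<bar> \<le> (\<Sum>i<n. \<bar>dp \<theta> (S i) j * (\<Prod>l\<in>{..<n} - {i}. p \<theta> (S l))\<bar>)"
    unfolding joint_deriv_def by (rule sum_abs)
  also have "\<dots> \<le> (\<Sum>i<n. 1)"
  proof (rule sum_mono)
    fix i assume "i \<in> {..<n}"
    then have "\<bar>dp \<theta> (S i) j\<bar> \<le> 1" using assms by (auto intro!: dp_bound dest: datasets_mem)
    moreover have "(\<Prod>l\<in>{..<n} - {i}. p \<theta> (S l)) \<in> {0..1}"
      using assms by (auto intro!: prod_nonneg prod_le_1 simp: p_nonneg p_le_1 datasets_mem)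
    ultimately show "\<bar>dp \<theta> (S i) j * (\<Prod>l\<in>{..<n} - {i}. p \<theta> (S l))\<bar> \<le> 1"
      unfolding abs_mult by (intro mult_le_one) auto
  qed
  finally show ?thesis by simp
qed

lemma measurable_joint: "S \<in> datasets n \<Longrightarrow> (\<lambda>\<theta>. joint n \<theta> S) \<in> borel_measurable (cube_prior J)"
  unfolding joint_def by (intro borel_measurable_prod p_measurable) (auto dest: datasets_mem)

lemma measurable_joint_deriv:
  "S \<in> datasets n \<Longrightarrow> j \<in> J \<Longrightarrow> (\<lambda>\<theta>. joint_deriv n \<theta> S j) \<in> borel_measurable (cube_prior J)"
  unfolding joint_deriv_def
  by (intro borel_measurable_sum borel_measurable_times borel_measurable_prod p_measurable dp_measurable)
    (auto dest: datasets_mem)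

lemma integral_score_identity:
  assumes "S \<in> datasets n" "j \<in> J"
  shows "integrable (cube_prior J) (\<lambda>\<theta>. \<theta> j * joint n \<theta> S)" (is ?A)
    and "integrable (cube_prior J) (\<lambda>\<theta>. (1 - (\<theta> j)\<^sup>2) * joint_deriv n \<theta> S j)" (is ?B)
    and "(\<integral>\<theta>. (1 - (\<theta> j)\<^sup>2) * joint_deriv n \<theta> S j \<partial>cube_prior J) =
       2 * (\<integral>\<theta>. \<theta> j * joint n \<theta> S \<partial>cube_prior J)"
proof -
  interpret prob_space "cube_prior J" by (rule prob_space_cube_prior)
  note [measurable] = measurable_joint[OF assms(1)] measurable_joint_deriv[OF assms]
    measurable_cube_prior_component[OF assms(2)]
  have sq: "\<bar>\<theta> j\<bar> \<le> 1" "\<bar>1 - (\<theta> j)\<^sup>2\<bar> \<le> 1" if "\<theta> \<in> params" for \<theta>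
  proof -
    show "\<bar>\<theta> j\<bar> \<le> 1" using that assms by (auto simp: PiE_iff abs_le_iff)
    then have "(\<theta> j)\<^sup>2 \<le> 1" by (simp add: abs_square_le_1)
    then show "\<bar>1 - (\<theta> j)\<^sup>2\<bar> \<le> 1" by (simp add: abs_le_iff)
  qed
  have "\<bar>\<theta> j * joint n \<theta> S\<bar> \<le> 1" if "\<theta> \<in> params" for \<theta>
    unfolding abs_mult using sq joint_bound assms that by (intro mult_le_one) auto
  then show A: ?A
    by (intro integrable_const_bound[where B=1] AE_I2) (simp_all add: space_cube_prior)
  have "\<bar>(1 - (\<theta> j)\<^sup>2) * joint_deriv n \<theta> S j\<bar> \<le> 1 * real n" if "\<theta> \<in> params" for \<theta>
    unfolding abs_mult using sq joint_deriv_bound assms that by (intro mult_mono) auto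
  then show B: ?B
    by (intro integrable_const_bound[where B="real n"] AE_I2) (simp_all add: space_cube_prior)
  show "(\<integral>\<theta>. (1 - (\<theta> j)\<^sup>2) * joint_deriv n \<theta> S j \<partial>cube_prior J) =
       2 * (\<integral>\<theta>. \<theta> j * joint n \<theta> S \<partial>cube_prior J)"
    by (rule cube_prior_integration_by_parts[OF finite_J assms(2) A B])
      (rule joint_has_deriv[OF assms] joint_deriv_cont[OF assms])+
qed

text \<open>
For the uniform prior the mean of the sum of the squared parameters is \<open>N / 3\<close>, and integration by
parts rewrites twice the mean of the inner product of \<open>\<theta>\<close> and \<open>G\<close> as the mean correlation with the
score, which is at most \<open>N / 6\<close>. The difference has mean at least \<open>N / 6\<close>, so it cannot be below
\<open>N / 12\<close> everywhere. It is a lower bound for the squared error of an estimate with conditional mean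
\<open>G\<close>, because the square of the estimate is nonnegative.
\<close>

theorem bayes_correlation:
  fixes G :: "(nat \<Rightarrow> 'x) \<Rightarrow> 'j \<Rightarrow> real"
  assumes J: "J \<noteq> {}"
    and corr: "\<And>\<theta>. \<theta> \<in> params \<Longrightarrow>
      (\<Sum>S\<in>datasets n. joint n \<theta> S * (\<Sum>j\<in>J. (1 - (\<theta> j)\<^sup>2) * (\<Sum>i<n. sc \<theta> (S i) j) * G S j)) \<le> card J / 6"
  shows "\<exists>\<theta>\<in>params. (\<Sum>j\<in>J. (\<theta> j)\<^sup>2) - 2 * (\<Sum>S\<in>datasets n. joint n \<theta> S * (\<Sum>j\<in>J. \<theta> j * G S j)) \<ge> card J / 12"
proof (rule ccontr)
  interpret prob_space "cube_prior J" by (rule prob_space_cube_prior)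
  let ?a = "\<lambda>\<theta>. \<Sum>S\<in>datasets n. \<Sum>j\<in>J. G S j * (\<theta> j * joint n \<theta> S)"
  let ?b = "\<lambda>\<theta>. \<Sum>S\<in>datasets n. \<Sum>j\<in>J. G S j * ((1 - (\<theta> j)\<^sup>2) * joint_deriv n \<theta> S j)"
  let ?sq = "\<lambda>\<theta>. \<Sum>j\<in>J. (\<theta> j)\<^sup>2"
  assume "\<not> ?thesis"
  then have less: "?sq \<theta> - 2 * ?a \<theta> \<le> card J / 12" if "\<theta> \<in> params" for \<theta>
    using that by (fastforce simp: sum_distrib_left ac_simps not_le)
  have int_a: "integrable (cube_prior J) ?a" and int_b: "integrable (cube_prior J) ?b"
    by (intro Bochner_Integration.integrable_sum integrable_mult_right integral_score_identity; assumption)+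
  have int_sq1: "integrable (cube_prior J) (\<lambda>\<theta>. (\<theta> j)\<^sup>2)" if "j \<in> J" for j
    by (rule integrable_cube_prior_square[OF that])
  then have int_sq: "integrable (cube_prior J) ?sq"
    by (intro Bochner_Integration.integrable_sum)
  have eq: "(\<integral>\<theta>. ?b \<theta> \<partial>cube_prior J) = 2 * (\<integral>\<theta>. ?a \<theta> \<partial>cube_prior J)"
  proof -
    have "(\<integral>\<theta>. ?b \<theta> \<partial>cube_prior J) =
        (\<Sum>S\<in>datasets n. \<Sum>j\<in>J. G S j * (\<integral>\<theta>. (1 - (\<theta> j)\<^sup>2) * joint_deriv n \<theta> S j \<partial>cube_prior J))"
      by (simp add: Bochner_Integration.integral_sum Bochner_Integration.integrable_sum integral_score_identity(2))
    moreover have "(\<integral>\<theta>. ?a \<theta> \<partial>cube_prior J) =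
        (\<Sum>S\<in>datasets n. \<Sum>j\<in>J. G S j * (\<integral>\<theta>. \<theta> j * joint n \<theta> S \<partial>cube_prior J))"
      by (simp add: Bochner_Integration.integral_sum Bochner_Integration.integrable_sum integral_score_identity(1))
    ultimately show ?thesis
      by (simp add: integral_score_identity(3) sum_distrib_left mult.left_commute)
  qed
  have "?b \<theta> \<le> card J / 6" if "\<theta> \<in> params" for \<theta>
  proof -
    have "?b \<theta> = (\<Sum>S\<in>datasets n. joint n \<theta> S * (\<Sum>j\<in>J. (1 - (\<theta> j)\<^sup>2) * (\<Sum>i<n. sc \<theta> (S i) j) * G S j))"
      unfolding sum_distrib_left[of "joint n \<theta> _"] using that
      by (intro sum.cong refl) (simp add: joint_deriv_score)
    then show ?thesis using corr[OF that] by simp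
  qed
  then have "(\<integral>\<theta>. ?b \<theta> \<partial>cube_prior J) \<le> card J / 6"
    by (intro integral_le_const int_b AE_I2) (auto simp: space_cube_prior)
  moreover have "(\<integral>\<theta>. ?sq \<theta> \<partial>cube_prior J) = card J / 3"
    by (subst Bochner_Integration.integral_sum)
      (auto simp: int_sq1 integral_cube_prior_square finite_J)
  moreover have "(\<integral>\<theta>. ?sq \<theta> - 2 * ?a \<theta> \<partial>cube_prior J) \<le> card J / 12"
    by (intro integral_le_const Bochner_Integration.integrable_diff integrable_mult_right int_a int_sq AE_I2)
      (use less in \<open>auto simp: space_cube_prior\<close>)
  moreover have "(\<integral>\<theta>. ?sq \<theta> - 2 * ?a \<theta> \<partial>cube_prior J) =
     (\<integral>\<theta>. ?sq \<theta> \<partial>cube_prior J) - 2 * (\<integral>\<theta>. ?a \<theta> \<partial>cube_prior J)"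
    using int_a int_sq by (subst Bochner_Integration.integral_diff) auto
  moreover have "card J > 0" using J finite_J by (simp add: card_gt_0_iff)
  ultimately show False using eq by (simp add: field_simps)
qed

end

section \<open>Correlation with the score, with and without privacy\<close>

text \<open>
At order two the Renyi divergence is the logarithm of one plus the chi-square divergence. The
inequality is the nonnegativity of the second moment under \<open>Q\<close> of \<open>L - 1 - t \<phi>\<close>, where \<open>L\<close> is the
density of \<open>P\<close>. With the free parameter \<open>t\<close> it is a Cauchy-Schwarz inequality without square roots,
which can be averaged over datasets directly.
\<close>

lemma renyi_change_of_measure:
  fixes \<phi> :: "'a \<Rightarrow> real"
  assumes P: "prob_space P" and Q: "prob_space Q" and sets: "sets P = sets Q"
    and div: "renyi_div 2 P Q \<le> ereal (2 * \<rho>)"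
    and \<phi>: "\<phi> \<in> borel_measurable Q" "\<And>x. \<bar>\<phi> x\<bar> \<le> C"
  shows "2 * t * ((\<integral>x. \<phi> x \<partial>P) - (\<integral>x. \<phi> x \<partial>Q)) \<le> (exp (2 * \<rho>) - 1) + t\<^sup>2 * (\<integral>x. (\<phi> x)\<^sup>2 \<partial>Q)"
proof -
  interpret P: prob_space P by fact
  interpret Q: prob_space Q by fact
  define L where "L x = enn2real (RN_deriv Q P x)" for x
  have ac: "absolutely_continuous Q P" and fin: "renyi_integral 2 P Q < \<infinity>"
    using div by (auto simp: renyi_div_def split: if_splits)
  have L_meas [measurable]: "L \<in> borel_measurable Q" unfolding L_def by measurable
  note [measurable] = \<phi>(1)
  have L_nonneg: "0 \<le> L x" for x by (simp add: L_def)
  have RN: "AE x in Q. RN_deriv Q P x = ennreal (L x)"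
    using Q.RN_deriv_finite[OF P.sigma_finite_measure_axioms ac sets]
    by eventually_elim (auto simp: L_def less_top)
  have dens: "P = density Q (\<lambda>x. ennreal (L x))"
  proof -
    have "P = density Q (RN_deriv Q P)" using Q.density_RN_deriv[OF ac sets] by simp
    also have "\<dots> = density Q (\<lambda>x. ennreal (L x))"
      by (rule density_cong) (use RN in auto)
    finally show ?thesis .
  qed
  have "(\<integral>\<^sup>+x. ennreal (L x) \<partial>Q) = emeasure P (space P)"
    by (subst (1 2) dens) (simp add: emeasure_density cong: nn_integral_cong)
  then have L1: "has_bochner_integral Q L 1"
    by (intro has_bochner_integral_nn_integral) (auto simp: L_nonneg P.emeasure_space_1)
  define E where "E = enn2real (renyi_integral 2 P Q)"
  have "renyi_integral 2 P Q = (\<integral>\<^sup>+x. ennreal ((L x)\<^sup>2) \<partial>Q)"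
    unfolding renyi_integral_def L_def[symmetric] by (simp add: L_nonneg)
  then have L2: "has_bochner_integral Q (\<lambda>x. (L x)\<^sup>2) E"
    using fin by (intro has_bochner_integral_nn_integral) (auto simp: E_def less_top)
  have E_le: "E \<le> exp (2 * \<rho>)"
  proof (cases "E > 0")
    case True
    have "ln E \<le> 2 * \<rho>" using div ac fin by (simp add: renyi_div_def E_def split: if_splits)
    then show ?thesis using True by (metis exp_le_cancel_iff exp_ln)
  next
    case False
    then show ?thesis by (smt (verit) exp_gt_zero)
  qed
  have C: "0 \<le> C" using \<phi>(2)[of undefined] by linarith
  have int\<phi>: "integrable Q \<phi>"
    using \<phi> by (intro Q.integrable_const_bound[where B=C]) auto
  have "(\<phi> x)\<^sup>2 \<le> C\<^sup>2" for x using power_mono[OF \<phi>(2)[of x], of 2] by simp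
  then have int\<phi>2: "integrable Q (\<lambda>x. (\<phi> x)\<^sup>2)"
    by (intro Q.integrable_const_bound[where B="C\<^sup>2"]) auto
  have intL\<phi>: "integrable Q (\<lambda>x. L x * \<phi> x)"
  proof (rule Bochner_Integration.integrable_bound)
    show "integrable Q (\<lambda>x. C * L x)" using L1 by (auto simp: has_bochner_integral_iff)
    show "AE x in Q. norm (L x * \<phi> x) \<le> norm (C * L x)"
      using mult_left_mono[OF \<phi>(2) L_nonneg] L_nonneg C
      by (intro AE_I2) (simp add: abs_mult mult.commute[of C])
  qed simp
  have P\<phi>: "(\<integral>x. \<phi> x \<partial>P) = (\<integral>x. L x * \<phi> x \<partial>Q)"
    by (subst dens) (simp add: integral_density L_nonneg)
  have int: "integrable Q L" "integrable Q (\<lambda>x. (L x)\<^sup>2)" "(\<integral>x. L x \<partial>Q) = 1" "(\<integral>x. (L x)\<^sup>2 \<partial>Q) = E"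
    using L1 L2 by (auto simp: has_bochner_integral_iff)
  have "0 \<le> (\<integral>x. (L x - 1 - t * \<phi> x)\<^sup>2 \<partial>Q)" by simp
  also have "\<dots> = (\<integral>x. (L x)\<^sup>2 - 2 * L x + 1 - 2 * t * (L x * \<phi> x) + 2 * t * \<phi> x + t\<^sup>2 * (\<phi> x)\<^sup>2 \<partial>Q)"
    by (intro Bochner_Integration.integral_cong refl) (simp add: power2_eq_square algebra_simps)
  also have "\<dots> = E - 2 + 1 - 2 * t * (\<integral>x. \<phi> x \<partial>P) + 2 * t * (\<integral>x. \<phi> x \<partial>Q) + t\<^sup>2 * (\<integral>x. (\<phi> x)\<^sup>2 \<partial>Q)"
    using int int\<phi> int\<phi>2 intL\<phi> by (simp add: P\<phi> Q.prob_space)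
  finally show ?thesis using E_le by (simp add: algebra_simps)
qed

context smooth_model
begin

lemma expectation_resample:
  assumes "\<theta> \<in> params" "i < n"
  shows "(\<Sum>S\<in>datasets n. \<Sum>x\<in>\<Omega>. joint n \<theta> S * p \<theta> x * F (S(i := x)) (S i)) =
         (\<Sum>S\<in>datasets n. \<Sum>x\<in>\<Omega>. joint n \<theta> S * p \<theta> x * F S x)"
  unfolding joint_def using assms by (intro sum_PiE_resample) auto

lemma expectation_add_sample:
  assumes "\<theta> \<in> params"
  shows "(\<Sum>S\<in>datasets n. joint n \<theta> S * h S) = (\<Sum>S\<in>datasets n. \<Sum>x\<in>\<Omega>. joint n \<theta> S * p \<theta> x * h S)"
  by (simp add: sum_distrib_left[symmetric] sum_distrib_right[symmetric] p_sum[OF assms])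

lemma expectation_one_sample:
  assumes "\<theta> \<in> params" "i < n"
  shows "(\<Sum>S\<in>datasets n. joint n \<theta> S * h (S i)) = (\<Sum>x\<in>\<Omega>. p \<theta> x * h x)"
proof -
  have "(\<Sum>S\<in>datasets n. joint n \<theta> S * h (S i)) = (\<Sum>S\<in>datasets n. \<Sum>x\<in>\<Omega>. joint n \<theta> S * p \<theta> x * h x)"
    using expectation_resample[OF assms, of "\<lambda>S x. h x"] by (simp add: expectation_add_sample[OF assms(1)])
  also have "\<dots> = (\<Sum>S\<in>datasets n. joint n \<theta> S) * (\<Sum>x\<in>\<Omega>. p \<theta> x * h x)"
    by (simp add: sum_product mult.assoc)
  finally show ?thesis by (simp add: joint_sum assms)
qed

text \<open>
Scores of different observations are uncorrelated, so the information of the sample is \<open>n\<close> times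
that of one observation.
\<close>

lemma total_score_variance:
  assumes \<theta>: "\<theta> \<in> params" and j: "j \<in> J"
  shows "(\<Sum>S\<in>datasets n. joint n \<theta> S * (\<Sum>i<n. sc \<theta> (S i) j)\<^sup>2) \<le> real n * \<I>"
proof -
  have diag: "(\<Sum>S\<in>datasets n. joint n \<theta> S * (sc \<theta> (S i) j * sc \<theta> (S i) j)) \<le> \<I>" if "i < n" for i
  proof -
    have "(\<Sum>k\<in>J. of_bool (k = j) * sc \<theta> x k) = sc \<theta> x j" for x
      using j finite_J by (simp add: sum.remove[of J j] of_bool_def)
    moreover have "(\<Sum>k\<in>J. (of_bool (k = j) :: real)\<^sup>2) = 1"
      using j finite_J by (simp add: sum.remove[of J j] of_bool_def)
    ultimately show ?thesis
      using fisher[OF \<theta>, of "\<lambda>k. of_bool (k = j)"] expectation_one_sample[OF \<theta> that, of "\<lambda>x. sc \<theta> x j * sc \<theta> x j"]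
      by (simp add: power2_eq_square)
  qed
  have off: "(\<Sum>S\<in>datasets n. joint n \<theta> S * (sc \<theta> (S i) j * sc \<theta> (S l) j)) = 0"
    if il: "i < n" "l < n" "i \<noteq> l" for i l
  proof -
    have "(\<Sum>S\<in>datasets n. joint n \<theta> S * (sc \<theta> (S i) j * sc \<theta> (S l) j)) =
      (\<Sum>S\<in>datasets n. \<Sum>x\<in>\<Omega>. joint n \<theta> S * p \<theta> x * (sc \<theta> x j * sc \<theta> (S l) j))"
      using expectation_resample[OF \<theta> il(1), of "\<lambda>S x. sc \<theta> x j * sc \<theta> (S l) j"] il
      by (simp add: expectation_add_sample[OF \<theta>])
    also have "\<dots> = (\<Sum>S\<in>datasets n. joint n \<theta> S * sc \<theta> (S l) j * (\<Sum>x\<in>\<Omega>. p \<theta> x * sc \<theta> x j))"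
      by (simp add: sum_distrib_left mult_ac)
    finally show ?thesis by (simp add: score_mean \<theta> j)
  qed
  have "(\<Sum>S\<in>datasets n. joint n \<theta> S * (\<Sum>i<n. sc \<theta> (S i) j)\<^sup>2) =
     (\<Sum>S\<in>datasets n. \<Sum>i<n. \<Sum>l<n. joint n \<theta> S * (sc \<theta> (S i) j * sc \<theta> (S l) j))"
  proof -
    have "T\<^sup>2 = (\<Sum>i<n. \<Sum>l<n. f i * f l)" if "T = (\<Sum>i<n. f i)" for T and f :: "nat \<Rightarrow> real"
      unfolding that power2_eq_square by (rule sum_product)
    then show ?thesis by (simp add: sum_distrib_left)
  qed
  also have "\<dots> = (\<Sum>i<n. \<Sum>l<n. \<Sum>S\<in>datasets n. joint n \<theta> S * (sc \<theta> (S i) j * sc \<theta> (S l) j))"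
    by (simp add: sum.swap[of _ "datasets n"])
  also have "\<dots> = (\<Sum>i<n. \<Sum>S\<in>datasets n. joint n \<theta> S * (sc \<theta> (S i) j * sc \<theta> (S i) j))"
    by (intro sum.cong refl, subst sum.remove[of "{..<n}"]) (auto simp: off intro!: sum.neutral)
  also have "\<dots> \<le> (\<Sum>i<n. \<I>)" by (intro sum_mono diag) simp
  finally show ?thesis by simp
qed

lemma param_weight:
  assumes "\<theta> \<in> params" "j \<in> J"
  shows "0 \<le> 1 - (\<theta> j)\<^sup>2" "1 - (\<theta> j)\<^sup>2 \<le> 1"
proof -
  have "\<bar>\<theta> j\<bar> \<le> 1" using assms by (auto simp: PiE_iff abs_le_iff)
  then show "0 \<le> 1 - (\<theta> j)\<^sup>2" by (simp add: abs_square_le_1)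
qed simp

text \<open>
For every estimator: the score of the whole sample has variance at most \<open>n \<I>\<close> in each coordinate,
and the estimate is bounded by one.
\<close>

lemma correlation_le_of_small_information:
  assumes \<theta>: "\<theta> \<in> params" and G: "\<And>S j. S \<in> datasets n \<Longrightarrow> j \<in> J \<Longrightarrow> \<bar>G S j\<bar> \<le> 1"
    and small: "36 * real n * \<I> \<le> 1"
  shows "(\<Sum>S\<in>datasets n. joint n \<theta> S * (\<Sum>j\<in>J. (1 - (\<theta> j)\<^sup>2) * (\<Sum>i<n. sc \<theta> (S i) j) * G S j)) \<le> card J / 6"
proof -
  \<comment> \<open>the weight \<open>3\<close> splits \<open>1/6\<close> evenly: \<open>3 n \<I> \<le> 1/12\<close> by assumption\<close>
  have amgm: "c * T * g \<le> 3 * T\<^sup>2 + 1/12" if "0 \<le> c" "c \<le> 1" "\<bar>g\<bar> \<le> 1" for c T g :: real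
  proof -
    have "\<bar>c * g\<bar> \<le> 1" using that by (simp add: abs_mult mult_le_one)
    then have "(c * g)\<^sup>2 \<le> 1" by (simp add: abs_square_le_1)
    moreover have "0 \<le> 3 * (T - c * g / 6)\<^sup>2" by simp
    ultimately show ?thesis by (simp add: power2_eq_square algebra_simps)
  qed
  have "(\<Sum>S\<in>datasets n. joint n \<theta> S * (\<Sum>j\<in>J. (1 - (\<theta> j)\<^sup>2) * (\<Sum>i<n. sc \<theta> (S i) j) * G S j)) \<le>
      (\<Sum>S\<in>datasets n. joint n \<theta> S * (\<Sum>j\<in>J. 3 * (\<Sum>i<n. sc \<theta> (S i) j)\<^sup>2 + 1/12))"
    by (intro sum_mono mult_left_mono amgm joint_nonneg param_weight \<theta> G)
  also have "\<dots> = 3 * (\<Sum>j\<in>J. \<Sum>S\<in>datasets n. joint n \<theta> S * (\<Sum>i<n. sc \<theta> (S i) j)\<^sup>2)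
     + (\<Sum>S\<in>datasets n. joint n \<theta> S) * (card J / 12)"
    by (simp add: sum.distrib distrib_left sum_distrib_left sum_distrib_right sum.swap[of _ J "datasets n"] mult_ac)
  also have "\<dots> \<le> 3 * (\<Sum>j\<in>J. real n * \<I>) + 1 * (card J / 12)"
    by (intro add_mono mult_left_mono sum_mono total_score_variance) (simp_all add: joint_sum \<theta>)
  also have "\<dots> \<le> card J / 6"
    using mult_left_mono[OF small, of "card J"] by (simp add: field_simps)
  finally show ?thesis .
qed

text \<open>
The fingerprinting bound. Let \<open>\<phi> x\<close> be the inner product of the weighted estimate with the score of
the observation \<open>x\<close>. If \<open>x\<close> is not in the dataset, \<open>\<phi> x\<close> has mean zero, and its second moment is at
most \<open>\<I> N\<close>: by the bound on the information matrix as a whole it grows only linearly in the number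
\<open>N\<close> of parameters. Replacing \<open>S i\<close> by a fresh copy reduces the case of an observation in the dataset
to this one, and privacy bounds the cost of the replacement.
\<close>

lemma correlation_le_of_privacy:
  fixes A :: "(nat \<Rightarrow> 'x) \<Rightarrow> 'b measure" and g :: "'b \<Rightarrow> 'j \<Rightarrow> real"
  assumes \<theta>: "\<theta> \<in> params" and n: "0 < n" and J: "J \<noteq> {}"
    and prob: "\<And>S. S \<in> datasets n \<Longrightarrow> prob_space (A S)"
    and sets: "\<And>S. S \<in> datasets n \<Longrightarrow> sets (A S) = sets N"
    and g_meas: "\<And>j. j \<in> J \<Longrightarrow> (\<lambda>b. g b j) \<in> borel_measurable N"
    and g_bound: "\<And>b j. \<bar>g b j\<bar> \<le> 1"
    and priv: "\<And>S i x. S \<in> datasets n \<Longrightarrow> i < n \<Longrightarrow> x \<in> \<Omega> \<Longrightarrow> x \<noteq> S i \<Longrightarrow>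
       renyi_div 2 (A S) (A (S(i := x))) \<le> ereal (2 * \<rho>)"
    and \<kappa>: "0 < \<kappa>" "exp (2 * \<rho>) - 1 \<le> \<kappa>"
    and small: "36 * (real n)\<^sup>2 * \<kappa> * \<I> \<le> card J"
  shows "(\<Sum>S\<in>datasets n. joint n \<theta> S *
      (\<Sum>j\<in>J. (1 - (\<theta> j)\<^sup>2) * (\<Sum>i<n. sc \<theta> (S i) j) * (\<integral>b. g b j \<partial>A S))) \<le> card J / 6"
proof -
  define c where "c j = 1 - (\<theta> j)\<^sup>2" for j
  define \<phi> where "\<phi> x b = (\<Sum>j\<in>J. c j * g b j * sc \<theta> x j)" for x b
  define E where "E S f = (\<integral>b. f b \<partial>A S)" for S and f :: "'b \<Rightarrow> real"
  have c: "\<bar>c j\<bar> \<le> 1" if "j \<in> J" for j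
    unfolding c_def using param_weight[OF \<theta> that] by linarith
  have cg: "\<bar>c j * g b j\<bar> \<le> 1" if "j \<in> J" for j b
    unfolding abs_mult using c[OF that] g_bound by (intro mult_le_one) auto
  have \<phi>_bound: "\<bar>\<phi> x b\<bar> \<le> (\<Sum>j\<in>J. \<bar>sc \<theta> x j\<bar>)" for x b
  proof -
    have "\<bar>\<phi> x b\<bar> \<le> (\<Sum>j\<in>J. \<bar>c j * g b j * sc \<theta> x j\<bar>)" unfolding \<phi>_def by (rule sum_abs)
    also have "\<dots> \<le> (\<Sum>j\<in>J. 1 * \<bar>sc \<theta> x j\<bar>)"
      unfolding abs_mult[of "c _ * g b _"] by (intro sum_mono mult_right_mono cg) auto
    finally show ?thesis by simp
  qed
  have \<phi>_meas: "\<phi> x \<in> borel_measurable N" for x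
    unfolding \<phi>_def by (intro borel_measurable_sum borel_measurable_times g_meas) auto
  have meas: "f \<in> borel_measurable (A S)" if "f \<in> borel_measurable N" "S \<in> datasets n" for f :: "'b \<Rightarrow> real" and S
    using that sets by (simp cong: measurable_cong_sets)
  have int_bounded: "integrable (A S) f"
    if "f \<in> borel_measurable N" "S \<in> datasets n" "\<And>b. \<bar>f b\<bar> \<le> B" for f :: "'b \<Rightarrow> real" and S B
  proof -
    interpret prob_space "A S" using prob that by blast
    show ?thesis
      by (rule integrable_const_bound[where B=B]) (simp_all add: that(3) meas[OF that(1,2)])
  qed
  have int_g: "integrable (A S) (\<lambda>b. g b j)" if "S \<in> datasets n" "j \<in> J" for S j
    using that g_bound by (intro int_bounded g_meas) auto
  have int_\<phi>: "integrable (A S) (\<phi> x)" if "S \<in> datasets n" for S x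
    by (rule int_bounded[OF \<phi>_meas that \<phi>_bound])
  have int_\<phi>2: "integrable (A S) (\<lambda>b. (\<phi> x b)\<^sup>2)" if "S \<in> datasets n" for S x
  proof (rule int_bounded[OF _ that])
    show "(\<lambda>b. (\<phi> x b)\<^sup>2) \<in> borel_measurable N" using \<phi>_meas by (rule borel_measurable_power)
    show "\<bar>(\<phi> x b)\<^sup>2\<bar> \<le> (\<Sum>j\<in>J. \<bar>sc \<theta> x j\<bar>)\<^sup>2" for b
      using power_mono[OF \<phi>_bound[of x b], of 2] by simp
  qed
  have upd: "S(i := x) \<in> datasets n" if "S \<in> datasets n" "i < n" "x \<in> \<Omega>" for S i x
    using that by (auto simp: PiE_iff extensional_def)
  have mean_zero: "(\<Sum>x\<in>\<Omega>. p \<theta> x * E S (\<phi> x)) = 0" if S: "S \<in> datasets n" for S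
  proof -
    have "E S (\<phi> x) = (\<Sum>j\<in>J. c j * E S (\<lambda>b. g b j) * sc \<theta> x j)" for x
      unfolding E_def \<phi>_def using int_g[OF S] by (subst Bochner_Integration.integral_sum) auto
    then have "(\<Sum>x\<in>\<Omega>. p \<theta> x * E S (\<phi> x)) =
      (\<Sum>j\<in>J. c j * E S (\<lambda>b. g b j) * (\<Sum>x\<in>\<Omega>. p \<theta> x * sc \<theta> x j))"
      by (simp add: sum_distrib_left sum.swap[of _ \<Omega> J] mult_ac)
    then show ?thesis by (simp add: score_mean \<theta>)
  qed
  have second_moment: "(\<Sum>x\<in>\<Omega>. p \<theta> x * E S (\<lambda>b. (\<phi> x b)\<^sup>2)) \<le> \<I> * card J" if S: "S \<in> datasets n" for S
  proof -
    interpret prob_space "A S" using prob S by blast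
    have "(\<Sum>x\<in>\<Omega>. p \<theta> x * E S (\<lambda>b. (\<phi> x b)\<^sup>2)) = (\<integral>b. (\<Sum>x\<in>\<Omega>. p \<theta> x * (\<phi> x b)\<^sup>2) \<partial>A S)"
      unfolding E_def using int_\<phi>2[OF S] by (subst Bochner_Integration.integral_sum) auto
    also have "\<dots> \<le> \<I> * card J"
    proof (rule integral_le_const[OF _ AE_I2])
      show "integrable (A S) (\<lambda>b. \<Sum>x\<in>\<Omega>. p \<theta> x * (\<phi> x b)\<^sup>2)" using int_\<phi>2[OF S] by auto
      fix b
      have "(\<Sum>x\<in>\<Omega>. p \<theta> x * (\<phi> x b)\<^sup>2) \<le> \<I> * (\<Sum>j\<in>J. (c j * g b j)\<^sup>2)"
        unfolding \<phi>_def by (rule fisher[OF \<theta>])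
      also have "\<dots> \<le> \<I> * (\<Sum>j\<in>J. 1)"
        using cg by (intro mult_left_mono sum_mono info_nonneg) (simp add: abs_square_le_1)
      finally show "(\<Sum>x\<in>\<Omega>. p \<theta> x * (\<phi> x b)\<^sup>2) \<le> \<I> * card J" by simp
    qed
    finally show ?thesis .
  qed
  have per_sample: "(\<Sum>S\<in>datasets n. joint n \<theta> S * E S (\<phi> (S i))) \<le> card J / (6 * real n)"
    if i: "i < n" for i
  proof -
    let ?D = "\<Sum>S\<in>datasets n. joint n \<theta> S * E S (\<phi> (S i))"
    have step: "2 * t * E S (\<phi> (S i)) \<le> 2 * t * E (S(i := x)) (\<phi> (S i)) + \<kappa> + t\<^sup>2 * E (S(i := x)) (\<lambda>b. (\<phi> (S i) b)\<^sup>2)"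
      if S: "S \<in> datasets n" and x: "x \<in> \<Omega>" for S x t
    proof (cases "x = S i")
      case True
      then show ?thesis using \<kappa> by (simp add: E_def)
    next
      case False
      have S': "S(i := x) \<in> datasets n" using S i x by (rule upd)
      have "2 * t * (E S (\<phi> (S i)) - E (S(i := x)) (\<phi> (S i)))
          \<le> (exp (2 * \<rho>) - 1) + t\<^sup>2 * E (S(i := x)) (\<lambda>b. (\<phi> (S i) b)\<^sup>2)"
        unfolding E_def
        by (rule renyi_change_of_measure[OF prob[OF S] prob[OF S'] _ priv[OF S i x False] meas[OF \<phi>_meas S'] \<phi>_bound])
          (simp add: sets S S')
      then show ?thesis using \<kappa>(2) by (simp add: algebra_simps)
    qed
    have bound: "2 * t * ?D \<le> \<kappa> + t\<^sup>2 * (\<I> * card J)" for t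
    proof -
      have "2 * t * ?D = (\<Sum>S\<in>datasets n. \<Sum>x\<in>\<Omega>. joint n \<theta> S * p \<theta> x * (2 * t * E S (\<phi> (S i))))"
        by (subst expectation_add_sample[OF \<theta>]) (simp add: sum_distrib_left mult_ac)
      also have "\<dots> \<le> (\<Sum>S\<in>datasets n. \<Sum>x\<in>\<Omega>. joint n \<theta> S * p \<theta> x *
          (2 * t * E (S(i := x)) (\<phi> (S i)) + \<kappa> + t\<^sup>2 * E (S(i := x)) (\<lambda>b. (\<phi> (S i) b)\<^sup>2)))"
        by (intro sum_mono mult_left_mono step mult_nonneg_nonneg joint_nonneg p_nonneg \<theta>)
      \<comment> \<open>exchange \<open>S i\<close> and \<open>x\<close>: now \<open>x\<close> is the observation outside the dataset\<close>
      also have "\<dots> = (\<Sum>S\<in>datasets n. \<Sum>x\<in>\<Omega>. joint n \<theta> S * p \<theta> x *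
          (2 * t * E S (\<phi> x) + \<kappa> + t\<^sup>2 * E S (\<lambda>b. (\<phi> x b)\<^sup>2)))"
        by (rule expectation_resample[OF \<theta> i])
      also have "\<dots> = (\<Sum>S\<in>datasets n. joint n \<theta> S *
          (2 * t * (\<Sum>x\<in>\<Omega>. p \<theta> x * E S (\<phi> x)) + \<kappa> * (\<Sum>x\<in>\<Omega>. p \<theta> x) + t\<^sup>2 * (\<Sum>x\<in>\<Omega>. p \<theta> x * E S (\<lambda>b. (\<phi> x b)\<^sup>2))))"
        by (simp add: sum_distrib_left sum.distrib distrib_left mult_ac)
      also have "\<dots> = (\<Sum>S\<in>datasets n. joint n \<theta> S * (\<kappa> + t\<^sup>2 * (\<Sum>x\<in>\<Omega>. p \<theta> x * E S (\<lambda>b. (\<phi> x b)\<^sup>2))))"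
        by (intro sum.cong refl) (simp add: mean_zero p_sum \<theta>)
      also have "\<dots> \<le> (\<Sum>S\<in>datasets n. joint n \<theta> S * (\<kappa> + t\<^sup>2 * (\<I> * card J)))"
        by (intro sum_mono mult_left_mono add_left_mono joint_nonneg \<theta> second_moment zero_le_power2)
      also have "\<dots> = \<kappa> + t\<^sup>2 * (\<I> * card J)"
        by (simp add: sum_distrib_right[symmetric] joint_sum \<theta>)
      finally show ?thesis .
    qed
    have N: "0 < real (card J)" using J finite_J by (simp add: card_gt_0_iff)
    \<comment> \<open>this \<open>t\<close> balances the two terms of the bound when the condition \<open>small\<close> is an equality\<close>
    define t where "t = 6 * real n * \<kappa> / card J"
    have t: "0 < t" using N n \<kappa> by (simp add: t_def)
    have "t * (t * (\<I> * card J)) = t * (36 * (real n)\<^sup>2 * \<kappa> * \<I>) / (6 * real n)"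
      using N n unfolding t_def by (simp add: field_simps power2_eq_square)
    also have "\<dots> \<le> t * card J / (6 * real n)"
      using t small n by (intro divide_right_mono mult_left_mono) auto
    also have "\<dots> = \<kappa>" using N n unfolding t_def by simp
    finally have "2 * t * ?D \<le> 2 * \<kappa>" using bound[of t] by (simp add: power2_eq_square mult.assoc)
    also have "2 * \<kappa> = 2 * t * (card J / (6 * real n))" using N n unfolding t_def by simp
    finally have "2 * t * ?D \<le> 2 * t * (card J / (6 * real n))" .
    then show ?thesis by (rule mult_left_le_imp_le) (use t in simp)
  qed
  have "(\<Sum>S\<in>datasets n. joint n \<theta> S * (\<Sum>j\<in>J. (1 - (\<theta> j)\<^sup>2) * (\<Sum>i<n. sc \<theta> (S i) j) * (\<integral>b. g b j \<partial>A S)))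
     = (\<Sum>i<n. \<Sum>S\<in>datasets n. joint n \<theta> S * E S (\<phi> (S i)))"
  proof -
    have "(\<Sum>j\<in>J. (1 - (\<theta> j)\<^sup>2) * (\<Sum>i<n. sc \<theta> (S i) j) * (\<integral>b. g b j \<partial>A S)) = (\<Sum>i<n. E S (\<phi> (S i)))"
      if S: "S \<in> datasets n" for S
    proof -
      have "E S (\<phi> x) = (\<Sum>j\<in>J. c j * (\<integral>b. g b j \<partial>A S) * sc \<theta> x j)" for x
        unfolding E_def \<phi>_def using int_g[OF S] by (subst Bochner_Integration.integral_sum) auto
      then show ?thesis
        by (simp add: c_def sum_distrib_left sum_distrib_right sum.swap[of _ J "{..<n}"] mult_ac)
    qed
    then show ?thesis
      by (simp add: sum_distrib_left sum.swap[of _ "datasets n"])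
  qed
  also have "\<dots> \<le> (\<Sum>i<n. card J / (6 * real n))" by (intro sum_mono per_sample) simp
  also have "\<dots> = card J / 6" using n by simp
  finally show ?thesis .
qed

text \<open>
Expand the square and drop the nonnegative square of the estimate: what remains is the quantity in
\<open>bayes_correlation\<close>, and either alternative of the last hypothesis bounds the correlation there.
\<close>

theorem squared_error_lower_bound:
  fixes A :: "(nat \<Rightarrow> 'x) \<Rightarrow> 'b measure" and g :: "'b \<Rightarrow> 'j \<Rightarrow> real"
  assumes n: "0 < n" and J: "J \<noteq> {}"
    and prob: "\<And>S. S \<in> datasets n \<Longrightarrow> prob_space (A S)"
    and sets: "\<And>S. S \<in> datasets n \<Longrightarrow> sets (A S) = sets N"
    and g_meas: "\<And>j. j \<in> J \<Longrightarrow> (\<lambda>b. g b j) \<in> borel_measurable N"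
    and g_bound: "\<And>b j. \<bar>g b j\<bar> \<le> 1"
    and priv: "\<And>S i x. S \<in> datasets n \<Longrightarrow> i < n \<Longrightarrow> x \<in> \<Omega> \<Longrightarrow> x \<noteq> S i \<Longrightarrow>
       renyi_div 2 (A S) (A (S(i := x))) \<le> ereal (2 * \<rho>)"
    and \<kappa>: "0 < \<kappa>" "exp (2 * \<rho>) - 1 \<le> \<kappa>"
    and small: "36 * real n * \<I> \<le> 1 \<or> 36 * (real n)\<^sup>2 * \<kappa> * \<I> \<le> card J"
  shows "\<exists>\<theta>\<in>params. card J / 12 \<le> (\<Sum>S\<in>datasets n. joint n \<theta> S * (\<integral>b. (\<Sum>j\<in>J. (g b j - \<theta> j)\<^sup>2) \<partial>A S))"
proof -
  define G where "G S j = (\<integral>b. g b j \<partial>A S)" for S j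
  have meas: "f \<in> borel_measurable (A S)" if "f \<in> borel_measurable N" "S \<in> datasets n" for f :: "'b \<Rightarrow> real" and S
    using that sets by (simp cong: measurable_cong_sets)
  have int_g: "integrable (A S) (\<lambda>b. g b j)" if "S \<in> datasets n" "j \<in> J" for S j
  proof -
    interpret prob_space "A S" using prob that by blast
    show ?thesis
      by (rule integrable_const_bound[where B=1]) (simp_all add: g_bound meas g_meas that)
  qed
  have int_g2: "integrable (A S) (\<lambda>b. (g b j)\<^sup>2)" if "S \<in> datasets n" "j \<in> J" for S j
  proof -
    interpret prob_space "A S" using prob that by blast
    show ?thesis
      by (rule integrable_const_bound[where B=1])
        (simp_all add: g_bound abs_square_le_1 meas g_meas that borel_measurable_power)
  qed
  have G_bound: "\<bar>G S j\<bar> \<le> 1" if "S \<in> datasets n" "j \<in> J" for S j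
  proof -
    interpret prob_space "A S" using prob that by blast
    have "G S j \<le> 1" "-1 \<le> G S j"
      unfolding G_def using g_bound int_g[OF that]
      by (auto intro!: integral_le_const integral_ge_const AE_I2 simp: abs_le_iff minus_le_iff)
    then show ?thesis by simp
  qed
  have "\<exists>\<theta>\<in>params. (\<Sum>j\<in>J. (\<theta> j)\<^sup>2) - 2 * (\<Sum>S\<in>datasets n. joint n \<theta> S * (\<Sum>j\<in>J. \<theta> j * G S j)) \<ge> card J / 12"
  proof (rule bayes_correlation[OF J])
    fix \<theta> assume \<theta>: "\<theta> \<in> params"
    from small show "(\<Sum>S\<in>datasets n. joint n \<theta> S * (\<Sum>j\<in>J. (1 - (\<theta> j)\<^sup>2) * (\<Sum>i<n. sc \<theta> (S i) j) * G S j)) \<le> card J / 6"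
    proof
      assume "36 * real n * \<I> \<le> 1"
      then show ?thesis using \<theta> G_bound by (intro correlation_le_of_small_information)
    next
      assume noisy: "36 * (real n)\<^sup>2 * \<kappa> * \<I> \<le> card J"
      show ?thesis unfolding G_def
        by (rule correlation_le_of_privacy[OF \<theta> n J]) (fact prob sets g_meas g_bound priv \<kappa> noisy)+
    qed
  qed
  then obtain \<theta> where \<theta>: "\<theta> \<in> params"
    and le: "card J / 12 \<le> (\<Sum>j\<in>J. (\<theta> j)\<^sup>2) - 2 * (\<Sum>S\<in>datasets n. joint n \<theta> S * (\<Sum>j\<in>J. \<theta> j * G S j))"
    by blast
  have "(\<Sum>j\<in>J. (\<theta> j)\<^sup>2) - 2 * (\<Sum>j\<in>J. \<theta> j * G S j) \<le> (\<integral>b. (\<Sum>j\<in>J. (g b j - \<theta> j)\<^sup>2) \<partial>A S)"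
    if S: "S \<in> datasets n" for S
  proof -
    interpret prob_space "A S" using prob S by blast
    have eq: "(\<integral>b. (\<Sum>j\<in>J. (g b j - \<theta> j)\<^sup>2) \<partial>A S) = (\<Sum>j\<in>J. \<integral>b. (g b j)\<^sup>2 - 2 * \<theta> j * g b j + (\<theta> j)\<^sup>2 \<partial>A S)"
      by (subst Bochner_Integration.integral_sum[symmetric])
        (use int_g[OF S] int_g2[OF S] in \<open>auto intro!: Bochner_Integration.integral_cong sum.cong simp: power2_eq_square algebra_simps\<close>)
    have "(\<Sum>j\<in>J. 0 - 2 * \<theta> j * G S j + (\<theta> j)\<^sup>2) \<le>
        (\<Sum>j\<in>J. (\<integral>b. (g b j)\<^sup>2 \<partial>A S) - 2 * \<theta> j * G S j + (\<theta> j)\<^sup>2)"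
      by (intro sum_mono add_mono diff_mono) auto
    also have "\<dots> = (\<integral>b. (\<Sum>j\<in>J. (g b j - \<theta> j)\<^sup>2) \<partial>A S)"
      unfolding eq using int_g[OF S] int_g2[OF S] by (intro sum.cong refl) (simp add: G_def prob_space)
    finally show ?thesis by (simp add: sum.distrib sum_subtractf sum_distrib_left mult.assoc sum_negf)
  qed
  then have "(\<Sum>S\<in>datasets n. joint n \<theta> S * ((\<Sum>j\<in>J. (\<theta> j)\<^sup>2) - 2 * (\<Sum>j\<in>J. \<theta> j * G S j)))
     \<le> (\<Sum>S\<in>datasets n. joint n \<theta> S * (\<integral>b. (\<Sum>j\<in>J. (g b j - \<theta> j)\<^sup>2) \<partial>A S))"
    by (intro sum_mono mult_left_mono joint_nonneg \<theta>)
  moreover have "(\<Sum>S\<in>datasets n. joint n \<theta> S * ((\<Sum>j\<in>J. (\<theta> j)\<^sup>2) - 2 * (\<Sum>j\<in>J. \<theta> j * G S j))) =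
     (\<Sum>j\<in>J. (\<theta> j)\<^sup>2) - 2 * (\<Sum>S\<in>datasets n. joint n \<theta> S * (\<Sum>j\<in>J. \<theta> j * G S j))"
    unfolding right_diff_distrib sum_subtractf sum_distrib_right[symmetric]
    by (simp add: joint_sum \<theta> sum_distrib_left mult.left_commute)
  ultimately show ?thesis using \<theta> le by (intro bexI[of _ \<theta>]) auto
qed

end

section \<open>Averages over sign vectors\<close>

abbreviation sign_cube :: "nat \<Rightarrow> (nat \<Rightarrow> real) set" where
  "sign_cube d \<equiv> PiE {..<d} (\<lambda>_. {-1, 1})"

lemma finite_sign_cube: "finite (sign_cube d)"
  by (intro finite_PiE) auto

lemma sign_cube_upd: "x \<in> sign_cube d \<Longrightarrow> i < d \<Longrightarrow> e \<in> {-1, 1} \<Longrightarrow> x(i := e) \<in> sign_cube d"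
  by (auto simp: PiE_iff extensional_def)

lemma sign_cube_coord: "x \<in> sign_cube d \<Longrightarrow> i < d \<Longrightarrow> x i = 1 \<or> x i = -1"
  by (auto simp: PiE_iff)

lemma sign_cube_abs:
  assumes "x \<in> sign_cube d" "i < d"
  shows "\<bar>x i\<bar> = 1"
  using sign_cube_coord[OF assms] by (elim disjE) simp_all

lemma sign_cube_square:
  assumes "x \<in> sign_cube d" "i < d"
  shows "x i * x i = 1"
  using sign_cube_coord[OF assms] by (elim disjE) simp_all

text \<open>
Flipping one sign is a bijection of the cube, so one coordinate can be averaged out. All conditional
expectations below are computed with this identity.
\<close>

lemma sum_sign_cube_coord:
  fixes F :: "(nat \<Rightarrow> real) \<Rightarrow> real"
  assumes i: "i < d"
  shows "(\<Sum>x\<in>sign_cube d. F x) = (\<Sum>x\<in>sign_cube d. (F (x(i := 1)) + F (x(i := -1))) / 2)"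
proof -
  let ?h = "\<lambda>x. x(i := - x i)"
  have h: "?h x \<in> sign_cube d" "?h (?h x) = x" if "x \<in> sign_cube d" for x
    using sign_cube_upd[OF that i, of "- x i"] sign_cube_coord[OF that i] by auto
  have "(\<Sum>x\<in>sign_cube d. F (?h x)) = (\<Sum>x\<in>sign_cube d. F x)"
    by (rule sum.reindex_bij_witness[where i = ?h and j = ?h]) ((rule h, assumption) | rule refl)+
  then have "2 * (\<Sum>x\<in>sign_cube d. F x) = (\<Sum>x\<in>sign_cube d. F x + F (?h x))"
    by (simp add: sum.distrib)
  also have "\<dots> = (\<Sum>x\<in>sign_cube d. F (x(i := 1)) + F (x(i := -1)))"
  proof (rule sum.cong[OF refl])
    fix x :: "nat \<Rightarrow> real" assume x: "x \<in> sign_cube d"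
    have "x(i := x i) = x" by simp
    then show "F x + F (?h x) = F (x(i := 1)) + F (x(i := -1))"
      using sign_cube_coord[OF x i] by (auto simp del: fun_upd_triv)
  qed
  finally show ?thesis by (simp add: sum_divide_distrib[symmetric])
qed

definition cube_avg :: "nat \<Rightarrow> ((nat \<Rightarrow> real) \<Rightarrow> real) \<Rightarrow> real" where
  "cube_avg d h = (\<Sum>x\<in>sign_cube d. h x) / 2 ^ d"

lemma cube_avg_sum: "cube_avg d (\<lambda>x. \<Sum>l\<in>L. f l x) = (\<Sum>l\<in>L. cube_avg d (f l))"
  unfolding cube_avg_def by (simp add: sum.swap[of _ "sign_cube d" L] sum_divide_distrib)

lemma cube_avg_cmult: "cube_avg d (\<lambda>x. c * f x) = c * cube_avg d f"
  unfolding cube_avg_def by (simp add: sum_distrib_left)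

lemma cube_avg_mono: "(\<And>x. x \<in> sign_cube d \<Longrightarrow> f x \<le> g x) \<Longrightarrow> cube_avg d f \<le> cube_avg d g"
  unfolding cube_avg_def by (intro divide_right_mono sum_mono) auto

lemma card_sign_cube: "card (sign_cube d) = 2 ^ d"
  by (subst card_PiE) (auto simp: numeral_2_eq_2)

lemma cube_avg_const: "cube_avg d (\<lambda>_. c) = c"
  unfolding cube_avg_def by (simp add: card_sign_cube)

lemma cube_avg_coord: "i < d \<Longrightarrow> cube_avg d (\<lambda>x. x i) = 0"
  unfolding cube_avg_def by (subst sum_sign_cube_coord) auto

lemma cube_avg_coord_prod:
  assumes "i < d" "j < d"
  shows "cube_avg d (\<lambda>x. x i * x j) = (if i = j then 1 else 0)"
proof (cases "i = j")
  case True
  have "cube_avg d (\<lambda>x. x i * x j) = cube_avg d (\<lambda>x. 1)"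
    unfolding cube_avg_def True[symmetric]
    by (intro arg_cong2[where f="(/)"] sum.cong refl) (simp add: sign_cube_square assms)
  then show ?thesis using True by (simp add: cube_avg_const)
next
  case False
  then show ?thesis
    unfolding cube_avg_def by (subst sum_sign_cube_coord[OF assms(1)]) simp
qed

lemma cube_avg_linear_forms:
  "cube_avg d (\<lambda>x. (\<Sum>l<d. a l * x l) * (\<Sum>l<d. b l * x l)) = (\<Sum>l<d. a l * b l)"
proof -
  have "cube_avg d (\<lambda>x. (\<Sum>l<d. a l * x l) * (\<Sum>l<d. b l * x l)) =
     cube_avg d (\<lambda>x. \<Sum>l<d. \<Sum>k<d. (a l * b k) * (x l * x k))"
    by (simp add: sum_product mult_ac)
  also have "\<dots> = (\<Sum>l<d. \<Sum>k<d. (a l * b k) * (if l = k then 1 else 0))"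
    by (simp only: cube_avg_sum cube_avg_cmult)
      (intro sum.cong refl arg_cong2[where f="(*)"] cube_avg_coord_prod; simp)
  finally show ?thesis by (simp add: if_distrib cong: if_cong)
qed

text \<open>
The left side is the moment generating function of a sign of mean \<open>m\<close>. Shifted to the values
\<open>0\<close> and \<open>2\<close> the sign becomes twice a Bernoulli variable, for which this is Hoeffding's lemma.
\<close>

lemma two_point_mgf:
  fixes m s :: real
  assumes "\<bar>m\<bar> \<le> 1"
  shows "((1 + m) * exp s + (1 - m) * exp (- s)) / 2 \<le> exp (m * s + s\<^sup>2 / 2)"
proof -
  have pos: "((1 + m) * exp s + (1 - m) * exp (- s)) / 2 \<le> exp (m * s + s\<^sup>2 / 2)"
    if "0 \<le> s" "\<bar>m\<bar> \<le> 1" for m s :: real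
  proof -
    \<comment> \<open>the probability of the value \<open>1\<close>\<close>
    define q where "q = (1 + m) / 2"
    have q: "0 \<le> q" using that by (auto simp: q_def)
    have "1 \<le> exp (2 * s)" using that by simp
    then have Y: "0 < 1 + q * (exp (2 * s) - 1)" using q by (intro add_pos_nonneg) auto
    have "- (2 * s) * q + ln (1 + q * (exp (2 * s) - 1)) \<le> (2 * s)\<^sup>2 / 8"
      using Hoeffdings_lemma_aux[of "2 * s" q] that q by simp
    then have "ln (1 + q * (exp (2 * s) - 1)) \<le> 2 * s * q + s\<^sup>2 / 2"
      by (simp add: power2_eq_square)
    then have "1 + q * (exp (2 * s) - 1) \<le> exp (2 * s * q + s\<^sup>2 / 2)"
      using Y by (metis exp_le_cancel_iff exp_ln)
    then have "exp (- s) * (1 + q * (exp (2 * s) - 1)) \<le> exp (- s) * exp (2 * s * q + s\<^sup>2 / 2)"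
      by (intro mult_left_mono) auto
    moreover have "exp (- s) * (1 + q * (exp (2 * s) - 1)) = (1 - q) * exp (- s) + q * (exp (- s) * exp (2 * s))"
      by (simp add: algebra_simps)
    moreover have "exp (- s) * exp (2 * s) = exp s" by (simp flip: exp_add)
    moreover have "exp (- s) * exp (2 * s * q + s\<^sup>2 / 2) = exp (m * s + s\<^sup>2 / 2)"
      by (simp add: q_def flip: exp_add) (simp add: field_simps)
    ultimately have "(1 - q) * exp (- s) + q * exp s \<le> exp (m * s + s\<^sup>2 / 2)" by simp
    then show ?thesis by (simp add: q_def field_simps)
  qed
  show ?thesis
  proof (cases "0 \<le> s")
    case True
    then show ?thesis using pos assms by blast
  next
    case False
    then show ?thesis using pos[of "-s" "-m"] assms by (simp add: add.commute)
  qed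
qed

lemma cube_avg_exp_linear: "cube_avg d (\<lambda>x. exp (\<Sum>l<d. w l * x l)) \<le> exp ((\<Sum>l<d. (w l)\<^sup>2) / 2)"
proof -
  have "cube_avg d (\<lambda>x. exp (\<Sum>l<d. w l * x l)) = (\<Sum>x\<in>sign_cube d. \<Prod>l<d. exp (w l * x l)) / 2 ^ d"
    unfolding cube_avg_def by (simp add: exp_sum)
  also have "\<dots> = (\<Prod>l<d. \<Sum>e\<in>{-1, 1}. exp (w l * e)) / 2 ^ d"
    by (subst prod_sum_PiE) auto
  also have "\<dots> = (\<Prod>l<d. ((1 + 0) * exp (w l) + (1 - 0) * exp (- w l)) / 2)"
    by (simp add: prod_dividef add.commute)
  also have "\<dots> \<le> (\<Prod>l<d. exp ((w l)\<^sup>2 / 2))"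
    using two_point_mgf[of 0] by (intro prod_mono) (auto intro!: add_nonneg_nonneg)
  also have "\<dots> = exp ((\<Sum>l<d. (w l)\<^sup>2) / 2)"
    by (simp add: exp_sum[symmetric] sum_divide_distrib)
  finally show ?thesis .
qed

section \<open>The sign regression model\<close>

definition pred :: "nat \<Rightarrow> (nat \<Rightarrow> nat \<Rightarrow> real) \<Rightarrow> (nat \<Rightarrow> real) \<Rightarrow> nat \<Rightarrow> real" where
  "pred d W x i = (\<Sum>l<d. W i l * x l)"

text \<open>
The probability of \<open>x\<close> when the coordinates outside \<open>R\<close> are independent fair signs and, given these,
the coordinates \<open>i\<close> in \<open>R\<close> are independent signs of mean \<open>pred d W x i\<close>.
\<close>

definition lik :: "nat \<Rightarrow> nat set \<Rightarrow> (nat \<Rightarrow> nat \<Rightarrow> real) \<Rightarrow> (nat \<Rightarrow> real) \<Rightarrow> real" where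
  "lik d R W x = (\<Prod>i\<in>R. 1 + x i * pred d W x i) / 2 ^ d"

text \<open>
For \<open>R\<close> the set of responses this says that \<open>h\<close> is a function of the predictors alone.
\<close>

definition ignores :: "nat set \<Rightarrow> ((nat \<Rightarrow> real) \<Rightarrow> 'c) \<Rightarrow> bool" where
  "ignores R h \<longleftrightarrow> (\<forall>i\<in>R. \<forall>x e. h (x(i := e)) = h x)"

lemma ignoresD: "ignores R h \<Longrightarrow> i \<in> R \<Longrightarrow> h (x(i := e)) = h x"
  by (simp add: ignores_def)

text \<open>
\<open>W\<close> maps predictors to responses, so there are no chains of dependence. The row bound keeps the
conditional means in \<open>[-1/2, 1/2]\<close>; together with the column bound it limits the operator norm of
\<open>W\<close> to \<open>1/2\<close>.
\<close>

locale sign_regression =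
  fixes d :: nat and R :: "nat set" and W :: "nat \<Rightarrow> nat \<Rightarrow> real"
  assumes R_subset: "R \<subseteq> {..<d}"
    and W_support: "\<And>i l. W i l \<noteq> 0 \<Longrightarrow> i \<in> R \<and> l < d \<and> l \<notin> R"
    and W_row: "\<And>i. i \<in> R \<Longrightarrow> (\<Sum>l<d. \<bar>W i l\<bar>) \<le> 1/2"
    and W_col: "\<And>l. (\<Sum>i\<in>R. \<bar>W i l\<bar>) \<le> 1/2"
begin

definition expect :: "((nat \<Rightarrow> real) \<Rightarrow> real) \<Rightarrow> real" where
  "expect f = (\<Sum>x\<in>sign_cube d. lik d R W x * f x)"

lemma finite_R: "finite R"
  using R_subset finite_subset by blast

lemma R_less: "i \<in> R \<Longrightarrow> i < d"
  using R_subset by auto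

lemma linear_ignores: "(\<And>l. l \<in> R \<Longrightarrow> v l = 0) \<Longrightarrow> ignores R (\<lambda>x. \<Sum>l<d. v l * x l)"
  unfolding ignores_def by (auto intro!: sum.cong)

lemma pred_ignores: "ignores R (\<lambda>x. pred d W x i)"
  unfolding pred_def using W_support by (intro linear_ignores) blast

lemma pred_upd: "j \<in> R \<Longrightarrow> pred d W (x(j := e)) i = pred d W x i"
  using ignoresD[OF pred_ignores] by blast

lemma pred_bound:
  assumes "x \<in> sign_cube d" "i \<in> R"
  shows "\<bar>pred d W x i\<bar> \<le> 1/2"
proof -
  have "\<bar>pred d W x i\<bar> \<le> (\<Sum>l<d. \<bar>W i l * x l\<bar>)" unfolding pred_def by (rule sum_abs)
  also have "\<dots> = (\<Sum>l<d. \<bar>W i l\<bar>)" using assms by (intro sum.cong) (auto simp: abs_mult sign_cube_abs)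
  finally show ?thesis using W_row[OF assms(2)] by simp
qed

lemma response_factor_pos:
  assumes "x \<in> sign_cube d" "i \<in> R"
  shows "0 < 1 + x i * pred d W x i"
proof -
  have "\<bar>x i * pred d W x i\<bar> \<le> 1/2"
    using assms pred_bound[OF assms] sign_cube_abs[of x d i] R_less by (simp add: abs_mult)
  then show ?thesis by (simp add: abs_le_iff)
qed

lemma lik_pos: "x \<in> sign_cube d \<Longrightarrow> 0 < lik d R W x"
  unfolding lik_def by (intro divide_pos_pos prod_pos response_factor_pos) auto

text \<open>
Given the predictors the responses are independent, so a product over responses can be replaced by
the product of its conditional means. The responses are averaged out one at a time.
\<close>

lemma sum_out_responses:
  assumes "finite R'" "R' \<subseteq> R" "ignores R h"
  shows "(\<Sum>x\<in>sign_cube d. h x * (\<Prod>i\<in>R'. (1 + x i * pred d W x i) * u i (x i))) =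
    (\<Sum>x\<in>sign_cube d. h x * (\<Prod>i\<in>R'. ((1 + pred d W x i) * u i 1 + (1 - pred d W x i) * u i (-1)) / 2))"
  using assms
proof (induction R' arbitrary: h rule: finite_induct)
  case (insert j R')
  let ?f = "\<lambda>x i. (1 + x i * pred d W x i) * u i (x i)"
  let ?c = "\<lambda>x i. ((1 + pred d W x i) * u i 1 + (1 - pred d W x i) * u i (-1)) / 2"
  have j: "j \<in> R" "j < d" "R' \<subseteq> R" using insert.prems R_less by auto
  define P where "P x = (\<Prod>i\<in>R'. ?f x i)" for x
  have P: "P (x(j := e)) = P x" for x e
    unfolding P_def using insert.hyps j by (intro prod.cong refl) (auto simp: pred_upd)
  have "(\<Sum>x\<in>sign_cube d. h x * (\<Prod>i\<in>insert j R'. ?f x i)) = (\<Sum>x\<in>sign_cube d. h x * ?f x j * P x)"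
    unfolding P_def using insert.hyps by (simp add: mult.assoc)
  also have "\<dots> = (\<Sum>x\<in>sign_cube d. h x * ?c x j * P x)"
    by (subst (1 2) sum_sign_cube_coord[OF j(2)])
      (intro sum.cong refl, simp add: pred_upd[OF j(1)] ignoresD[OF insert.prems(2) j(1)] P field_simps)
  also have "\<dots> = (\<Sum>x\<in>sign_cube d. h x * ?c x j * (\<Prod>i\<in>R'. ?c x i))"
    unfolding P_def
    using insert.prems(2) j
    by (intro insert.IH) (auto simp: ignores_def pred_upd)
  finally show ?case using insert.hyps by (simp add: mult.assoc)
qed simp

lemma expect_ignores: "ignores R h \<Longrightarrow> expect h = cube_avg d h"
  unfolding expect_def cube_avg_def lik_def
  using sum_out_responses[OF finite_R subset_refl, of h "\<lambda>_ _. 1"]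
  by (simp add: sum_divide_distrib[symmetric] mult.commute)

lemma lik_sum: "(\<Sum>x\<in>sign_cube d. lik d R W x) = 1"
  using expect_ignores[of "\<lambda>_. 1"] by (simp add: expect_def cube_avg_const ignores_def)

lemma expect_mono: "(\<And>x. x \<in> sign_cube d \<Longrightarrow> f x \<le> g x) \<Longrightarrow> expect f \<le> expect g"
  unfolding expect_def using lik_pos by (intro sum_mono mult_left_mono) (auto intro: less_imp_le)

lemma expect_cong: "(\<And>x. x \<in> sign_cube d \<Longrightarrow> f x = g x) \<Longrightarrow> expect f = expect g"
  unfolding expect_def by (intro sum.cong) auto

lemma expect_sum: "expect (\<lambda>x. \<Sum>l\<in>L. f l x) = (\<Sum>l\<in>L. expect (f l))"
  unfolding expect_def by (simp add: sum_distrib_left sum.swap[of _ "sign_cube d" L])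

lemma expect_diff: "expect (\<lambda>x. f x - g x) = expect f - expect g"
  unfolding expect_def by (simp add: right_diff_distrib sum_subtractf)

text \<open>
A response can be replaced by its conditional mean next to any factor that does not involve it, even
one that involves other responses.
\<close>

lemma expect_response:
  assumes i: "i \<in> R" and h: "ignores {i} h"
  shows "expect (\<lambda>x. x i * h x) = expect (\<lambda>x. pred d W x i * h x)"
proof -
  define L where "L x = (\<Prod>j\<in>R - {i}. 1 + x j * pred d W x j)" for x
  have lik: "lik d R W x = (1 + x i * pred d W x i) * L x / 2 ^ d" for x
    unfolding lik_def L_def using prod.remove[OF finite_R i] by simp
  have L: "L (x(i := e)) = L x" for x e
    unfolding L_def using i by (intro prod.cong) (auto simp: pred_upd)
  show ?thesis
    unfolding expect_def lik
    by (subst (1 2) sum_sign_cube_coord[OF R_less[OF i]])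
      (simp add: pred_upd[OF i] ignoresD[OF h] L field_simps)
qed

lemma expect_residual:
  assumes i: "i \<in> R" and h: "ignores {i} h"
  shows "expect (\<lambda>x. (x i - pred d W x i) * h x) = 0"
  using expect_response[OF assms] by (simp add: left_diff_distrib expect_diff)

lemma expect_coord: 
  assumes "i < d"
  shows "expect (\<lambda>x. x i) = 0"
proof (cases "i \<in> R")
  case True
  have "expect (\<lambda>x. x i) = expect (\<lambda>x. pred d W x i)"
    using expect_response[OF True, of "\<lambda>_. 1"] by (simp add: ignores_def)
  also have "\<dots> = cube_avg d (\<lambda>x. pred d W x i)" by (rule expect_ignores[OF pred_ignores])
  also have "\<dots> = 0" unfolding pred_def by (simp add: cube_avg_sum cube_avg_cmult cube_avg_coord)
  finally show ?thesis .
next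
  case False
  then have "ignores R (\<lambda>x. x i)" by (auto simp: ignores_def)
  then show ?thesis using assms by (simp add: expect_ignores cube_avg_coord)
qed

lemma expect_coord_square:
  assumes "i < d"
  shows "expect (\<lambda>x. x i * x i) = 1"
proof -
  have "expect (\<lambda>x. x i * x i) = expect (\<lambda>x. 1)"
    by (intro expect_cong) (simp add: sign_cube_square assms)
  then show ?thesis by (simp add: expect_def lik_sum)
qed

lemma cube_avg_pred_coord:
  assumes "j < d"
  shows "cube_avg d (\<lambda>x. pred d W x i * x j) = W i j"
proof -
  have coord: "(\<Sum>l<d. of_bool (l = j) * x l) = x j" for x :: "nat \<Rightarrow> real"
    using assms by (simp add: sum.remove[of "{..<d}" j] of_bool_def)
  have "cube_avg d (\<lambda>x. pred d W x i * x j) = (\<Sum>l<d. W i l * of_bool (l = j))"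
    using cube_avg_linear_forms[of d "W i" "\<lambda>l. of_bool (l = j)"] unfolding coord pred_def .
  then show ?thesis using assms by (simp add: sum.remove[of "{..<d}" j] of_bool_def)
qed

lemma expect_coord_prod:
  assumes "i < d" "j < d" "i \<noteq> j"
  shows "expect (\<lambda>x. x i * x j) = W i j + W j i + (\<Sum>l<d. W i l * W j l)"
proof -
  have mixed: "expect (\<lambda>x. x i * x j) = W i j" if ij: "i \<in> R" "j \<notin> R" "j < d" for i j
  proof -
    have "expect (\<lambda>x. x i * x j) = expect (\<lambda>x. pred d W x i * x j)"
      using ij by (intro expect_response) (auto simp: ignores_def)
    also have "\<dots> = cube_avg d (\<lambda>x. pred d W x i * x j)"
      using ij by (intro expect_ignores) (auto simp: ignores_def pred_upd)
    finally show ?thesis using ij by (simp add: cube_avg_pred_coord)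
  qed
  have zero: "W i l = 0" if "i \<notin> R \<or> l \<in> R" for i l using W_support that by blast
  consider "i \<in> R" "j \<in> R" | "i \<in> R" "j \<notin> R" | "i \<notin> R" "j \<in> R" | "i \<notin> R" "j \<notin> R" by blast
  then show ?thesis
  proof cases
    case 1
    have "expect (\<lambda>x. x i * x j) = expect (\<lambda>x. x j * pred d W x i)"
      using 1 assms by (subst expect_response) (auto simp: ignores_def mult.commute)
    also have "\<dots> = expect (\<lambda>x. pred d W x j * pred d W x i)"
      using 1 by (intro expect_response) (auto simp: ignores_def pred_upd)
    also have "\<dots> = cube_avg d (\<lambda>x. pred d W x j * pred d W x i)"
      by (intro expect_ignores) (auto simp: ignores_def pred_upd)
    also have "\<dots> = (\<Sum>l<d. W j l * W i l)"
      unfolding pred_def by (rule cube_avg_linear_forms)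
    finally show ?thesis using 1 by (simp add: zero mult.commute)
  next
    case 2
    then show ?thesis using assms by (simp add: mixed zero)
  next
    case 3
    have "expect (\<lambda>x. x i * x j) = W j i" using mixed[of j i] 3 assms by (simp add: mult.commute)
    then show ?thesis using 3 by (simp add: zero)
  next
    case 4
    then have "expect (\<lambda>x. x i * x j) = cube_avg d (\<lambda>x. x i * x j)"
      by (intro expect_ignores) (auto simp: ignores_def)
    then show ?thesis using assms 4 by (simp add: cube_avg_coord_prod zero)
  qed
qed

text \<open>
The Schur test for the operator norm of \<open>W\<close>.
\<close>

lemma W_schur: "(\<Sum>l<d. (\<Sum>i\<in>R. v i * W i l)\<^sup>2) \<le> (\<Sum>i\<in>R. (v i)\<^sup>2) / 4"
proof -
  have cs: "(\<Sum>i\<in>R. v i * W i l)\<^sup>2 \<le> 1/2 * (\<Sum>i\<in>R. \<bar>W i l\<bar> * (v i)\<^sup>2)" for l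
  proof -
    have "(\<Sum>i\<in>R. v i * W i l)\<^sup>2 = (\<Sum>i\<in>R. sqrt \<bar>W i l\<bar> * (sqrt \<bar>W i l\<bar> * sgn (W i l) * v i))\<^sup>2"
    proof -
      have "sqrt \<bar>w\<bar> * (sqrt \<bar>w\<bar> * sgn w * y) = y * w" for w y :: real
        by (simp add: mult.assoc[symmetric] abs_mult_sgn)
      then show ?thesis by (simp only:)
    qed
    also have "\<dots> \<le> (\<Sum>i\<in>R. (sqrt \<bar>W i l\<bar>)\<^sup>2) * (\<Sum>i\<in>R. (sqrt \<bar>W i l\<bar> * sgn (W i l) * v i)\<^sup>2)"
      by (rule Cauchy_Schwarz_ineq_sum)
    also have "\<dots> = (\<Sum>i\<in>R. \<bar>W i l\<bar>) * (\<Sum>i\<in>R. \<bar>W i l\<bar> * (v i)\<^sup>2)"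
      by (intro arg_cong2[where f="(*)"] sum.cong refl) (auto simp: power_mult_distrib sgn_if)
    also have "\<dots> \<le> 1/2 * (\<Sum>i\<in>R. \<bar>W i l\<bar> * (v i)\<^sup>2)"
      by (intro mult_right_mono W_col sum_nonneg) auto
    finally show ?thesis .
  qed
  have "(\<Sum>l<d. (\<Sum>i\<in>R. v i * W i l)\<^sup>2) \<le> (\<Sum>l<d. 1/2 * (\<Sum>i\<in>R. \<bar>W i l\<bar> * (v i)\<^sup>2))"
    by (intro sum_mono cs)
  also have "\<dots> = 1/2 * (\<Sum>i\<in>R. (\<Sum>l<d. \<bar>W i l\<bar>) * (v i)\<^sup>2)"
    by (simp only: sum_distrib_left[symmetric] sum_distrib_right sum.swap[of _ R "{..<d}"])
  also have "\<dots> \<le> 1/2 * (\<Sum>i\<in>R. 1/2 * (v i)\<^sup>2)"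
    by (intro mult_left_mono sum_mono mult_right_mono W_row) auto
  also have "\<dots> = (\<Sum>i\<in>R. (v i)\<^sup>2) / 4"
    by (simp add: sum_divide_distrib[symmetric])
  finally show ?thesis .
qed

text \<open>
Averaging out the responses costs half the squared norm of \<open>v\<close> on the responses and leaves the
exponential of a linear form in the predictors. Its coefficients \<open>w\<close> are those of \<open>v\<close> plus the
responses' share pulled back through \<open>W\<close>, and the Schur test controls their norm.
\<close>

lemma expect_exp_linear: "expect (\<lambda>x. exp (\<Sum>i<d. v i * x i)) \<le> exp (\<Sum>i<d. (v i)\<^sup>2)"
proof -
  let ?U = "{..<d} - R"
  define vU where "vU l = (if l \<in> R then 0 else v l)" for l
  define w where "w l = vU l + (\<Sum>i\<in>R. v i * W i l)" for l
  have split: "(\<Sum>i<d. f i) = (\<Sum>i\<in>R. f i) + (\<Sum>l\<in>?U. f l)" for f :: "nat \<Rightarrow> real"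
    using sum.subset_diff[OF R_subset, of f] by (simp add: add.commute)
  have vU: "(\<Sum>i<d. vU i * f i) = (\<Sum>l\<in>?U. v l * f l)" for f :: "nat \<Rightarrow> real"
    unfolding split[of "\<lambda>i. vU i * f i"] by (simp add: vU_def)
  let ?h = "\<lambda>x. exp (\<Sum>l<d. vU l * x l)"
  have "expect (\<lambda>x. exp (\<Sum>i<d. v i * x i)) =
     (\<Sum>x\<in>sign_cube d. ?h x * (\<Prod>i\<in>R. (1 + x i * pred d W x i) * exp (v i * x i))) / 2 ^ d"
    unfolding expect_def lik_def vU sum_divide_distrib
    by (intro sum.cong refl) (simp add: split[of "\<lambda>i. v i * _ i"] exp_add prod.distrib exp_sum finite_R)
  also have "\<dots> = cube_avg d (\<lambda>x. ?h x * (\<Prod>i\<in>R. ((1 + pred d W x i) * exp (v i * 1) + (1 - pred d W x i) * exp (v i * (-1))) / 2))"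
    unfolding cube_avg_def
    by (subst sum_out_responses[OF finite_R subset_refl, of ?h "\<lambda>i e. exp (v i * e)"])
      (auto simp: ignores_def vU_def intro!: sum.cong)
  also have "\<dots> \<le> cube_avg d (\<lambda>x. exp ((\<Sum>i\<in>R. (v i)\<^sup>2) / 2) * exp (\<Sum>l<d. w l * x l))"
  proof (rule cube_avg_mono)
    fix x :: "nat \<Rightarrow> real" assume x: "x \<in> sign_cube d"
    have m: "\<bar>pred d W x i\<bar> \<le> 1" if "i \<in> R" for i using pred_bound[OF x that] by simp
    have m': "0 \<le> 1 + pred d W x i" "0 \<le> 1 - pred d W x i" if "i \<in> R" for i
      using m[OF that] by auto
    have "(\<Prod>i\<in>R. ((1 + pred d W x i) * exp (v i * 1) + (1 - pred d W x i) * exp (v i * (-1))) / 2) \<le>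
        (\<Prod>i\<in>R. exp (pred d W x i * v i + (v i)\<^sup>2 / 2))"
      using two_point_mgf[OF m]
      by (intro prod_mono conjI divide_nonneg_nonneg add_nonneg_nonneg mult_nonneg_nonneg m') auto
    also have "\<dots> = exp (\<Sum>i\<in>R. pred d W x i * v i) * exp ((\<Sum>i\<in>R. (v i)\<^sup>2) / 2)"
      by (simp add: exp_sum[OF finite_R, symmetric] exp_add[symmetric] sum.distrib sum_divide_distrib)
    also have "(\<Sum>i\<in>R. pred d W x i * v i) = (\<Sum>l<d. (\<Sum>i\<in>R. v i * W i l) * x l)"
      by (simp add: pred_def sum_distrib_left sum_distrib_right sum.swap[of _ R "{..<d}"] mult_ac)
    finally have "?h x * (\<Prod>i\<in>R. ((1 + pred d W x i) * exp (v i * 1) + (1 - pred d W x i) * exp (v i * (-1))) / 2) \<le>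
      ?h x * (exp (\<Sum>l<d. (\<Sum>i\<in>R. v i * W i l) * x l) * exp ((\<Sum>i\<in>R. (v i)\<^sup>2) / 2))"
      by (intro mult_left_mono) auto
    also have "\<dots> = exp ((\<Sum>i\<in>R. (v i)\<^sup>2) / 2) * exp (\<Sum>l<d. w l * x l)"
      by (simp add: w_def exp_add[symmetric] distrib_right sum.distrib)
    finally show "?h x * (\<Prod>i\<in>R. ((1 + pred d W x i) * exp (v i * 1) + (1 - pred d W x i) * exp (v i * (-1))) / 2) \<le>
      exp ((\<Sum>i\<in>R. (v i)\<^sup>2) / 2) * exp (\<Sum>l<d. w l * x l)" .
  qed
  also have "\<dots> \<le> exp ((\<Sum>i\<in>R. (v i)\<^sup>2) / 2) * exp ((\<Sum>l<d. (w l)\<^sup>2) / 2)"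
    unfolding cube_avg_cmult by (intro mult_left_mono cube_avg_exp_linear) auto
  also have "\<dots> \<le> exp (\<Sum>i<d. (v i)\<^sup>2)"
  proof -
    have "(\<Sum>l<d. (w l)\<^sup>2) \<le> (\<Sum>l<d. 2 * (vU l)\<^sup>2 + 2 * (\<Sum>i\<in>R. v i * W i l)\<^sup>2)"
    proof (rule sum_mono)
      fix l
      have "0 \<le> (vU l - (\<Sum>i\<in>R. v i * W i l))\<^sup>2" by simp
      then show "(w l)\<^sup>2 \<le> 2 * (vU l)\<^sup>2 + 2 * (\<Sum>i\<in>R. v i * W i l)\<^sup>2"
        unfolding w_def by (simp add: power2_eq_square algebra_simps)
    qed
    also have "\<dots> = 2 * (\<Sum>l\<in>?U. (v l)\<^sup>2) + 2 * (\<Sum>l<d. (\<Sum>i\<in>R. v i * W i l)\<^sup>2)"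
    proof -
      have "(\<Sum>l<d. (vU l)\<^sup>2) = (\<Sum>l\<in>?U. (v l)\<^sup>2)"
        unfolding split[of "\<lambda>l. (vU l)\<^sup>2"] by (simp add: vU_def)
      then show ?thesis by (simp add: sum.distrib sum_distrib_left[symmetric])
    qed
    also have "\<dots> \<le> 2 * (\<Sum>l\<in>?U. (v l)\<^sup>2) + (\<Sum>i\<in>R. (v i)\<^sup>2) / 2"
      using W_schur[of v] by simp
    finally have "(\<Sum>i\<in>R. (v i)\<^sup>2) / 2 + (\<Sum>l<d. (w l)\<^sup>2) / 2 \<le> (\<Sum>i<d. (v i)\<^sup>2)"
      unfolding split[of "\<lambda>i. (v i)\<^sup>2"] using sum_nonneg[of R "\<lambda>i. (v i)\<^sup>2"] by simp
    then show ?thesis by (simp flip: exp_add)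
  qed
  finally show ?thesis .
qed

text \<open>
Multiply numerator and denominator by \<open>1 - x i * pred d W x i\<close> and use \<open>x i * x i = 1\<close>. The score
becomes a centred response times a function of the predictors.
\<close>

lemma response_score_eq:
  assumes "x \<in> sign_cube d" "i \<in> R"
  shows "x i * y / (1 + x i * pred d W x i) = (x i - pred d W x i) * (y / (1 - (pred d W x i)\<^sup>2))"
proof -
  have "\<bar>pred d W x i\<bar> \<le> 1/2" by (rule pred_bound[OF assms])
  then have "1 + pred d W x i \<noteq> 0" "1 - pred d W x i \<noteq> 0" by auto
  moreover have "1 - (pred d W x i)\<^sup>2 = (1 + pred d W x i) * (1 - pred d W x i)"
    by (simp add: power2_eq_square algebra_simps)
  ultimately show ?thesis using sign_cube_coord[OF assms(1) R_less[OF assms(2)]]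
    by (auto simp: divide_simps) (simp_all add: algebra_simps)
qed

lemma expect_score:
  assumes i: "i \<in> R" and H: "ignores R H"
  shows "expect (\<lambda>x. x i * H x / (1 + x i * pred d W x i)) = 0"
proof -
  have "expect (\<lambda>x. x i * H x / (1 + x i * pred d W x i)) =
      expect (\<lambda>x. (x i - pred d W x i) * (H x / (1 - (pred d W x i)\<^sup>2)))"
    by (intro expect_cong response_score_eq i)
  also have "\<dots> = 0"
    using i H by (intro expect_residual) (auto simp: ignores_def pred_upd)
  finally show ?thesis .
qed

text \<open>
The bound on the information matrix. Centred responses are conditionally uncorrelated, so only the
diagonal terms survive; each has conditional variance \<open>1 - (pred d W x i)\<^sup>2\<close>, which is at least
\<open>3/4\<close>, and the remaining linear forms in independent signs have second moment the sum of the squared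
coefficients.
\<close>

lemma expect_score_square:
  assumes V: "\<And>i l. i \<in> R \<Longrightarrow> l \<in> R \<Longrightarrow> V i l = 0"
  shows "expect (\<lambda>x. (\<Sum>i\<in>R. x i * (\<Sum>l<d. V i l * x l) / (1 + x i * pred d W x i))\<^sup>2)
    \<le> 4/3 * (\<Sum>i\<in>R. \<Sum>l<d. (V i l)\<^sup>2)"
proof -
  define H where "H i x = (\<Sum>l<d. V i l * x l)" for i and x :: "nat \<Rightarrow> real"
  define K where "K i x = H i x / (1 - (pred d W x i)\<^sup>2)" for i x
  have H: "ignores R (H i)" if "i \<in> R" for i
    unfolding H_def using V that by (intro linear_ignores) auto
  have K: "K i (x(j := e)) = K i x" if "i \<in> R" "j \<in> R" for i j x e
    unfolding K_def using H[OF that(1)] that by (simp add: ignores_def pred_upd)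
  let ?r = "\<lambda>i x. x i - pred d W x i"
  have "expect (\<lambda>x. (\<Sum>i\<in>R. x i * H i x / (1 + x i * pred d W x i))\<^sup>2) =
    expect (\<lambda>x. \<Sum>i\<in>R. \<Sum>j\<in>R. ?r i x * (K i x * ?r j x * K j x))"
  proof (rule expect_cong)
    fix x :: "nat \<Rightarrow> real" assume x: "x \<in> sign_cube d"
    have "(\<Sum>i\<in>R. x i * H i x / (1 + x i * pred d W x i)) = (\<Sum>i\<in>R. ?r i x * K i x)"
      unfolding K_def by (intro sum.cong refl response_score_eq x)
    then show "(\<Sum>i\<in>R. x i * H i x / (1 + x i * pred d W x i))\<^sup>2 =
        (\<Sum>i\<in>R. \<Sum>j\<in>R. ?r i x * (K i x * ?r j x * K j x))"
      by (simp add: power2_eq_square sum_product mult.assoc)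
  qed
  also have "\<dots> = (\<Sum>i\<in>R. \<Sum>j\<in>R. expect (\<lambda>x. ?r i x * (K i x * ?r j x * K j x)))"
    by (simp only: expect_sum)
  also have "\<dots> = (\<Sum>i\<in>R. expect (\<lambda>x. ?r i x * (K i x * ?r i x * K i x)))"
  proof (rule sum.cong[OF refl])
    fix i assume i: "i \<in> R"
    have "expect (\<lambda>x. ?r i x * (K i x * ?r j x * K j x)) = 0" if "j \<in> R" "j \<noteq> i" for j
      using that i by (intro expect_residual) (auto simp: ignores_def pred_upd K)
    then show "(\<Sum>j\<in>R. expect (\<lambda>x. ?r i x * (K i x * ?r j x * K j x))) =
        expect (\<lambda>x. ?r i x * (K i x * ?r i x * K i x))"
      using i finite_R by (subst sum.remove[of R i]) (auto intro!: sum.neutral)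
  qed
  also have "\<dots> \<le> (\<Sum>i\<in>R. 4/3 * (\<Sum>l<d. (V i l)\<^sup>2))"
  proof (rule sum_mono)
    fix i assume i: "i \<in> R"
    have "expect (\<lambda>x. ?r i x * (K i x * ?r i x * K i x)) =
        expect (\<lambda>x. (1 - (pred d W x i)\<^sup>2) * (K i x)\<^sup>2 - 2 * (?r i x * (pred d W x i * (K i x)\<^sup>2)))"
    proof (rule expect_cong)
      fix x :: "nat \<Rightarrow> real" assume x: "x \<in> sign_cube d"
      have "x i * x i = 1" by (rule sign_cube_square[OF x R_less[OF i]])
      moreover have "?r i x * (K i x * ?r i x * K i x) =
         (x i * x i - (pred d W x i)\<^sup>2) * (K i x)\<^sup>2 - 2 * (?r i x * (pred d W x i * (K i x)\<^sup>2))"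
        by (simp add: power2_eq_square algebra_simps)
      ultimately show "?r i x * (K i x * ?r i x * K i x) =
         (1 - (pred d W x i)\<^sup>2) * (K i x)\<^sup>2 - 2 * (?r i x * (pred d W x i * (K i x)\<^sup>2))" by simp
    qed
    also have "\<dots> = expect (\<lambda>x. (1 - (pred d W x i)\<^sup>2) * (K i x)\<^sup>2)"
    proof -
      have "expect (\<lambda>x. ?r i x * (2 * (pred d W x i * (K i x)\<^sup>2))) = 0"
        using i by (intro expect_residual) (auto simp: ignores_def pred_upd K)
      then show ?thesis by (simp add: expect_diff mult.left_commute)
    qed
    also have "\<dots> \<le> expect (\<lambda>x. 4/3 * (H i x * H i x))"
    proof (rule expect_mono)
      fix x :: "nat \<Rightarrow> real" assume x: "x \<in> sign_cube d"
      have "\<bar>pred d W x i\<bar> \<le> 1/2" by (rule pred_bound[OF x i])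
      then have "(pred d W x i)\<^sup>2 \<le> (1/2)\<^sup>2" by (metis abs_ge_zero power2_abs power_mono)
      then have D: "3/4 \<le> 1 - (pred d W x i)\<^sup>2" by (simp add: power2_eq_square)
      then have "(1 - (pred d W x i)\<^sup>2) * (K i x)\<^sup>2 = (H i x)\<^sup>2 / (1 - (pred d W x i)\<^sup>2)"
        unfolding K_def by (simp add: power2_eq_square)
      also have "\<dots> \<le> (H i x)\<^sup>2 / (3/4)"
        using D by (intro divide_left_mono) auto
      finally show "(1 - (pred d W x i)\<^sup>2) * (K i x)\<^sup>2 \<le> 4/3 * (H i x * H i x)"
        by (simp add: power2_eq_square)
    qed
    also have "\<dots> = cube_avg d (\<lambda>x. 4/3 * (H i x * H i x))"
      using ignoresD[OF H[OF i]] by (intro expect_ignores) (auto simp: ignores_def)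
    also have "\<dots> = 4/3 * (\<Sum>l<d. V i l * V i l)"
      unfolding cube_avg_cmult H_def cube_avg_linear_forms ..
    finally show "expect (\<lambda>x. ?r i x * (K i x * ?r i x * K i x)) \<le> 4/3 * (\<Sum>l<d. (V i l)\<^sup>2)"
      by (simp add: power2_eq_square)
  qed
  also have "\<dots> = 4/3 * (\<Sum>i\<in>R. \<Sum>l<d. (V i l)\<^sup>2)" by (simp add: sum_distrib_left)
  finally show ?thesis unfolding H_def .
qed

end

section \<open>Laws on scaled sign vectors\<close>

text \<open>
Write \<open>exp (y\<^sup>2 / 8)\<close> as the mean of \<open>exp (g y / 2)\<close> over a standard Gaussian \<open>g\<close> and exchange the
two expectations: the bound on the moment generating function leaves a Gaussian integral.
\<close>

lemma exp_square_moment_of_mgf: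
  fixes y w :: "'a \<Rightarrow> real"
  assumes X: "finite X" and w: "\<And>x. x \<in> X \<Longrightarrow> 0 \<le> w x"
    and mgf: "\<And>t. (\<Sum>x\<in>X. w x * exp (t * y x)) \<le> exp (t\<^sup>2)"
  shows "(\<Sum>x\<in>X. w x * exp ((y x)\<^sup>2 / 8)) \<le> 2"
proof -
  have tilt: "std_normal_density g * exp (g * z / 2) = exp (z\<^sup>2 / 8) * normal_density (z / 2) 1 g" for g z
  proof -
    have "- g\<^sup>2 / 2 + g * z / 2 = z\<^sup>2 / 8 + - (g - z / 2)\<^sup>2 / 2"
      by (simp add: power2_eq_square field_simps)
    then have "exp (- g\<^sup>2 / 2) * exp (g * z / 2) = exp (z\<^sup>2 / 8) * exp (- (g - z / 2)\<^sup>2 / 2)"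
      unfolding exp_add[symmetric] by (rule arg_cong)
    then show ?thesis unfolding normal_density_def by simp
  qed
  have int: "integrable lborel (\<lambda>g. std_normal_density g * exp (g * z / 2))" for z
    unfolding tilt by simp
  have val: "(\<integral>g. std_normal_density g * exp (g * z / 2) \<partial>lborel) = exp (z\<^sup>2 / 8)" for z
    unfolding tilt by simp
  have "(\<Sum>x\<in>X. w x * exp ((y x)\<^sup>2 / 8)) = (\<integral>g. (\<Sum>x\<in>X. w x * (std_normal_density g * exp (g * y x / 2))) \<partial>lborel)"
    using int by (subst Bochner_Integration.integral_sum) (auto simp: val)
  also have "\<dots> \<le> (\<integral>g. 2 * normal_density 0 2 g \<partial>lborel)"
  proof (rule integral_mono)
    fix g :: real
    have "(\<Sum>x\<in>X. w x * (std_normal_density g * exp (g * y x / 2))) =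
        std_normal_density g * (\<Sum>x\<in>X. w x * exp (g * y x / 2))"
      by (simp add: sum_distrib_left mult.left_commute)
    also have "\<dots> \<le> std_normal_density g * exp ((g / 2)\<^sup>2)"
      using mgf[of "g / 2"] by (intro mult_left_mono) (simp_all add: mult.commute)
    also have "\<dots> = 1 / sqrt (2 * pi) * exp (- g\<^sup>2 / 4)"
      by (simp add: std_normal_density_def mult_exp_exp power2_eq_square)
    also have "\<dots> \<le> 1 / sqrt (2 * pi) * exp (- g\<^sup>2 / 8)"
      by (intro mult_left_mono) auto
    also have "\<dots> = 2 * normal_density 0 2 g"
    proof -
      have "sqrt (2 * pi * 2\<^sup>2) = 2 * sqrt (2 * pi)" unfolding real_sqrt_mult by simp
      then show ?thesis unfolding normal_density_def by simp
    qed
    finally show "(\<Sum>x\<in>X. w x * (std_normal_density g * exp (g * y x / 2))) \<le> 2 * normal_density 0 2 g" .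
  qed (use int in auto)
  also have "\<dots> = 2" by simp
  finally show ?thesis .
qed

text \<open>
The finitely many atoms carry all the mass, so the integral is a sum for an arbitrary \<open>F\<close>, in
particular for the integrand of the risk, which is itself an integral of the spectral norm.
\<close>

lemma nn_integral_finite_support:
  assumes M: "prob_space M" and W: "finite W" "inj_on \<tau> W"
    and sets: "\<And>w. w \<in> W \<Longrightarrow> {\<tau> w} \<in> sets M"
    and mass: "\<And>w. w \<in> W \<Longrightarrow> emeasure M {\<tau> w} = ennreal (q w)"
    and q: "\<And>w. w \<in> W \<Longrightarrow> 0 \<le> q w" "(\<Sum>w\<in>W. q w) = 1"
  shows "(\<integral>\<^sup>+x. F x \<partial>M) = (\<Sum>w\<in>W. ennreal (q w) * F (\<tau> w))"
proof -
  interpret prob_space M by fact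
  have "{x} \<in> sets M" if "x \<in> \<tau> ` W" for x using that sets by auto
  note sing = this
  have "\<tau> ` W = (\<Union>x\<in>\<tau> ` W. {x})" by auto
  then have im: "\<tau> ` W \<in> sets M"
    using W(1) sing by (metis (no_types, lifting) finite_imageI sets.finite_UN)
  have "emeasure M (\<tau> ` W) = (\<Sum>x\<in>\<tau> ` W. emeasure M {x})"
    by (rule emeasure_eq_sum_singleton) (use W sing in auto)
  also have "\<dots> = (\<Sum>w\<in>W. ennreal (q w))" using W mass by (simp add: sum.reindex)
  also have "\<dots> = 1" using q by (simp add: sum_ennreal)
  finally have "AE x in M. x \<in> \<tau> ` W"
    using im by (simp add: AE_in_set_eq_1 emeasure_eq_measure)
  then have "(\<integral>\<^sup>+x. F x \<partial>M) = (\<integral>\<^sup>+x. F x * indicator (\<tau> ` W) x \<partial>M)"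
    by (intro nn_integral_cong_AE) auto
  also have "\<dots> = (\<Sum>x\<in>\<tau> ` W. F x * emeasure M {x})"
    by (rule nn_integral_indicator_finite) (use W sing in auto)
  also have "\<dots> = (\<Sum>w\<in>W. ennreal (q w) * F (\<tau> w))"
    using W mass by (simp add: sum.reindex mult.commute)
  finally show ?thesis .
qed

lemma space_vec_space: "space (vec_space d) = PiE {..<d} (\<lambda>_. UNIV)"
  by (simp add: vec_space_def space_PiM)

lemma measurable_vec_coord: "i < d \<Longrightarrow> (\<lambda>x. x i) \<in> borel_measurable (vec_space d)"
  unfolding vec_space_def by (intro measurable_component_singleton) simp

lemma sets_PiM_singleton:
  assumes "finite I" "x \<in> extensional I" "\<And>i. i \<in> I \<Longrightarrow> {x i} \<in> sets (M i)"
  shows "{x} \<in> sets (PiM I M)"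
proof -
  have "{x} = PiE I (\<lambda>i. {x i})"
    using PiE_singleton[OF assms(2)] by simp
  then show ?thesis using assms by (simp add: sets_PiM_I_finite)
qed

lemma sets_vec_space_singleton: "x \<in> space (vec_space d) \<Longrightarrow> {x} \<in> sets (vec_space d)"
  unfolding vec_space_def by (intro sets_PiM_singleton) (auto simp: space_PiM PiE_def)

definition scale_vec :: "nat \<Rightarrow> real \<Rightarrow> rvec \<Rightarrow> rvec" where
  "scale_vec d s x = (\<lambda>i\<in>{..<d}. s * x i)"

lemma scale_vec_space: "scale_vec d s x \<in> space (vec_space d)"
  by (simp add: scale_vec_def space_vec_space)

lemma inj_scale_vec: "s \<noteq> 0 \<Longrightarrow> inj_on (scale_vec d s) (sign_cube d)"
proof (rule inj_onI)
  fix x y :: rvec assume s: "s \<noteq> 0" and x: "x \<in> sign_cube d" and y: "y \<in> sign_cube d"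
    and eq: "scale_vec d s x = scale_vec d s y"
  show "x = y"
  proof (rule PiE_ext[OF x y])
    fix i assume "i \<in> {..<d}"
    then show "x i = y i" using fun_cong[OF eq, of i] s by (simp add: scale_vec_def)
  qed
qed

definition sign_law :: "nat \<Rightarrow> nat set \<Rightarrow> (nat \<Rightarrow> nat \<Rightarrow> real) \<Rightarrow> real \<Rightarrow> rvec measure" where
  "sign_law d R W s =
     distr (point_measure (sign_cube d) (\<lambda>x. ennreal (lik d R W x))) (vec_space d) (scale_vec d s)"

definition scale_data :: "nat \<Rightarrow> nat \<Rightarrow> real \<Rightarrow> (nat \<Rightarrow> rvec) \<Rightarrow> (nat \<Rightarrow> rvec)" where
  "scale_data n d s S = (\<lambda>i\<in>{..<n}. scale_vec d s (S i))"

lemma scale_data_space: "scale_data n d s S \<in> space (dataset_space n d)"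
  by (auto simp: scale_data_def dataset_space_def space_PiM scale_vec_space)

lemma scale_data_adjacent:
  assumes "s \<noteq> 0" "S \<in> PiE {..<n} (\<lambda>_. sign_cube d)" "i < n" "x \<in> sign_cube d" "x \<noteq> S i"
  shows "adjacent n d (scale_data n d s S) (scale_data n d s (S(i := x)))"
proof -
  have "scale_vec d s (S i) \<noteq> scale_vec d s x"
    using inj_onD[OF inj_scale_vec[OF assms(1)], of d "S i" x] assms by (auto simp: PiE_iff)
  then have "{l. l < n \<and> scale_data n d s S l \<noteq> scale_data n d s (S(i := x)) l} = {i}"
    using assms by (auto simp: scale_data_def)
  then show ?thesis by (simp add: adjacent_def scale_data_space)
qed

context sign_regression
begin

lemma sets_law [simp, measurable_cong]: "sets (sign_law d R W s) = sets (vec_space d)"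
  by (simp add: sign_law_def)

lemma nn_integral_law:
  assumes [measurable]: "f \<in> borel_measurable (vec_space d)"
  shows "(\<integral>\<^sup>+x. f x \<partial>sign_law d R W s) = (\<Sum>x\<in>sign_cube d. ennreal (lik d R W x) * f (scale_vec d s x))"
  unfolding sign_law_def
  by (subst nn_integral_distr)
    (auto simp: nn_integral_point_measure_finite finite_sign_cube scale_vec_space)

lemma prob_space_law: "prob_space (sign_law d R W s)"
proof (rule prob_spaceI)
  have "emeasure (sign_law d R W s) (space (sign_law d R W s)) = (\<integral>\<^sup>+x. 1 \<partial>sign_law d R W s)"
    by simp
  also have "\<dots> = (\<Sum>x\<in>sign_cube d. ennreal (lik d R W x))"
    by (subst nn_integral_law) auto
  also have "\<dots> = 1" using lik_sum lik_pos by (subst sum_ennreal) (auto intro: less_imp_le)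
  finally show "emeasure (sign_law d R W s) (space (sign_law d R W s)) = 1" .
qed

lemma integral_law:
  assumes "f \<in> borel_measurable (vec_space d)"
  shows "(\<integral>x. f x \<partial>sign_law d R W s) = expect (\<lambda>x. f (scale_vec d s x))"
  unfolding sign_law_def expect_def
  using assms lik_pos
  by (subst integral_distr)
    (auto simp: lebesgue_integral_point_measure_finite finite_sign_cube scale_vec_space less_imp_le)

lemma mean_law: "i < d \<Longrightarrow> mean_vec (sign_law d R W s) i = 0"
  unfolding mean_vec_def
  by (subst integral_law)
    (use expect_coord[of i] in \<open>auto simp: measurable_vec_coord scale_vec_def expect_def sum_distrib_left[symmetric] mult.left_commute\<close>)

lemma cov_law:
  assumes "i < d" "j < d"
  shows "cov_mat (sign_law d R W s) i j = s\<^sup>2 * expect (\<lambda>x. x i * x j)"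
proof -
  have "cov_mat (sign_law d R W s) i j = expect (\<lambda>x. (s * x i) * (s * x j))"
    unfolding cov_mat_def mean_law[OF assms(1)] mean_law[OF assms(2)]
    by (subst integral_law)
      (use assms in \<open>auto intro!: borel_measurable_times measurable_vec_coord simp: scale_vec_def\<close>)
  also have "\<dots> = s\<^sup>2 * expect (\<lambda>x. x i * x j)"
    unfolding expect_def by (simp add: sum_distrib_left power2_eq_square mult_ac)
  finally show ?thesis .
qed

lemma psd_cov_law: "psd d (cov_mat (sign_law d R W s))"
  unfolding psd_def
proof (intro conjI allI impI)
  fix i j assume "i < d" "j < d"
  then show "cov_mat (sign_law d R W s) i j = cov_mat (sign_law d R W s) j i"
    by (simp add: cov_law mult.commute)
next
  fix v :: "nat \<Rightarrow> real"
  have "(\<Sum>i<d. \<Sum>j<d. v i * cov_mat (sign_law d R W s) i j * v j) =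
      s\<^sup>2 * expect (\<lambda>x. (\<Sum>i<d. v i * x i)\<^sup>2)"
  proof -
    have "expect (\<lambda>x. (\<Sum>i<d. v i * x i)\<^sup>2) = expect (\<lambda>x. \<Sum>i<d. \<Sum>j<d. (v i * v j) * (x i * x j))"
      by (simp add: power2_eq_square sum_product mult_ac)
    also have "\<dots> = (\<Sum>i<d. \<Sum>j<d. expect (\<lambda>x. (v i * v j) * (x i * x j)))"
      by (simp only: expect_sum)
    also have "\<dots> = (\<Sum>i<d. \<Sum>j<d. v i * v j * expect (\<lambda>x. x i * x j))"
      unfolding expect_def by (simp add: sum_distrib_left mult_ac)
    finally show ?thesis by (simp add: sum_distrib_left cov_law mult_ac)
  qed
  also have "\<dots> \<ge> 0"
    unfolding expect_def using lik_pos by (intro mult_nonneg_nonneg sum_nonneg) (auto intro: less_imp_le)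
  finally show "0 \<le> (\<Sum>i<d. \<Sum>j<d. v i * cov_mat (sign_law d R W s) i j * v j)" .
qed

text \<open>
By the bound on the moment generating function every unit linear form \<open>y\<close> in the signs satisfies
\<open>E exp (y\<^sup>2 / 8) \<le> 2\<close>, and \<open>s\<^sup>2 \<le> K\<^sup>2 / 8\<close> makes the scaled exponent at most \<open>y\<^sup>2 / 8\<close>.
\<close>

lemma psi2_law:
  assumes K: "0 < K" and s: "s\<^sup>2 \<le> K\<^sup>2 / 8"
  shows "psi2_norm_vec d (sign_law d R W s) (\<lambda>x i. x i - mean_vec (sign_law d R W s) i) \<le> ennreal K"
  unfolding psi2_norm_vec_def
proof (rule SUP_least)
  fix v :: rvec assume "v \<in> {v. L2_set v {..<d} = 1}"
  then have v: "(\<Sum>i<d. (v i)\<^sup>2) = 1" by (simp add: L2_set_def)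
  let ?\<mu> = "mean_vec (sign_law d R W s)"
  let ?\<xi> = "\<lambda>x. \<Sum>i<d. (x i - ?\<mu> i) * v i"
  have meas: "?\<xi> \<in> borel_measurable (vec_space d)"
    by (intro borel_measurable_sum borel_measurable_times borel_measurable_diff measurable_vec_coord) auto
  have \<xi>: "?\<xi> (scale_vec d s x) = s * (\<Sum>i<d. v i * x i)" for x
    by (auto simp: scale_vec_def mean_law sum_distrib_left mult_ac intro!: sum.cong)
  have "(\<integral>\<^sup>+x. ennreal (exp ((?\<xi> x)\<^sup>2 / K\<^sup>2)) \<partial>sign_law d R W s) =
      (\<Sum>x\<in>sign_cube d. ennreal (lik d R W x) * ennreal (exp ((?\<xi> (scale_vec d s x))\<^sup>2 / K\<^sup>2)))"
    by (rule nn_integral_law) (use meas in measurable)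
  also have "\<dots> = ennreal (\<Sum>x\<in>sign_cube d. lik d R W x * exp ((?\<xi> (scale_vec d s x))\<^sup>2 / K\<^sup>2))"
    using lik_pos by (subst sum_ennreal[symmetric]) (auto simp: ennreal_mult less_imp_le)
  also have "\<dots> \<le> ennreal 2"
  proof (rule ennreal_leI)
    have "(\<Sum>x\<in>sign_cube d. lik d R W x * exp ((?\<xi> (scale_vec d s x))\<^sup>2 / K\<^sup>2)) \<le>
        (\<Sum>x\<in>sign_cube d. lik d R W x * exp ((\<Sum>i<d. v i * x i)\<^sup>2 / 8))"
    proof (intro sum_mono mult_left_mono)
      fix x :: rvec assume "x \<in> sign_cube d"
      then show "0 \<le> lik d R W x" using lik_pos less_imp_le by blast
      let ?y = "\<Sum>i<d. v i * x i"
      have "s\<^sup>2 * ?y\<^sup>2 \<le> K\<^sup>2 / 8 * ?y\<^sup>2" using s by (intro mult_right_mono) auto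
      then have "(s * ?y)\<^sup>2 / K\<^sup>2 \<le> ?y\<^sup>2 / 8" using K by (simp add: power_mult_distrib field_simps)
      then show "exp ((?\<xi> (scale_vec d s x))\<^sup>2 / K\<^sup>2) \<le> exp (?y\<^sup>2 / 8)" unfolding \<xi> by simp
    qed
    also have "\<dots> \<le> 2"
    proof (rule exp_square_moment_of_mgf[OF finite_sign_cube])
      fix t :: real
      have "(\<Sum>x\<in>sign_cube d. lik d R W x * exp (t * (\<Sum>i<d. v i * x i))) =
          expect (\<lambda>x. exp (\<Sum>i<d. (t * v i) * x i))"
        unfolding expect_def by (simp add: sum_distrib_left mult.assoc)
      also have "\<dots> \<le> exp (\<Sum>i<d. (t * v i)\<^sup>2)" by (rule expect_exp_linear)
      also have "\<dots> = exp (t\<^sup>2)" by (simp add: power_mult_distrib sum_distrib_left[symmetric] v)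
      finally show "(\<Sum>x\<in>sign_cube d. lik d R W x * exp (t * (\<Sum>i<d. v i * x i))) \<le> exp (t\<^sup>2)" .
    qed (use lik_pos less_imp_le in blast)
    finally show "(\<Sum>x\<in>sign_cube d. lik d R W x * exp ((?\<xi> (scale_vec d s x))\<^sup>2 / K\<^sup>2)) \<le> 2" .
  qed
  finally show "psi2_norm (sign_law d R W s) ?\<xi> \<le> ennreal K"
    unfolding psi2_norm_def using K by (intro Inf_lower) auto
qed

lemma nn_integral_samples:
  assumes s: "s \<noteq> 0"
  shows "(\<integral>\<^sup>+S. F S \<partial>PiM {..<n} (\<lambda>_. sign_law d R W s)) =
    (\<Sum>S\<in>PiE {..<n} (\<lambda>_. sign_cube d). ennreal (\<Prod>i<n. lik d R W (S i)) * F (scale_data n d s S))"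
proof (rule nn_integral_finite_support)
  let ?P = "sign_law d R W s"
  interpret P: prob_space ?P by (rule prob_space_law)
  interpret product_sigma_finite "\<lambda>_::nat. ?P"
    by (simp add: product_sigma_finite_def P.sigma_finite_measure_axioms)
  show "prob_space (PiM {..<n} (\<lambda>_. ?P))" by (rule prob_space_PiM) (rule prob_space_law)
  show "finite (PiE {..<n} (\<lambda>_. sign_cube d))" by (intro finite_PiE finite_sign_cube) auto
  show "inj_on (scale_data n d s) (PiE {..<n} (\<lambda>_. sign_cube d))"
  proof (rule inj_onI)
    fix S T assume S: "S \<in> PiE {..<n} (\<lambda>_. sign_cube d)" and T: "T \<in> PiE {..<n} (\<lambda>_. sign_cube d)"
      and eq: "scale_data n d s S = scale_data n d s T"
    show "S = T"
    proof (rule PiE_ext[OF S T])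
      fix i assume i: "i \<in> {..<n}"
      then have "scale_vec d s (S i) = scale_vec d s (T i)"
        using fun_cong[OF eq, of i] by (simp add: scale_data_def)
      then show "S i = T i"
        by (rule inj_onD[OF inj_scale_vec[OF s]]) (use S T i in auto)
    qed
  qed
  fix S assume S: "S \<in> PiE {..<n} (\<lambda>_. sign_cube d)"
  have eq: "{scale_data n d s S} = PiE {..<n} (\<lambda>i. {scale_vec d s (S i)})"
  proof -
    have "{scale_data n d s S} = PiE {..<n} (\<lambda>i. {scale_data n d s S i})"
      by (rule PiE_singleton[symmetric]) (unfold scale_data_def, rule restrict_extensional)
    also have "PiE {..<n} (\<lambda>i. {scale_data n d s S i}) = PiE {..<n} (\<lambda>i. {scale_vec d s (S i)})"
      by (rule PiE_cong) (simp add: scale_data_def)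
    finally show ?thesis .
  qed
  have sing: "{scale_vec d s (S i)} \<in> sets ?P" for i
    by (simp add: sets_vec_space_singleton scale_vec_space)
  show "{scale_data n d s S} \<in> sets (PiM {..<n} (\<lambda>_. ?P))"
    unfolding eq using sing by (intro sets_PiM_I_finite) auto
  have mass: "emeasure ?P {scale_vec d s x} = ennreal (lik d R W x)" if x: "x \<in> sign_cube d" for x
  proof -
    have A: "{scale_vec d s x} \<in> sets (vec_space d)"
      by (simp add: sets_vec_space_singleton scale_vec_space)
    have "emeasure ?P {scale_vec d s x} = (\<integral>\<^sup>+y. indicator {scale_vec d s x} y \<partial>?P)"
      using A by simp
    also have "\<dots> = (\<Sum>y\<in>sign_cube d. ennreal (lik d R W y) * indicator {scale_vec d s x} (scale_vec d s y))"
      using A by (intro nn_integral_law) auto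
    also have "\<dots> = (\<Sum>y\<in>{x}. ennreal (lik d R W y) * indicator {scale_vec d s x} (scale_vec d s y))"
      using x inj_onD[OF inj_scale_vec[OF s], of d _ x]
      by (intro sum.mono_neutral_right) (auto simp: finite_sign_cube indicator_def)
    finally show ?thesis by simp
  qed
  show "emeasure (PiM {..<n} (\<lambda>_. ?P)) {scale_data n d s S} = ennreal (\<Prod>i<n. lik d R W (S i))"
  proof -
    have "emeasure (PiM {..<n} (\<lambda>_. ?P)) {scale_data n d s S} = (\<Prod>i<n. emeasure ?P {scale_vec d s (S i)})"
      unfolding eq using sing by (intro emeasure_PiM) auto
    also have "\<dots> = (\<Prod>i<n. ennreal (lik d R W (S i)))"
      using S by (intro prod.cong refl mass) auto
    also have "\<dots> = ennreal (\<Prod>i<n. lik d R W (S i))"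
      using S lik_pos by (intro prod_ennreal) (meson PiE_mem less_imp_le)
    finally show ?thesis .
  qed
  show "0 \<le> (\<Prod>i<n. lik d R W (S i))"
    using S lik_pos by (intro prod_nonneg) (auto simp: PiE_iff less_imp_le)
next
  show "(\<Sum>S\<in>PiE {..<n} (\<lambda>_. sign_cube d). \<Prod>i<n. lik d R W (S i)) = 1"
    using prod_sum_PiE[of "{..<n}" "\<lambda>_. sign_cube d" "\<lambda>_. lik d R W"] by (simp add: finite_sign_cube lik_sum)
qed

end

section \<open>Spectral norm and the covariance classes\<close>

lemma L2_set_abs: "L2_set (\<lambda>i. \<bar>f i\<bar>) A = L2_set f A"
  by (simp add: L2_set_def)

text \<open>
The supremum in the definition of the spectral norm is over a bounded set: on the unit ball the image
is bounded by the absolute row sums.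
\<close>

lemma spectral_norm_ge:
  assumes "L2_set x {..<d} \<le> 1"
  shows "L2_set (mat_vec d A x) {..<d} \<le> spectral_norm d A"
  unfolding spectral_norm_def
proof (rule cSUP_upper)
  show "bdd_above ((\<lambda>x. L2_set (mat_vec d A x) {..<d}) ` {x. L2_set x {..<d} \<le> 1})"
  proof (rule bdd_aboveI2)
    fix x :: rvec assume "x \<in> {x. L2_set x {..<d} \<le> 1}"
    then have x: "L2_set x {..<d} \<le> 1" by simp
    have x1: "\<bar>x j\<bar> \<le> 1" if "j < d" for j
      using member_le_L2_set[of "{..<d}" j "\<lambda>i. \<bar>x i\<bar>"] that x by (simp add: L2_set_abs)
    have "L2_set (mat_vec d A x) {..<d} = L2_set (\<lambda>i. \<bar>mat_vec d A x i\<bar>) {..<d}" by (simp add: L2_set_abs)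
    also have "\<dots> \<le> L2_set (\<lambda>i. \<Sum>j<d. \<bar>A i j\<bar>) {..<d}"
    proof (rule L2_set_mono)
      fix i
      have "\<bar>mat_vec d A x i\<bar> \<le> (\<Sum>j<d. \<bar>A i j * x j\<bar>)" unfolding mat_vec_def by (rule sum_abs)
      also have "\<dots> \<le> (\<Sum>j<d. \<bar>A i j\<bar> * 1)"
        unfolding abs_mult by (intro sum_mono mult_left_mono x1) auto
      finally show "\<bar>mat_vec d A x i\<bar> \<le> (\<Sum>j<d. \<bar>A i j\<bar>)" by simp
    qed simp
    finally show "L2_set (mat_vec d A x) {..<d} \<le> L2_set (\<lambda>i. \<Sum>j<d. \<bar>A i j\<bar>) {..<d}" .
  qed
qed (use assms in simp)

text \<open>
Test the matrix on the normalised indicator vector of \<open>U\<close>.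
\<close>

lemma spectral_norm_group_sum:
  assumes U: "U \<subseteq> {..<d}" "U \<noteq> {}"
  shows "(\<Sum>i<d. (\<Sum>l\<in>U. A i l)\<^sup>2) \<le> card U * (spectral_norm d A)\<^sup>2"
proof -
  have fU: "finite U" using U finite_subset by blast
  have c: "0 < real (card U)" using U fU by (simp add: card_gt_0_iff)
  define v where "v l = of_bool (l \<in> U) / sqrt (card U)" for l
  have "(\<Sum>l<d. (v l)\<^sup>2) = (\<Sum>l\<in>U. 1 / card U)"
    using U c by (intro sum.mono_neutral_cong_right) (auto simp: v_def power_divide)
  then have "L2_set v {..<d} \<le> 1" using c by (simp add: L2_set_def)
  then have "L2_set (mat_vec d A v) {..<d} \<le> spectral_norm d A" by (rule spectral_norm_ge)
  then have "(L2_set (mat_vec d A v) {..<d})\<^sup>2 \<le> (spectral_norm d A)\<^sup>2" by (intro power_mono) auto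
  moreover have "(L2_set (mat_vec d A v) {..<d})\<^sup>2 = (\<Sum>i<d. (mat_vec d A v i)\<^sup>2)"
    by (simp add: L2_set_def sum_nonneg)
  moreover have "mat_vec d A v i = (\<Sum>l\<in>U. A i l) / sqrt (card U)" for i
    unfolding mat_vec_def sum_divide_distrib
    using U by (intro sum.mono_neutral_cong_right) (auto simp: v_def)
  ultimately show ?thesis using c
    by (simp add: power_divide sum_divide_distrib[symmetric] field_simps)
qed

lemma card_band_le:
  "card {j. j < d \<and> j \<noteq> i \<and> \<bar>real i - real j\<bar> < 2 * real k} \<le> 4 * k"
proof -
  have "{j. j < d \<and> j \<noteq> i \<and> \<bar>real i - real j\<bar> < 2 * real k} \<subseteq> {i - 2 * k..<i + 2 * k}"
    by auto
  then have "card {j. j < d \<and> j \<noteq> i \<and> \<bar>real i - real j\<bar> < 2 * real k} \<le> card {i - 2 * k..<i + 2 * k}"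
    by (intro card_mono) auto
  then show ?thesis by simp
qed

text \<open>
A matrix of bandwidth \<open>2k\<close> whose off-diagonal entries have the size that the decay condition allows
at distance \<open>2k\<close> lies in both classes: at smaller distances the conditions are weaker, at larger
distances the entries vanish. A row has at most \<open>4k\<close> off-diagonal entries in the band, so its
absolute sum is at most \<open>2 \<sigma> (2k) powr -\<alpha>\<close>; this gives the row-tail condition and the upper bound
on the spectrum.
\<close>

lemma banded_in_classes:
  fixes S :: rmat
  assumes psd: "psd d S" and k: "1 \<le> k" and \<alpha>: "0 < \<alpha>" and \<sigma>: "0 \<le> \<sigma>"
    and diag: "\<And>i. i < d \<Longrightarrow> S i i = \<sigma>"
    and off: "\<And>i j. i < d \<Longrightarrow> j < d \<Longrightarrow> i \<noteq> j \<Longrightarrow> \<bar>S i j\<bar> \<le> \<sigma> * (2 * real k) powr (- (\<alpha> + 1))"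
    and band: "\<And>i j. i < d \<Longrightarrow> j < d \<Longrightarrow> 2 * real k \<le> \<bar>real i - real j\<bar> \<Longrightarrow> S i j = 0"
    and M0: "3 * \<sigma> \<le> M0" and M: "2 * \<sigma> \<le> M"
  shows "S \<in> decay_class \<alpha> M0 M d" "S \<in> row_tail_class \<alpha> M0 M d"
proof -
  have sym: "S i j = S j i" if "i < d" "j < d" for i j using psd that by (simp add: psd_def)
  let ?b = "(2 * real k) powr (- \<alpha>)"
  have b1: "?b \<le> 1" using k \<alpha> powr_mono[of "-\<alpha>" 0 "2 * real k"] by simp
  have b: "(2 * real k) powr (- (\<alpha> + 1)) * (2 * real k) = ?b"
    using k by (simp add: powr_diff powr_minus_divide powr_add field_simps)
  have row: "(\<Sum>j | j < d \<and> j \<noteq> i. \<bar>S i j\<bar>) \<le> 2 * \<sigma> * ?b" if i: "i < d" for i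
  proof -
    have "(\<Sum>j | j < d \<and> j \<noteq> i. \<bar>S i j\<bar>) = (\<Sum>j | j < d \<and> j \<noteq> i \<and> \<bar>real i - real j\<bar> < 2 * real k. \<bar>S i j\<bar>)"
    proof (intro sum.mono_neutral_right)
      have "\<bar>real i - real j\<bar> < 2 * real k" if "j < d" "S i j \<noteq> 0" for j
        using band[OF i that(1)] that(2) by (meson not_less)
      then show "\<forall>j\<in>{j. j < d \<and> j \<noteq> i} - {j. j < d \<and> j \<noteq> i \<and> \<bar>real i - real j\<bar> < 2 * real k}. \<bar>S i j\<bar> = 0"
        by auto
    qed auto
    also have "\<dots> \<le> (\<Sum>j | j < d \<and> j \<noteq> i \<and> \<bar>real i - real j\<bar> < 2 * real k. \<sigma> * (2 * real k) powr (- (\<alpha> + 1)))"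
      using i off by (intro sum_mono) auto
    also have "\<dots> \<le> real (4 * k) * (\<sigma> * (2 * real k) powr (- (\<alpha> + 1)))"
      unfolding sum_constant using \<sigma> card_band_le[of d i k]
      by (intro mult_right_mono) (auto simp del: of_nat_mult)
    also have "\<dots> = 2 * \<sigma> * ((2 * real k) powr (- (\<alpha> + 1)) * (2 * real k))" by simp
    finally show ?thesis unfolding b .
  qed
  have row_total: "(\<Sum>j<d. \<bar>S i j\<bar>) \<le> M0" if i: "i < d" for i
  proof -
    have "(\<Sum>j<d. \<bar>S i j\<bar>) = \<bar>S i i\<bar> + (\<Sum>j\<in>{..<d} - {i}. \<bar>S i j\<bar>)"
      using i by (intro sum.remove) auto
    also have "{..<d} - {i} = {j. j < d \<and> j \<noteq> i}" by auto
    finally have "(\<Sum>j<d. \<bar>S i j\<bar>) \<le> \<sigma> + 2 * \<sigma> * ?b" using row[OF i] diag[OF i] \<sigma> by simp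
    also have "\<dots> \<le> \<sigma> + 2 * \<sigma> * 1" using b1 \<sigma> by (intro add_left_mono mult_left_mono) auto
    finally show ?thesis using M0 by simp
  qed
  have upper: "psd d (\<lambda>i j. scaled_id M0 i j - S i j)"
    unfolding psd_def
  proof (intro conjI allI impI)
    fix i j assume "i < d" "j < d"
    then show "scaled_id M0 i j - S i j = scaled_id M0 j i - S j i"
      using sym by (auto simp: scaled_id_def)
  next
    fix x :: rvec
    have "(\<Sum>i<d. \<Sum>j<d. x i * S i j * x j) \<le> (\<Sum>i<d. \<Sum>j<d. \<bar>S i j\<bar> * (x i)\<^sup>2 / 2 + \<bar>S j i\<bar> * (x j)\<^sup>2 / 2)"
    proof (intro sum_mono)
      fix i j assume "i \<in> {..<d}" "j \<in> {..<d}"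
      then have s: "S j i = S i j" using sym by auto
      have "x i * S i j * x j \<le> \<bar>S i j\<bar> * (\<bar>x i\<bar> * \<bar>x j\<bar>)"
        by (metis abs_ge_self abs_mult mult.commute mult.left_commute)
      also have "\<dots> \<le> \<bar>S i j\<bar> * ((x i)\<^sup>2 / 2 + (x j)\<^sup>2 / 2)"
      proof (rule mult_left_mono)
        have "0 \<le> (\<bar>x i\<bar> - \<bar>x j\<bar>)\<^sup>2" by simp
        also have "\<dots> = (x i)\<^sup>2 + (x j)\<^sup>2 - 2 * (\<bar>x i\<bar> * \<bar>x j\<bar>)"
          unfolding power2_diff by simp
        finally show "\<bar>x i\<bar> * \<bar>x j\<bar> \<le> (x i)\<^sup>2 / 2 + (x j)\<^sup>2 / 2" by simp
      qed simp
      finally show "x i * S i j * x j \<le> \<bar>S i j\<bar> * (x i)\<^sup>2 / 2 + \<bar>S j i\<bar> * (x j)\<^sup>2 / 2"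
        by (simp add: s algebra_simps)
    qed
    also have "\<dots> = (\<Sum>i<d. \<Sum>j<d. \<bar>S i j\<bar> * (x i)\<^sup>2 / 2) + (\<Sum>i<d. \<Sum>j<d. \<bar>S j i\<bar> * (x j)\<^sup>2 / 2)"
      by (simp only: sum.distrib)
    also have "(\<Sum>i<d. \<Sum>j<d. \<bar>S j i\<bar> * (x j)\<^sup>2 / 2) = (\<Sum>i<d. \<Sum>j<d. \<bar>S i j\<bar> * (x i)\<^sup>2 / 2)"
      by (rule sum.swap)
    also have "(\<Sum>i<d. \<Sum>j<d. \<bar>S i j\<bar> * (x i)\<^sup>2 / 2) + (\<Sum>i<d. \<Sum>j<d. \<bar>S i j\<bar> * (x i)\<^sup>2 / 2) = (\<Sum>i<d. (\<Sum>j<d. \<bar>S i j\<bar>) * (x i)\<^sup>2)"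
      by (simp only: sum.distrib[symmetric] field_sum_of_halves sum_distrib_right)
    also have "\<dots> \<le> (\<Sum>i<d. M0 * (x i)\<^sup>2)"
      by (intro sum_mono mult_right_mono row_total) auto
    also have "\<dots> = (\<Sum>i<d. \<Sum>j<d. x i * scaled_id M0 i j * x j)"
      by (intro sum.cong refl) (simp add: scaled_id_def power2_eq_square if_distrib if_distribR cong: if_cong)
    finally show "0 \<le> (\<Sum>i<d. \<Sum>j<d. x i * (scaled_id M0 i j - S i j) * x j)"
      by (simp add: algebra_simps sum_subtractf)
  qed
  show "S \<in> decay_class \<alpha> M0 M d"
    unfolding decay_class_def
  proof (intro CollectI conjI psd upper allI impI)
    fix i j assume ij: "i < d" "j < d" "i \<noteq> j"
    show "\<bar>S i j\<bar> \<le> M * \<bar>real i - real j\<bar> powr - (\<alpha> + 1)"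
    proof (cases "2 * real k \<le> \<bar>real i - real j\<bar>")
      case True
      then show ?thesis using band[OF ij(1,2)] M \<sigma> by simp
    next
      case False
      have "(2 * real k) powr (- (\<alpha> + 1)) \<le> \<bar>real i - real j\<bar> powr (- (\<alpha> + 1))"
        using False ij \<alpha> by (intro powr_mono2') auto
      then have "\<sigma> * (2 * real k) powr (- (\<alpha> + 1)) \<le> M * \<bar>real i - real j\<bar> powr (- (\<alpha> + 1))"
        using M \<sigma> by (intro mult_mono) auto
      then show ?thesis using off[OF ij] by simp
    qed
  qed
  show "S \<in> row_tail_class \<alpha> M0 M d"
    unfolding row_tail_class_def
  proof (intro CollectI conjI psd upper allI impI)
    fix k' j :: nat assume k': "1 \<le> k'" and j: "j < d"
    have eq: "(\<Sum>i | i < d \<and> int k' < \<bar>int i - int j\<bar>. \<bar>S i j\<bar>) = (\<Sum>i | i < d \<and> int k' < \<bar>int i - int j\<bar>. \<bar>S j i\<bar>)"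
      using sym j by (intro sum.cong) auto
    show "(\<Sum>i | i < d \<and> int k' < \<bar>int i - int j\<bar>. \<bar>S i j\<bar>) \<le> M * real k' powr - \<alpha>"
    proof (cases "2 * k \<le> k'")
      case True
      have "S j i = 0" if "i < d" "int k' < \<bar>int i - int j\<bar>" for i
        using True that j by (intro band) auto
      then show ?thesis unfolding eq using M \<sigma> by (simp add: sum.neutral)
    next
      case False
      have "(\<Sum>i | i < d \<and> int k' < \<bar>int i - int j\<bar>. \<bar>S j i\<bar>) \<le> (\<Sum>i | i < d \<and> i \<noteq> j. \<bar>S j i\<bar>)"
        by (intro sum_mono2) auto
      also have "\<dots> \<le> 2 * \<sigma> * ?b" by (rule row[OF j])
      also have "\<dots> \<le> M * real k' powr - \<alpha>"
        using False k' M \<sigma> \<alpha> by (intro mult_mono powr_mono2') auto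
      finally show ?thesis unfolding eq .
    qed
  qed
qed

section \<open>The block design\<close>

text \<open>
Coordinates \<open>i\<close> with \<open>i mod (2k) < k\<close> are responses, the others predictors; group \<open>q\<close> is the \<open>q\<close>-th
run of \<open>m\<close> predictors in the block that contains \<open>i\<close>.
\<close>

definition predictor_group :: "nat \<Rightarrow> nat \<Rightarrow> nat \<Rightarrow> nat \<Rightarrow> nat set" where
  "predictor_group k m i q = {2 * k * (i div (2 * k)) + k + q * m ..< 2 * k * (i div (2 * k)) + k + Suc q * m}"

locale block_design =
  fixes d k r m B :: nat and a :: real
  assumes pos: "0 < k" "0 < r" "0 < m" "0 < B"
    and rm_le: "r * m \<le> k" and B_le: "2 * k * B \<le> d"
    and a_pos: "0 < a" and ak_le: "a * real k \<le> 1/2"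
begin

definition responses :: "nat set" where
  "responses = {i. i < 2 * k * B \<and> i mod (2 * k) < k}"

abbreviation pairs :: "(nat \<times> nat) set" where
  "pairs \<equiv> responses \<times> {..<r}"

text \<open>
For a fixed response at most one summand is nonzero for each \<open>l\<close>. The same formula with an arbitrary
vector in place of \<open>\<theta>\<close> gives the coefficients of a linear combination of scores.
\<close>

definition coef :: "(nat \<times> nat \<Rightarrow> real) \<Rightarrow> nat \<Rightarrow> nat \<Rightarrow> real" where
  "coef \<theta> i l = (if i \<in> responses then \<Sum>q<r. a * \<theta> (i, q) * of_bool (l \<in> predictor_group k m i q) else 0)"

lemma finite_responses: "finite responses"
  unfolding responses_def by (rule finite_subset[of _ "{..<2 * k * B}"]) auto

lemma responses_less: "i \<in> responses \<Longrightarrow> i < d"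
  using B_le by (auto simp: responses_def)

lemma block_less: "i \<in> responses \<Longrightarrow> i div (2 * k) < B"
  using pos by (auto simp: responses_def less_mult_imp_div_less mult.commute)

lemma card_group: "card (predictor_group k m i q) = m"
  by (simp add: predictor_group_def)

lemma group_block:
  assumes "q < r" "l \<in> predictor_group k m i q"
  shows "l div (2 * k) = i div (2 * k)" "k \<le> l mod (2 * k)"
proof -
  have "Suc q * m \<le> r * m" using assms(1) by (intro mult_right_mono) auto
  then have le: "Suc q * m \<le> k" using rm_le by simp
  define e where "e = l - 2 * k * (i div (2 * k))"
  have l: "l = 2 * k * (i div (2 * k)) + e" "k \<le> e" "e < 2 * k"
    using assms(2) le unfolding predictor_group_def e_def by auto
  then show "l div (2 * k) = i div (2 * k)" using pos
    by (subst l(1)) (simp add: div_mult_self4 del: mult_Suc)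
  have "l mod (2 * k) = e" using l pos by (metis mod_mult_self4 mod_less)
  then show "k \<le> l mod (2 * k)" using l by simp
qed

lemma group_not_response: "q < r \<Longrightarrow> l \<in> predictor_group k m i q \<Longrightarrow> l \<notin> responses"
  using group_block(2)[of q l i] by (auto simp: responses_def)

lemma group_less:
  assumes "i div (2 * k) < B" "q < r" "l \<in> predictor_group k m i q"
  shows "l < d"
proof -
  have "l div (2 * k) < B" using group_block(1)[OF assms(2,3)] assms(1) by simp
  then have "l < B * (2 * k)" using pos by (simp add: div_less_iff_less_mult)
  then show ?thesis using B_le by (simp add: mult.commute)
qed

lemma group_disjoint:
  assumes "l \<in> predictor_group k m i q" "l \<in> predictor_group k m i q'"
  shows "q = q'"
proof -
  have "q < Suc q'" "q' < Suc q"
  proof -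
    have "q * m < Suc q' * m" "q' * m < Suc q * m" using assms by (auto simp: predictor_group_def)
    then show "q < Suc q'" "q' < Suc q" using pos by (simp_all only: mult_less_cancel2)
  qed
  then show ?thesis by simp
qed

lemma coef_group:
  assumes "i \<in> responses" "q < r" "l \<in> predictor_group k m i q"
  shows "coef \<theta> i l = a * \<theta> (i, q)"
proof -
  have "(\<Sum>q'<r. a * \<theta> (i, q') * of_bool (l \<in> predictor_group k m i q')) = (\<Sum>q'\<in>{q}. a * \<theta> (i, q') * of_bool (l \<in> predictor_group k m i q'))"
    using assms group_disjoint by (intro sum.mono_neutral_right) auto
  then show ?thesis using assms by (simp add: coef_def)
qed

lemma coef_nonzero:
  assumes "coef \<theta> i l \<noteq> 0"
  shows "i \<in> responses" "\<exists>q<r. l \<in> predictor_group k m i q"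
proof -
  show i: "i \<in> responses" using assms by (auto simp: coef_def split: if_splits)
  show "\<exists>q<r. l \<in> predictor_group k m i q"
    using assms i by (auto simp: coef_def elim!: sum.not_neutral_contains_not_neutral)
qed

lemma coef_support:
  assumes "coef \<theta> i l \<noteq> 0"
  shows "i \<in> responses \<and> l < d \<and> l \<notin> responses" "l div (2 * k) = i div (2 * k)"
  using coef_nonzero[OF assms] group_block group_not_response group_less block_less by blast+

lemma coef_bound:
  assumes \<theta>: "\<theta> \<in> PiE pairs (\<lambda>_. {-1..1})"
  shows "\<bar>coef \<theta> i l\<bar> \<le> a"
proof (cases "coef \<theta> i l = 0")
  case False
  then obtain q where q: "q < r" "l \<in> predictor_group k m i q" and i: "i \<in> responses" using coef_nonzero by blast
  have "\<theta> (i, q) \<in> {-1..1}" using \<theta> q i by (auto simp: PiE_iff)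
  then have "\<bar>\<theta> (i, q)\<bar> \<le> 1" by auto
  then show ?thesis using a_pos by (simp add: coef_group[OF i q] abs_mult mult_left_le)
qed (use a_pos in simp)

lemma sum_coef:
  "i \<in> responses \<Longrightarrow> (\<Sum>l<d. coef \<theta> i l * f l) = (\<Sum>q<r. a * \<theta> (i, q) * (\<Sum>l\<in>predictor_group k m i q. f l))"
proof -
  assume i: "i \<in> responses"
  have "(\<Sum>l<d. coef \<theta> i l * f l) = (\<Sum>q<r. \<Sum>l<d. a * \<theta> (i, q) * (of_bool (l \<in> predictor_group k m i q) * f l))"
    using i by (simp add: coef_def sum_distrib_right sum.swap[of _ "{..<d}"] mult.assoc)
  also have "\<dots> = (\<Sum>q<r. a * \<theta> (i, q) * (\<Sum>l\<in>predictor_group k m i q. f l))"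
  proof (rule sum.cong[OF refl])
    fix q assume q: "q \<in> {..<r}"
    have "(\<Sum>l<d. of_bool (l \<in> predictor_group k m i q) * f l) = (\<Sum>l\<in>predictor_group k m i q. f l)"
      using group_less[OF block_less[OF i]] q by (intro sum.mono_neutral_cong_right) auto
    then show "(\<Sum>l<d. a * \<theta> (i, q) * (of_bool (l \<in> predictor_group k m i q) * f l)) = a * \<theta> (i, q) * (\<Sum>l\<in>predictor_group k m i q. f l)"
      by (simp add: sum_distrib_left[symmetric])
  qed
  finally show ?thesis .
qed

lemma pred_coef:
  "i \<in> responses \<Longrightarrow> pred d (coef \<theta>) x i = (\<Sum>q<r. a * \<theta> (i, q) * (\<Sum>l\<in>predictor_group k m i q. x l))"
  unfolding pred_def by (rule sum_coef)

lemma sum_coef_square: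
  assumes i: "i \<in> responses"
  shows "(\<Sum>l<d. (coef \<theta> i l)\<^sup>2) = a\<^sup>2 * real m * (\<Sum>q<r. (\<theta> (i, q))\<^sup>2)"
proof -
  have "(\<Sum>l<d. (coef \<theta> i l)\<^sup>2) = (\<Sum>q<r. a * \<theta> (i, q) * (\<Sum>l\<in>predictor_group k m i q. coef \<theta> i l))"
    unfolding power2_eq_square by (rule sum_coef[OF i])
  also have "\<dots> = (\<Sum>q<r. a * \<theta> (i, q) * (\<Sum>l\<in>predictor_group k m i q. a * \<theta> (i, q)))"
    by (intro sum.cong arg_cong2[where f="(*)"] refl coef_group i) auto
  also have "\<dots> = a\<^sup>2 * real m * (\<Sum>q<r. (\<theta> (i, q))\<^sup>2)"
    by (simp add: card_group sum_distrib_left power2_eq_square mult_ac)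
  finally show ?thesis .
qed

lemma card_same_block: "card {i \<in> responses. i div (2 * k) = c} \<le> k"
proof -
  have "{i \<in> responses. i div (2 * k) = c} \<subseteq> {2 * k * c..<2 * k * c + k}"
  proof
    fix i assume "i \<in> {i \<in> responses. i div (2 * k) = c}"
    then have "i = 2 * k * c + i mod (2 * k)" "i mod (2 * k) < k"
      using mult_div_mod_eq[of "2 * k" i] by (auto simp: responses_def)
    then show "i \<in> {2 * k * c..<2 * k * c + k}" by simp
  qed
  from card_mono[OF _ this] show ?thesis by simp
qed

lemma sign_regression_coef:
  assumes \<theta>: "\<theta> \<in> PiE pairs (\<lambda>_. {-1..1})"
  shows "sign_regression d responses (coef \<theta>)"
proof
  show "responses \<subseteq> {..<d}" using responses_less by auto
  show "i \<in> responses \<and> l < d \<and> l \<notin> responses" if "coef \<theta> i l \<noteq> 0" for i l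
    using coef_support(1)[OF that] .
  show "(\<Sum>l<d. \<bar>coef \<theta> i l\<bar>) \<le> 1/2" if i: "i \<in> responses" for i
  proof -
    let ?G = "\<Union>q<r. predictor_group k m i q"
    have "(\<Sum>l<d. \<bar>coef \<theta> i l\<bar>) = (\<Sum>l\<in>?G. \<bar>coef \<theta> i l\<bar>)"
    proof (rule sum.mono_neutral_right)
      show "?G \<subseteq> {..<d}" using group_less[OF block_less[OF i]] by auto
      show "\<forall>l\<in>{..<d} - ?G. \<bar>coef \<theta> i l\<bar> = 0" using coef_nonzero(2)[of \<theta> i] by auto
    qed simp
    also have "\<dots> \<le> (\<Sum>l\<in>?G. a)" by (intro sum_mono coef_bound \<theta>)
    also have "\<dots> = card ?G * a" by simp
    also have "card ?G \<le> (\<Sum>q<r. card (predictor_group k m i q))" by (rule card_UN_le) simp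
    then have "card ?G * a \<le> real k * a"
      using a_pos rm_le by (intro mult_right_mono) (auto simp: card_group)
    finally show ?thesis using ak_le by (simp add: mult.commute)
  qed
  show "(\<Sum>i\<in>responses. \<bar>coef \<theta> i l\<bar>) \<le> 1/2" for l
  proof -
    have "(\<Sum>i\<in>responses. \<bar>coef \<theta> i l\<bar>) = (\<Sum>i\<in>{i \<in> responses. i div (2 * k) = l div (2 * k)}. \<bar>coef \<theta> i l\<bar>)"
    proof (rule sum.mono_neutral_right)
      show "\<forall>i\<in>responses - {i \<in> responses. i div (2 * k) = l div (2 * k)}. \<bar>coef \<theta> i l\<bar> = 0"
        using coef_support(2)[of \<theta> _ l] by force
    qed (use finite_responses in auto)
    also have "\<dots> \<le> (\<Sum>i\<in>{i \<in> responses. i div (2 * k) = l div (2 * k)}. a)"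
      by (intro sum_mono coef_bound \<theta>)
    also have "\<dots> \<le> real k * a"
      using card_same_block[of "l div (2 * k)"] a_pos by (auto intro!: mult_right_mono)
    finally show ?thesis using ak_le by (simp add: mult.commute)
  qed
qed

definition block_density :: "(nat \<times> nat \<Rightarrow> real) \<Rightarrow> rvec \<Rightarrow> real" where
  "block_density \<theta> x = lik d responses (coef \<theta>) x"

definition block_density_deriv :: "(nat \<times> nat \<Rightarrow> real) \<Rightarrow> rvec \<Rightarrow> nat \<times> nat \<Rightarrow> real" where
  "block_density_deriv \<theta> x j = x (fst j) * (a * (\<Sum>l\<in>predictor_group k m (fst j) (snd j). x l)) *
     (\<Prod>i\<in>responses - {fst j}. 1 + x i * pred d (coef \<theta>) x i) / 2 ^ d"

definition block_score :: "(nat \<times> nat \<Rightarrow> real) \<Rightarrow> rvec \<Rightarrow> nat \<times> nat \<Rightarrow> real" where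
  "block_score \<theta> x j = x (fst j) * (a * (\<Sum>l\<in>predictor_group k m (fst j) (snd j). x l)) /
     (1 + x (fst j) * pred d (coef \<theta>) x (fst j))"

lemma pred_coef_upd_other: "i \<noteq> i' \<Longrightarrow> pred d (coef (\<theta>((i, q) := t))) x i' = pred d (coef \<theta>) x i'"
  unfolding pred_def by (intro sum.cong refl) (simp add: coef_def)

lemma pred_coef_upd_same:
  assumes "i \<in> responses" "q < r"
  shows "pred d (coef (\<theta>((i, q) := t))) x i =
    pred d (coef \<theta>) x i + (t - \<theta> (i, q)) * (a * (\<Sum>l\<in>predictor_group k m i q. x l))"
  unfolding pred_coef[OF assms(1)] using assms(2)
  by (subst (1 2) sum.remove[of "{..<r}" q]) (auto simp: algebra_simps intro!: sum.cong)

text \<open>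
The likelihood is a product over responses whose factor for \<open>i\<close> is affine in the parameters of \<open>i\<close>
and free of all others. A linear combination of scores is again of the form treated in
\<open>expect_score_square\<close>, and disjointness of the groups makes its coefficients sum up to
\<open>a\<^sup>2 m\<close> times the squared norm of the combination.
\<close>

lemma smooth_model_block:
  "smooth_model (sign_cube d) pairs block_density block_density_deriv block_score (4/3 * a\<^sup>2 * real m)"
proof
  show "finite (sign_cube d)" by (rule finite_sign_cube)
  show "finite pairs" using finite_responses by simp
  show "0 \<le> 4/3 * a\<^sup>2 * real m" by simp
  have pred_meas: "(\<lambda>\<theta>. pred d (coef \<theta>) x i) \<in> borel_measurable (cube_prior pairs)" if i: "i \<in> responses" for x i
    unfolding pred_coef[OF i] using i
    by (intro borel_measurable_sum borel_measurable_times borel_measurable_const measurable_cube_prior_component) auto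
  show "(\<lambda>\<theta>. block_density \<theta> x) \<in> borel_measurable (cube_prior pairs)" for x
    unfolding block_density_def lik_def
    by (intro borel_measurable_divide borel_measurable_prod borel_measurable_add borel_measurable_times
        borel_measurable_const pred_meas) auto
  show "(\<lambda>\<theta>. block_density_deriv \<theta> x j) \<in> borel_measurable (cube_prior pairs)" if "j \<in> pairs" for x j
    unfolding block_density_deriv_def
    by (intro borel_measurable_divide borel_measurable_prod borel_measurable_add borel_measurable_times
        borel_measurable_const pred_meas) auto
  fix \<theta> :: "nat \<times> nat \<Rightarrow> real" and x :: rvec and j and t :: real
  assume j: "j \<in> pairs"
  obtain i q where iq: "j = (i, q)" "i \<in> responses" "q < r" using j by auto
  have split: "block_density \<theta> x = (1 + x i * pred d (coef \<theta>) x i) * (\<Prod>i\<in>responses - {i}. 1 + x i * pred d (coef \<theta>) x i) / 2 ^ d" for \<theta>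
    unfolding block_density_def lik_def using prod.remove[OF finite_responses iq(2)] by simp
  have rest: "(\<Prod>i\<in>responses - {i}. 1 + x i * pred d (coef (\<theta>(j := t))) x i) = (\<Prod>i\<in>responses - {i}. 1 + x i * pred d (coef \<theta>) x i)"
    unfolding iq(1) by (intro prod.cong refl) (auto simp: pred_coef_upd_other)
  show "block_density (\<theta>(j := t)) x = block_density \<theta> x + (t - \<theta> j) * block_density_deriv \<theta> x j"
    unfolding split rest unfolding iq(1) pred_coef_upd_same[OF iq(2,3)] block_density_deriv_def
    by (simp add: field_simps)
  show "block_density_deriv (\<theta>(j := t)) x j = block_density_deriv \<theta> x j"
    unfolding block_density_deriv_def using rest iq(1) by simp
next
  fix \<theta> :: "nat \<times> nat \<Rightarrow> real" assume \<theta>: "\<theta> \<in> PiE pairs (\<lambda>_. {-1..1})"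
  interpret sign_regression d responses "coef \<theta>" by (rule sign_regression_coef[OF \<theta>])
  show "(\<Sum>x\<in>sign_cube d. block_density \<theta> x) = 1" unfolding block_density_def by (rule lik_sum)
  show "0 \<le> block_density \<theta> x" if "x \<in> sign_cube d" for x
    unfolding block_density_def using lik_pos[OF that] by simp
  show "block_density_deriv \<theta> x j = block_density \<theta> x * block_score \<theta> x j" if x: "x \<in> sign_cube d" and j: "j \<in> pairs" for x j
  proof -
    have i: "fst j \<in> responses" using j by auto
    have "block_density \<theta> x = (1 + x (fst j) * pred d (coef \<theta>) x (fst j)) * (\<Prod>i\<in>responses - {fst j}. 1 + x i * pred d (coef \<theta>) x i) / 2 ^ d"
      unfolding block_density_def lik_def using prod.remove[OF finite_responses i] by simp
    then show ?thesis using response_factor_pos[OF x i]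
      unfolding block_density_deriv_def block_score_def by simp
  qed
  show "(\<Sum>x\<in>sign_cube d. block_density \<theta> x * block_score \<theta> x j) = 0" if j: "j \<in> pairs" for j
  proof -
    have "ignores responses (\<lambda>x. a * (\<Sum>l\<in>predictor_group k m (fst j) (snd j). x l))"
      using j group_not_response[of "snd j" _ "fst j"]
      unfolding ignores_def by (auto intro!: arg_cong2[where f="(*)"] sum.cong)
    then have "expect (\<lambda>x. x (fst j) * (a * (\<Sum>l\<in>predictor_group k m (fst j) (snd j). x l)) / (1 + x (fst j) * pred d (coef \<theta>) x (fst j))) = 0"
      using j by (intro expect_score) auto
    then show ?thesis by (simp add: expect_def block_density_def block_score_def)
  qed
  show "(\<Sum>x\<in>sign_cube d. block_density \<theta> x * (\<Sum>j\<in>pairs. c j * block_score \<theta> x j)\<^sup>2) \<le> 4/3 * a\<^sup>2 * real m * (\<Sum>j\<in>pairs. (c j)\<^sup>2)" for c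
  proof -
    have sc: "(\<Sum>j\<in>pairs. c j * block_score \<theta> x j) =
        (\<Sum>i\<in>responses. x i * (\<Sum>l<d. coef c i l * x l) / (1 + x i * pred d (coef \<theta>) x i))" for x
    proof -
      have "(\<Sum>j\<in>pairs. c j * block_score \<theta> x j) = (\<Sum>i\<in>responses. \<Sum>q<r. c (i, q) * block_score \<theta> x (i, q))"
        by (simp add: sum.cartesian_product)
      also have "\<dots> = (\<Sum>i\<in>responses. x i * (\<Sum>l<d. coef c i l * x l) / (1 + x i * pred d (coef \<theta>) x i))"
      proof (rule sum.cong[OF refl])
        fix i assume i: "i \<in> responses"
        define Y where "Y q = (\<Sum>l\<in>predictor_group k m i q. x l)" for q
        show "(\<Sum>q<r. c (i, q) * block_score \<theta> x (i, q)) =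
            x i * (\<Sum>l<d. coef c i l * x l) / (1 + x i * pred d (coef \<theta>) x i)"
          unfolding sum_coef[OF i] block_score_def fst_conv snd_conv Y_def[symmetric]
          by (simp add: sum_distrib_left sum_divide_distrib mult_ac)
      qed
      finally show ?thesis .
    qed
    have "(\<Sum>x\<in>sign_cube d. block_density \<theta> x * (\<Sum>j\<in>pairs. c j * block_score \<theta> x j)\<^sup>2) \<le>
        4/3 * (\<Sum>i\<in>responses. \<Sum>l<d. (coef c i l)\<^sup>2)"
      unfolding sc block_density_def expect_def[symmetric]
      using coef_support(1)[of c] by (intro expect_score_square) blast
    also have "(\<Sum>i\<in>responses. \<Sum>l<d. (coef c i l)\<^sup>2) = a\<^sup>2 * real m * (\<Sum>j\<in>pairs. (c j)\<^sup>2)"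
      by (simp add: sum_coef_square sum_distrib_left[symmetric] sum.cartesian_product)
    finally show ?thesis by simp
  qed
qed

lemma card_responses: "card responses = B * k"
proof -
  have "bij_betw (\<lambda>(c, e). 2 * k * c + e) ({..<B} \<times> {..<k}) responses"
  proof (rule bij_betw_byWitness[where f' = "\<lambda>i. (i div (2 * k), i mod (2 * k))"])
    show "\<forall>z\<in>{..<B} \<times> {..<k}. ((case z of (c, e) \<Rightarrow> 2 * k * c + e) div (2 * k), (case z of (c, e) \<Rightarrow> 2 * k * c + e) mod (2 * k)) = z"
      by auto
    show "\<forall>i\<in>responses. (case (i div (2 * k), i mod (2 * k)) of (c, e) \<Rightarrow> 2 * k * c + e) = i"
      by simp
    show "(\<lambda>(c, e). 2 * k * c + e) ` ({..<B} \<times> {..<k}) \<subseteq> responses"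
    proof clarsimp
      fix c e assume ce: "c < B" "e < k"
      have "2 * k * Suc c \<le> 2 * k * B" using ce by (intro mult_left_mono) auto
      then have "2 * k * c + e < 2 * k * B" using ce by simp
      then show "2 * k * c + e \<in> responses" using ce by (simp add: responses_def)
    qed
    show "(\<lambda>i. (i div (2 * k), i mod (2 * k))) ` responses \<subseteq> {..<B} \<times> {..<k}"
      using block_less by (auto simp: responses_def)
  qed
  from bij_betw_same_card[OF this] show ?thesis by simp
qed

lemma card_pairs: "card pairs = B * k * r"
  by (simp add: card_cartesian_product card_responses)

text \<open>
Of the three summands at most one is nonzero, as \<open>i\<close> and \<open>j\<close> are a response and a predictor, in either
order, or two responses. In the last case the sum gains a factor from the row bound, so
covariances between responses are no larger than \<open>a\<close> either.
\<close>

lemma covariance_entry: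
  assumes \<theta>: "\<theta> \<in> PiE pairs (\<lambda>_. {-1..1})" and ij: "i < d" "j < d" "i \<noteq> j"
  shows "\<bar>coef \<theta> i j + coef \<theta> j i + (\<Sum>l<d. coef \<theta> i l * coef \<theta> j l)\<bar> \<le> a"
    and "coef \<theta> i j + coef \<theta> j i + (\<Sum>l<d. coef \<theta> i l * coef \<theta> j l) \<noteq> 0 \<Longrightarrow> i div (2 * k) = j div (2 * k)"
proof -
  interpret sign_regression d responses "coef \<theta>" by (rule sign_regression_coef[OF \<theta>])
  show "i div (2 * k) = j div (2 * k)" if C: "coef \<theta> i j + coef \<theta> j i + (\<Sum>l<d. coef \<theta> i l * coef \<theta> j l) \<noteq> 0"
  proof (rule ccontr)
    assume ne: "\<not> ?thesis"
    have "coef \<theta> i l * coef \<theta> j l = 0" for l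
      using coef_support(2)[of \<theta> i l] coef_support(2)[of \<theta> j l] ne by (metis mult_eq_0_iff)
    moreover have "coef \<theta> i j = 0" "coef \<theta> j i = 0"
      using coef_support(2)[of \<theta> i j] coef_support(2)[of \<theta> j i] ne by auto
    ultimately show False using C by (simp only: sum.neutral_const add_0_left)
  qed
  consider "coef \<theta> i j \<noteq> 0" | "coef \<theta> j i \<noteq> 0" | "coef \<theta> i j = 0" "coef \<theta> j i = 0" by blast
  then show "\<bar>coef \<theta> i j + coef \<theta> j i + (\<Sum>l<d. coef \<theta> i l * coef \<theta> j l)\<bar> \<le> a"
  proof cases
    case 1
    then have "coef \<theta> j l = 0" for l using coef_support(1)[of \<theta> i j] coef_support(1)[of \<theta> j l] by blast
    then show ?thesis using coef_bound[OF \<theta>, of i j] by simp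
  next
    case 2
    then have "coef \<theta> i l = 0" for l using coef_support(1)[of \<theta> j i] coef_support(1)[of \<theta> i l] by blast
    then show ?thesis using coef_bound[OF \<theta>, of j i] by simp
  next
    case 3
    have "\<bar>\<Sum>l<d. coef \<theta> i l * coef \<theta> j l\<bar> \<le> (\<Sum>l<d. \<bar>coef \<theta> i l * coef \<theta> j l\<bar>)" by (rule sum_abs)
    also have "\<dots> \<le> (\<Sum>l<d. a * \<bar>coef \<theta> j l\<bar>)"
      unfolding abs_mult by (intro sum_mono mult_right_mono coef_bound \<theta>) auto
    also have "\<dots> = a * (\<Sum>l<d. \<bar>coef \<theta> j l\<bar>)" by (simp add: sum_distrib_left)
    also have "\<dots> \<le> a * 1"
    proof (intro mult_left_mono)
      show "(\<Sum>l<d. \<bar>coef \<theta> j l\<bar>) \<le> 1"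
      proof (cases "j \<in> responses")
        case True then show ?thesis using W_row[OF True] by simp
      next
        case False then show ?thesis by (simp add: coef_def)
      qed
    qed (use a_pos in simp)
    finally show ?thesis using 3 by simp
  qed
qed

lemma law_in_model:
  assumes \<theta>: "\<theta> \<in> PiE pairs (\<lambda>_. {-1..1})"
    and \<alpha>: "0 < \<alpha>" and K: "0 < K"
    and s: "s\<^sup>2 \<le> K\<^sup>2 / 8" "3 * s\<^sup>2 \<le> M0" "2 * s\<^sup>2 \<le> M"
    and a: "a \<le> (2 * real k) powr (- (\<alpha> + 1))"
    and \<J>: "\<J> \<in> {row_tail_class, decay_class}"
  shows "sign_law d responses (coef \<theta>) s \<in> subgauss_model K d (\<J> \<alpha> M0 M d)"
proof -
  interpret sign_regression d responses "coef \<theta>" by (rule sign_regression_coef[OF \<theta>])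
  let ?S = "cov_mat (sign_law d responses (coef \<theta>) s)"
  have off: "?S i j = s\<^sup>2 * (coef \<theta> i j + coef \<theta> j i + (\<Sum>l<d. coef \<theta> i l * coef \<theta> j l))"
    if "i < d" "j < d" "i \<noteq> j" for i j
    using that by (simp add: cov_law expect_coord_prod)
  have 1: "?S i i = s\<^sup>2" if "i < d" for i
    using that by (simp add: cov_law expect_coord_square)
  have 2: "\<bar>?S i j\<bar> \<le> s\<^sup>2 * (2 * real k) powr (- (\<alpha> + 1))" if ij: "i < d" "j < d" "i \<noteq> j" for i j
    unfolding off[OF ij] abs_mult
    using covariance_entry(1)[OF \<theta> ij] a by (simp add: mult_left_mono)
  have 3: "?S i j = 0" if ij: "i < d" "j < d" "2 * real k \<le> \<bar>real i - real j\<bar>" for i j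
  proof -
    have ne: "i \<noteq> j" using ij pos by auto
    have "i div (2 * k) \<noteq> j div (2 * k)"
    proof
      assume eq: "i div (2 * k) = j div (2 * k)"
      have lt: "i mod (2 * k) < 2 * k" "j mod (2 * k) < 2 * k" using pos by auto
      have "i = 2 * k * (j div (2 * k)) + i mod (2 * k)" "j = 2 * k * (j div (2 * k)) + j mod (2 * k)"
        using mult_div_mod_eq[of "2 * k" i] mult_div_mod_eq[of "2 * k" j] eq by simp_all
      then have "\<bar>int i - int j\<bar> < 2 * int k" using lt by linarith
      then have "\<bar>real i - real j\<bar> < 2 * real k" by linarith
      then show False using ij by simp
    qed
    then show ?thesis using covariance_entry(2)[OF \<theta> ij(1,2) ne] off[OF ij(1,2) ne] by force
  qed
  have "?S \<in> decay_class \<alpha> M0 M d" "?S \<in> row_tail_class \<alpha> M0 M d"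
    by (rule banded_in_classes[OF psd_cov_law _ \<alpha> _ 1 2 3 s(2,3)]; use pos in simp)+
  then show ?thesis
    using \<J> prob_space_law psi2_law[OF K s(1)] by (auto simp: subgauss_model_def)
qed

text \<open>
The covariances of response \<open>i\<close> with the \<open>m\<close> predictors of group \<open>q\<close> are all \<open>s\<^sup>2 a \<theta> (i, q)\<close>, so the
rescaled sum estimates \<open>\<theta> (i, q)\<close>. Clipping to \<open>[-1, 1]\<close> can only reduce the error and keeps every
expectation finite for an arbitrary estimator.
\<close>

definition estimate :: "real \<Rightarrow> rmat \<Rightarrow> nat \<times> nat \<Rightarrow> real" where
  "estimate s D j = max (-1) (min 1 ((\<Sum>l\<in>predictor_group k m (fst j) (snd j). D (fst j) l) / (s\<^sup>2 * a * real m)))"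

lemma estimate_bound: "\<bar>estimate s D j\<bar> \<le> 1"
  by (simp add: estimate_def abs_le_iff)

lemma estimate_measurable:
  assumes "j \<in> pairs"
  shows "(\<lambda>D. estimate s D j) \<in> borel_measurable (mat_space d)"
proof -
  have entry: "(\<lambda>D. D i l) \<in> borel_measurable (mat_space d)" if "i < d" "l < d" for i l
    unfolding mat_space_def using that
    by (intro measurable_compose[where f = "\<lambda>D. D i" and g = "\<lambda>x. x l" and N = "vec_space d"]
        measurable_component_singleton measurable_vec_coord) auto
  have "fst j < d" "\<And>l. l \<in> predictor_group k m (fst j) (snd j) \<Longrightarrow> l < d"
    using assms group_less[OF block_less] responses_less by auto
  then show ?thesis
    unfolding estimate_def
    by (intro borel_measurable_max borel_measurable_min borel_measurable_divide borel_measurable_sum borel_measurable_const entry)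
qed

text \<open>
For one group in one block the spectral norm bounds the \<open>k\<close> parameter errors that belong to it. The
\<open>B r\<close> pairs of a block and a group exhaust all parameters, and averaging over them gives the factor
\<open>1 / (B r)\<close>.
\<close>

lemma spectral_error_ge:
  assumes \<theta>: "\<theta> \<in> PiE pairs (\<lambda>_. {-1..1})" and s: "s \<noteq> 0"
  shows "s ^ 4 * a\<^sup>2 * real m / (real B * real r) * (\<Sum>j\<in>pairs. (estimate s D j - \<theta> j)\<^sup>2) \<le>
    (spectral_norm d (\<lambda>i l. D i l - cov_mat (sign_law d responses (coef \<theta>) s) i l))\<^sup>2"
proof -
  interpret sign_regression d responses "coef \<theta>" by (rule sign_regression_coef[OF \<theta>])
  let ?S = "cov_mat (sign_law d responses (coef \<theta>) s)"
  let ?\<Delta> = "\<lambda>i l. D i l - ?S i l"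
  let ?w = "s\<^sup>2 * a * real m"
  have w: "0 < ?w" using s a_pos pos by simp
  have entry: "(?w * (estimate s D (i, q) - \<theta> (i, q)))\<^sup>2 \<le> (\<Sum>l\<in>predictor_group k m i q. ?\<Delta> i l)\<^sup>2"
    if i: "i \<in> responses" and q: "q < r" for i q
  proof -
    have S: "?S i l = s\<^sup>2 * (a * \<theta> (i, q))" if l: "l \<in> predictor_group k m i q" for l
    proof -
      have "l \<notin> responses" using group_not_response q l by blast
      moreover have "l < d" using group_less[OF block_less[OF i] q l] .
      ultimately show ?thesis
        using i l q responses_less[OF i] coef_group[OF i q l, of \<theta>]
        by (subst cov_law, simp, simp, subst expect_coord_prod) (auto simp: coef_def[of \<theta> l])
    qed
    define z where "z = (\<Sum>l\<in>predictor_group k m i q. D i l) / ?w"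
    have "(\<Sum>l\<in>predictor_group k m i q. ?\<Delta> i l) = ?w * (z - \<theta> (i, q))"
      using s a_pos pos unfolding z_def by (simp add: S sum_subtractf card_group right_diff_distrib)
    moreover have "\<bar>estimate s D (i, q) - \<theta> (i, q)\<bar> \<le> \<bar>z - \<theta> (i, q)\<bar>"
    proof -
      have "\<theta> (i, q) \<in> {-1..1}" using \<theta> i q by (auto simp: PiE_iff)
      moreover have "estimate s D (i, q) = max (-1) (min 1 z)" by (simp add: estimate_def z_def)
      ultimately show ?thesis by (auto simp: max_def min_def)
    qed
    ultimately show ?thesis by (simp add: power_mult_distrib abs_le_square_iff mult_left_mono)
  qed
  have "(\<Sum>j\<in>pairs. (?w * (estimate s D j - \<theta> j))\<^sup>2) = (\<Sum>q<r. \<Sum>i\<in>responses. (?w * (estimate s D (i, q) - \<theta> (i, q)))\<^sup>2)"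
    unfolding sum.cartesian_product' by (rule sum.swap)
  also have "\<dots> \<le> (\<Sum>q<r. \<Sum>i\<in>responses. (\<Sum>l\<in>predictor_group k m i q. ?\<Delta> i l)\<^sup>2)"
    by (intro sum_mono entry) auto
  also have "\<dots> = (\<Sum>q<r. \<Sum>c<B. \<Sum>i\<in>{i \<in> responses. i div (2 * k) = c}. (\<Sum>l\<in>predictor_group k m i q. ?\<Delta> i l)\<^sup>2)"
    using block_less by (intro sum.cong refl sum.group[symmetric] finite_responses) auto
  also have "\<dots> \<le> (\<Sum>q<r. \<Sum>c<B. real m * (spectral_norm d ?\<Delta>)\<^sup>2)"
  proof (intro sum_mono)
    fix q c assume q: "q \<in> {..<r}" and c: "c \<in> {..<B}"
    let ?U = "predictor_group k m (2 * k * c) q"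
    have U: "predictor_group k m i q = ?U" if "i div (2 * k) = c" for i
      using that pos by (simp add: predictor_group_def)
    have "(\<Sum>i\<in>{i \<in> responses. i div (2 * k) = c}. (\<Sum>l\<in>predictor_group k m i q. ?\<Delta> i l)\<^sup>2) =
        (\<Sum>i\<in>{i \<in> responses. i div (2 * k) = c}. (\<Sum>l\<in>?U. ?\<Delta> i l)\<^sup>2)"
      by (intro sum.cong refl) (simp add: U)
    also have "\<dots> \<le> (\<Sum>i<d. (\<Sum>l\<in>?U. ?\<Delta> i l)\<^sup>2)"
      using responses_less by (intro sum_mono2) auto
    also have "\<dots> \<le> card ?U * (spectral_norm d ?\<Delta>)\<^sup>2"
    proof (rule spectral_norm_group_sum)
      show "?U \<subseteq> {..<d}" using group_less[of "2 * k * c" q] c q pos by auto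
      show "?U \<noteq> {}" using card_group[of "2 * k * c" q] pos by force
    qed
    finally show "(\<Sum>i\<in>{i \<in> responses. i div (2 * k) = c}. (\<Sum>l\<in>predictor_group k m i q. ?\<Delta> i l)\<^sup>2)
        \<le> real m * (spectral_norm d ?\<Delta>)\<^sup>2" by (simp add: card_group)
  qed
  finally have main: "?w\<^sup>2 * (\<Sum>j\<in>pairs. (estimate s D j - \<theta> j)\<^sup>2) \<le> real r * real B * real m * (spectral_norm d ?\<Delta>)\<^sup>2"
    by (simp add: power_mult_distrib sum_distrib_left mult.assoc)
  have "s ^ 4 * a\<^sup>2 * real m / (real B * real r) * (\<Sum>j\<in>pairs. (estimate s D j - \<theta> j)\<^sup>2) =
      ?w\<^sup>2 * (\<Sum>j\<in>pairs. (estimate s D j - \<theta> j)\<^sup>2) / (real r * real B * real m)"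
    using pos by (simp add: field_simps power2_eq_square power4_eq_xxxx)
  also have "\<dots> \<le> (spectral_norm d ?\<Delta>)\<^sup>2"
    using main pos by (simp add: divide_le_eq mult.commute)
  finally show ?thesis .
qed

text \<open>
There are \<open>N = B k r\<close> parameters, so squared error \<open>N / 12\<close> becomes spectral risk
\<open>s\<^sup>4 a\<^sup>2 m / (B r) * N / 12\<close>.
\<close>

theorem risk_lower_bound:
  assumes \<alpha>: "0 < \<alpha>" and K: "0 < K"
    and s: "s \<noteq> 0" "s\<^sup>2 \<le> K\<^sup>2 / 8" "3 * s\<^sup>2 \<le> M0" "2 * s\<^sup>2 \<le> M"
    and a: "a \<le> (2 * real k) powr (- (\<alpha> + 1))"
    and \<J>: "\<J> \<in> {row_tail_class, decay_class}"
    and A: "A \<in> zcdp_estimators \<rho> n d" and n: "0 < n"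
    and \<kappa>: "0 < \<kappa>" "exp (2 * \<rho>) - 1 \<le> \<kappa>"
    and small: "48 * real n * a\<^sup>2 * real m \<le> 1 \<or> 48 * (real n)\<^sup>2 * \<kappa> * a\<^sup>2 * real m \<le> real B * real k * real r"
  shows "ennreal (s ^ 4 * a\<^sup>2 * real m * real k / 12) \<le> (SUP P\<in>subgauss_model K d (\<J> \<alpha> M0 M d). risk n d A P)"
proof -
  interpret smooth_model "sign_cube d" pairs block_density block_density_deriv block_score "4/3 * a\<^sup>2 * real m"
    by (rule smooth_model_block)
  let ?A = "\<lambda>S. A (scale_data n d s S)"
  have A_space: "A S \<in> space (prob_algebra (mat_space d))" if "S \<in> space (dataset_space n d)" for S
    using A that by (auto simp: zcdp_estimators_def dest: measurable_space)
  then have A_prob: "prob_space (?A S)" and A_sets: "sets (?A S) = sets (mat_space d)" for S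
    using scale_data_space by (auto simp: space_prob_algebra)
  have priv: "renyi_div 2 (?A S) (?A (S(i := x))) \<le> ereal (2 * \<rho>)"
    if "S \<in> datasets n" "i < n" "x \<in> sign_cube d" "x \<noteq> S i" for S i x
  proof -
    have "adjacent n d (scale_data n d s S) (scale_data n d s (S(i := x)))"
      using that s by (intro scale_data_adjacent)
    then have "\<forall>l>1. renyi_div l (?A S) (?A (S(i := x))) \<le> ereal (\<rho> * l)"
      using A by (simp add: zcdp_estimators_def)
    from this[rule_format, of 2] show ?thesis by (simp add: mult.commute)
  qed
  have "responses \<noteq> {}" using card_responses pos by force
  then have J: "pairs \<noteq> {}" using pos by auto
  have small': "36 * real n * (4/3 * a\<^sup>2 * real m) \<le> 1 \<or> 36 * (real n)\<^sup>2 * \<kappa> * (4/3 * a\<^sup>2 * real m) \<le> card pairs"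
    using small by (simp add: card_pairs mult_ac)
  have "\<exists>\<theta>\<in>params. card pairs / 12 \<le>
      (\<Sum>S\<in>datasets n. joint n \<theta> S * (\<integral>D. (\<Sum>j\<in>pairs. (estimate s D j - \<theta> j)\<^sup>2) \<partial>?A S))"
    by (rule squared_error_lower_bound[where N = "mat_space d" and \<kappa> = \<kappa> and \<rho> = \<rho>, OF n J])
      ((rule A_prob A_sets estimate_bound \<kappa> small') | (rule estimate_measurable, assumption) | (rule priv, assumption+))+
  then obtain \<theta> where \<theta>: "\<theta> \<in> params"
    and loss: "card pairs / 12 \<le> (\<Sum>S\<in>datasets n. joint n \<theta> S * (\<integral>D. (\<Sum>j\<in>pairs. (estimate s D j - \<theta> j)\<^sup>2) \<partial>?A S))"
    by blast
  interpret sign_regression d responses "coef \<theta>" by (rule sign_regression_coef[OF \<theta>])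
  let ?P = "sign_law d responses (coef \<theta>) s"
  let ?c = "s ^ 4 * a\<^sup>2 * real m / (real B * real r)"
  let ?L = "\<lambda>D. \<Sum>j\<in>pairs. (estimate s D j - \<theta> j)\<^sup>2"
  have c: "0 \<le> ?c" by simp
  have joint: "joint n \<theta> S = (\<Prod>i<n. lik d responses (coef \<theta>) (S i))" for S
    by (simp add: joint_def block_density_def)
  have inner: "ennreal (?c * (\<integral>D. ?L D \<partial>?A S)) \<le>
      (\<integral>\<^sup>+D. ennreal ((spectral_norm d (\<lambda>i l. D i l - cov_mat ?P i l))\<^sup>2) \<partial>?A S)" for S
  proof -
    interpret prob_space "?A S" by (rule A_prob)
    have meas: "?L \<in> borel_measurable (?A S)"
      using estimate_measurable
      by (subst measurable_cong_sets[OF A_sets refl])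
        (intro borel_measurable_sum borel_measurable_power borel_measurable_diff borel_measurable_const, auto)
    have "\<bar>?L D\<bar> \<le> (\<Sum>j\<in>pairs. 4)" for D
    proof -
      have "(estimate s D j - \<theta> j)\<^sup>2 \<le> 4" if "j \<in> pairs" for j
      proof -
        have "\<theta> j \<in> {-1..1}" using \<theta> that by (auto simp: PiE_iff)
        then have "\<bar>estimate s D j - \<theta> j\<bar> \<le> 2" using estimate_bound[of s D j] by (auto simp: abs_le_iff)
        from power_mono[OF this, of 2] show ?thesis by simp
      qed
      then have "?L D \<le> (\<Sum>j\<in>pairs. 4)" by (rule sum_mono)
      moreover have "0 \<le> ?L D" by (intro sum_nonneg) simp
      ultimately show ?thesis by simp
    qed
    then have int: "integrable (?A S) ?L"
      by (intro integrable_const_bound[where B="\<Sum>j\<in>pairs. 4"] meas AE_I2) simp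
    have "ennreal (?c * (\<integral>D. ?L D \<partial>?A S)) = ennreal (\<integral>D. ?c * ?L D \<partial>?A S)" by simp
    also have "\<dots> = (\<integral>\<^sup>+D. ennreal (?c * ?L D) \<partial>?A S)"
      using int c by (intro nn_integral_eq_integral[symmetric] integrable_mult_right AE_I2 mult_nonneg_nonneg sum_nonneg) auto
    also have "\<dots> \<le> (\<integral>\<^sup>+D. ennreal ((spectral_norm d (\<lambda>i l. D i l - cov_mat ?P i l))\<^sup>2) \<partial>?A S)"
      by (intro nn_integral_mono ennreal_leI spectral_error_ge \<theta> s)
    finally show ?thesis .
  qed
  have L_nonneg: "0 \<le> (\<integral>D. ?L D \<partial>?A S)" for S
    by (intro Bochner_Integration.integral_nonneg sum_nonneg) simp
  have "s ^ 4 * a\<^sup>2 * real m * real k / 12 = ?c * (card pairs / 12)"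
    using pos by (simp add: card_pairs)
  also have "\<dots> \<le> ?c * (\<Sum>S\<in>datasets n. joint n \<theta> S * (\<integral>D. ?L D \<partial>?A S))"
    by (intro mult_left_mono loss c)
  also have "\<dots> = (\<Sum>S\<in>datasets n. joint n \<theta> S * (?c * (\<integral>D. ?L D \<partial>?A S)))"
    unfolding sum_distrib_left by (intro sum.cong refl mult.left_commute)
  finally have "ennreal (s ^ 4 * a\<^sup>2 * real m * real k / 12) \<le>
      ennreal (\<Sum>S\<in>datasets n. joint n \<theta> S * (?c * (\<integral>D. ?L D \<partial>?A S)))"
    by (rule ennreal_leI)
  also have "\<dots> = (\<Sum>S\<in>datasets n. ennreal (joint n \<theta> S) * ennreal (?c * (\<integral>D. ?L D \<partial>?A S)))"
  proof -
    have nn: "0 \<le> joint n \<theta> S" "0 \<le> ?c * (\<integral>D. ?L D \<partial>?A S)" if "S \<in> datasets n" for S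
      using joint_nonneg[OF \<theta> that] mult_nonneg_nonneg[OF c L_nonneg] by auto
    have "ennreal (\<Sum>S\<in>datasets n. joint n \<theta> S * (?c * (\<integral>D. ?L D \<partial>?A S))) =
        (\<Sum>S\<in>datasets n. ennreal (joint n \<theta> S * (?c * (\<integral>D. ?L D \<partial>?A S))))"
      by (rule sum_ennreal[symmetric]) (rule mult_nonneg_nonneg[OF nn])
    also have "\<dots> = (\<Sum>S\<in>datasets n. ennreal (joint n \<theta> S) * ennreal (?c * (\<integral>D. ?L D \<partial>?A S)))"
      by (intro sum.cong refl) (rule ennreal_mult[OF nn])
    finally show ?thesis .
  qed
  also have "\<dots> \<le> (\<Sum>S\<in>datasets n. ennreal (joint n \<theta> S) *
      (\<integral>\<^sup>+D. ennreal ((spectral_norm d (\<lambda>i l. D i l - cov_mat ?P i l))\<^sup>2) \<partial>?A S))"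
    by (intro sum_mono mult_left_mono inner) auto
  also have "\<dots> = risk n d A ?P"
    unfolding risk_def nn_integral_samples[OF s(1)] joint ..
  also have "\<dots> \<le> (SUP P\<in>subgauss_model K d (\<J> \<alpha> M0 M d). risk n d A P)"
    by (intro SUP_upper law_in_model \<theta> \<alpha> K s a \<J>)
  finally show ?thesis .
qed

end

section \<open>Choice of the block size and of the signal strength\<close>

lemma exp_minus_one_le:
  fixes x b :: real
  assumes "0 \<le> x" "x \<le> b"
  shows "exp x - 1 \<le> x * exp b"
proof -
  have "1 - x \<le> exp (- x)" using exp_ge_add_one_self[of "- x"] by simp
  then have "exp x * (1 - x) \<le> exp x * exp (- x)" by (intro mult_left_mono) auto
  then have "exp x - 1 \<le> x * exp x" by (simp add: exp_minus algebra_simps)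
  also have "\<dots> \<le> x * exp b" using assms by (intro mult_left_mono) auto
  finally show ?thesis .
qed

text \<open>
The signal strength \<open>a\<close> is as large as the decay condition and the information bound \<open>a\<^sup>2 \<le> y\<close> allow.
If \<open>r\<close> does not divide \<open>k\<close>, rounding in \<open>m = k div r\<close> costs a factor of two.
\<close>

lemma block_design_risk:
  fixes y :: real
  assumes kr: "1 \<le> r" "r \<le> k" "2 * k \<le> d" and y: "0 < y"
    and \<alpha>: "0 < \<alpha>" and K: "0 < K"
    and s: "s \<noteq> 0" "s\<^sup>2 \<le> K\<^sup>2 / 8" "3 * s\<^sup>2 \<le> M0" "2 * s\<^sup>2 \<le> M"
    and \<J>: "\<J> \<in> {row_tail_class, decay_class}"
    and A: "A \<in> zcdp_estimators \<rho> n d" and n: "0 < n"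
    and \<kappa>: "0 < \<kappa>" "exp (2 * \<rho>) - 1 \<le> \<kappa>"
    and small: "48 * real n * y * real (k div r) \<le> 1 \<or>
      48 * (real n)\<^sup>2 * \<kappa> * y * real (k div r) \<le> real (d div (2 * k)) * real k * real r"
  shows "ennreal (s ^ 4 / 24 * (min (2 powr (-2 * \<alpha> - 2) * real k powr (-2 * \<alpha> - 2)) y * (real k)\<^sup>2 / real r))
    \<le> (SUP P\<in>subgauss_model K d (\<J> \<alpha> M0 M d). risk n d A P)"
proof -
  define w where "w = (2 * real k) powr (- (\<alpha> + 1))"
  define a where "a = min w (sqrt y)"
  define m where "m = k div r"
  have k: "1 \<le> k" using kr by simp
  have w: "0 < w" using k by (simp add: w_def)
  have a: "0 < a" using w y by (simp add: a_def)
  have a2: "a\<^sup>2 = min (2 powr (-2 * \<alpha> - 2) * real k powr (-2 * \<alpha> - 2)) y"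
  proof -
    have "a\<^sup>2 = min (w\<^sup>2) y"
    proof (cases "w \<le> sqrt y")
      case True
      then show ?thesis using w y power_mono[OF True, of 2] by (simp add: a_def)
    next
      case False
      then show ?thesis using y power_mono[of "sqrt y" w 2] by (simp add: a_def)
    qed
    also have "w\<^sup>2 = (2 * real k) powr (-2 * \<alpha> - 2)"
      unfolding w_def power2_eq_square powr_add[symmetric] by (rule arg_cong) simp
    also have "\<dots> = 2 powr (-2 * \<alpha> - 2) * real k powr (-2 * \<alpha> - 2)" by (simp add: powr_mult)
    finally show ?thesis .
  qed
  have ay: "a\<^sup>2 \<le> y" unfolding a2 by simp
  have m: "0 < m" "r * m \<le> k" "real k \<le> 2 * (real r * real m)"
  proof -
    show m0: "0 < m" using kr by (simp add: m_def div_greater_zero_iff)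
    show "r * m \<le> k" by (simp add: m_def)
    have "k = r * m + k mod r" by (simp add: m_def)
    moreover have "k mod r < r" "r \<le> r * m" using kr m0 by simp_all
    ultimately have "k \<le> 2 * (r * m)" by linarith
    then show "real k \<le> 2 * (real r * real m)" by (metis of_nat_le_iff of_nat_mult of_nat_numeral)
  qed
  interpret block_design d k r m "d div (2 * k)" a
  proof
    show "0 < k" "0 < r" "0 < m" "0 < d div (2 * k)" "r * m \<le> k" "2 * k * (d div (2 * k)) \<le> d" "0 < a"
      using kr m a by (auto simp: div_greater_zero_iff)
    have "a * real k \<le> w * real k" by (intro mult_right_mono) (auto simp: a_def)
    also have "\<dots> = (2 * real k) powr (- \<alpha>) / 2"
    proof -
      have "(2 * real k) powr (- \<alpha>) = (2 * real k) powr (- (\<alpha> + 1)) * (2 * real k) powr 1"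
        unfolding powr_add[symmetric] by simp
      then show ?thesis using k by (simp add: w_def)
    qed
    also have "\<dots> \<le> 1 / 2" using k \<alpha> powr_mono[of "-\<alpha>" 0 "2 * real k"] by simp
    finally show "a * real k \<le> 1 / 2" .
  qed
  have small': "48 * real n * a\<^sup>2 * real m \<le> 1 \<or> 48 * (real n)\<^sup>2 * \<kappa> * a\<^sup>2 * real m \<le> real (d div (2 * k)) * real k * real r"
    using small
  proof
    assume *: "48 * real n * y * real (k div r) \<le> 1"
    have "48 * real n * a\<^sup>2 * real m \<le> 48 * real n * y * real m"
      using ay by (intro mult_right_mono mult_left_mono) auto
    then show ?thesis using * by (simp add: m_def)
  next
    assume *: "48 * (real n)\<^sup>2 * \<kappa> * y * real (k div r) \<le> real (d div (2 * k)) * real k * real r"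
    have "48 * (real n)\<^sup>2 * \<kappa> * a\<^sup>2 * real m \<le> 48 * (real n)\<^sup>2 * \<kappa> * y * real m"
      using ay \<kappa> by (intro mult_right_mono mult_left_mono) auto
    then show ?thesis using * by (simp add: m_def)
  qed
  have "s ^ 4 / 24 * (a\<^sup>2 * (real k)\<^sup>2 / real r) = s ^ 4 * a\<^sup>2 * real k / (24 * real r) * real k"
    by (simp add: power2_eq_square)
  also have "\<dots> \<le> s ^ 4 * a\<^sup>2 * real k / (24 * real r) * (2 * (real r * real m))"
    using m(3) by (intro mult_left_mono divide_nonneg_nonneg mult_nonneg_nonneg) auto
  also have "\<dots> = s ^ 4 * a\<^sup>2 * real m * real k / 12" using kr by (simp add: field_simps)
  finally have "ennreal (s ^ 4 / 24 * (a\<^sup>2 * (real k)\<^sup>2 / real r)) \<le> ennreal (s ^ 4 * a\<^sup>2 * real m * real k / 12)"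
    by (rule ennreal_leI)
  also have "\<dots> \<le> (SUP P\<in>subgauss_model K d (\<J> \<alpha> M0 M d). risk n d A P)"
    by (rule risk_lower_bound[OF \<alpha> K s _ \<J> A n \<kappa> small']) (simp add: a_def w_def)
  finally show ?thesis unfolding a2 .
qed

text \<open>
Here \<open>r = 1\<close> and \<open>y = 1 / (48 n k)\<close>, so the risk is of order \<open>k / n\<close> as long as
\<open>k powr (2\<alpha> + 1) \<le> n\<close>. The largest such block size that also fits the dimension gives the rate.
\<close>

lemma sampling_lower_bound:
  assumes \<alpha>: "0 < \<alpha>" and K: "0 < K"
    and s: "s \<noteq> 0" "s\<^sup>2 \<le> K\<^sup>2 / 8" "3 * s\<^sup>2 \<le> M0" "2 * s\<^sup>2 \<le> M"
    and \<J>: "\<J> \<in> {row_tail_class, decay_class}"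
    and A: "A \<in> zcdp_estimators \<rho> n d" and n: "0 < n" and d: "4 \<le> d"
  shows "ennreal (s ^ 4 / 24 * min (2 powr (-2 * \<alpha> - 2)) (1/48) / 8 *
      min (real n powr (-(2 * \<alpha>) / (2 * \<alpha> + 1))) (real d / real n))
    \<le> (SUP P\<in>subgauss_model K d (\<J> \<alpha> M0 M d). risk n d A P)"
proof -
  define x where "x = real n powr (1 / (2 * \<alpha> + 1))"
  define k where "k = min (nat \<lfloor>x\<rfloor>) (d div 4)"
  let ?c = "min (2 powr (-2 * \<alpha> - 2)) (1/48::real)"
  have x: "1 \<le> x" using n \<alpha> by (simp add: x_def ge_one_powr_ge_zero)
  have k: "1 \<le> k" using x d by (auto simp: k_def le_nat_iff le_floor_iff)
  have kx: "real k \<le> x" unfolding k_def using x by linarith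
  have k_ge: "min x (real d) / 8 \<le> real k"
  proof -
    have "1 \<le> \<lfloor>x\<rfloor>" using x by simp
    then have "1 \<le> real_of_int \<lfloor>x\<rfloor>" "real (nat \<lfloor>x\<rfloor>) = real_of_int \<lfloor>x\<rfloor>" by simp_all
    then have "x / 2 \<le> real (nat \<lfloor>x\<rfloor>)" using floor_correct[of x] by linarith
    moreover have "d \<le> 8 * (d div 4)"
    proof -
      have "1 \<le> d div 4" using d by (simp add: Suc_le_eq div_greater_zero_iff)
      moreover have "d = 4 * (d div 4) + d mod 4" "d mod 4 < 4" by simp_all
      ultimately show ?thesis by linarith
    qed
    then have "real d \<le> real (8 * (d div 4))" by (simp only: of_nat_le_iff)
    then have "real d / 8 \<le> real (d div 4)" by simp
    ultimately show ?thesis unfolding k_def using x by (auto simp: min_def)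
  qed
  have kn: "real k powr (2 * \<alpha> + 1) \<le> real n"
  proof -
    have "real k powr (2 * \<alpha> + 1) \<le> x powr (2 * \<alpha> + 1)" using kx \<alpha> by (intro powr_mono2) auto
    also have "\<dots> = real n" using n \<alpha> by (simp add: x_def powr_powr)
    finally show ?thesis .
  qed
  define y where "y = 1 / (48 * real n * real k)"
  have y: "0 < y" using n k by (simp add: y_def)
  have "?c * (1 / (real n * real k)) \<le> min (2 powr (-2 * \<alpha> - 2) * real k powr (-2 * \<alpha> - 2)) y"
  proof (rule min.boundedI)
    have "real k powr (2 * \<alpha> + 2) = real k powr (2 * \<alpha> + 1) * real k powr 1"
      unfolding powr_add[symmetric] by (simp add: algebra_simps)
    also have "\<dots> \<le> real n * real k" using kn by (simp add: mult_right_mono)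
    finally have "1 / (real n * real k) \<le> 1 / real k powr (2 * \<alpha> + 2)"
      using k n by (intro divide_left_mono) auto
    also have "\<dots> = real k powr (-2 * \<alpha> - 2)"
      by (simp add: powr_minus_divide[symmetric])
    finally show "?c * (1 / (real n * real k)) \<le> 2 powr (-2 * \<alpha> - 2) * real k powr (-2 * \<alpha> - 2)"
      by (intro mult_mono) auto
    have "?c * (1 / (real n * real k)) \<le> 1/48 * (1 / (real n * real k))"
      by (intro mult_right_mono) auto
    then show "?c * (1 / (real n * real k)) \<le> y" by (simp add: y_def)
  qed
  then have upper: "?c * (1 / (real n * real k)) * (real k)\<^sup>2 \<le> min (2 powr (-2 * \<alpha> - 2) * real k powr (-2 * \<alpha> - 2)) y * (real k)\<^sup>2"
    by (rule mult_right_mono) simp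
  have eq: "?c * (1 / (real n * real k)) * (real k)\<^sup>2 = ?c * (real k / real n)"
    using k by (simp add: power2_eq_square)
  have lower: "?c * (min (real n powr (-(2 * \<alpha>) / (2 * \<alpha> + 1))) (real d / real n) / 8) \<le> ?c * (real k / real n)"
  proof (rule mult_left_mono)
    have e: "1 / (2 * \<alpha> + 1) - 1 = -(2 * \<alpha>) / (2 * \<alpha> + 1)" using \<alpha> by (simp add: field_simps)
    have "real n powr (-(2 * \<alpha>) / (2 * \<alpha> + 1)) = x / real n"
      unfolding e[symmetric] x_def using n by (simp add: powr_diff)
    then have "min (real n powr (-(2 * \<alpha>) / (2 * \<alpha> + 1))) (real d / real n) = min x (real d) / real n"
      using n by (simp add: min_divide_distrib_right)
    then show "min (real n powr (-(2 * \<alpha>) / (2 * \<alpha> + 1))) (real d / real n) / 8 \<le> real k / real n"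
      using divide_right_mono[OF k_ge, of "real n"] by (simp add: mult.commute)
  qed simp
  have "?c * (min (real n powr (-(2 * \<alpha>) / (2 * \<alpha> + 1))) (real d / real n) / 8) \<le>
      min (2 powr (-2 * \<alpha> - 2) * real k powr (-2 * \<alpha> - 2)) y * (real k)\<^sup>2 / real 1"
    using order_trans[OF lower upper[unfolded eq]] unfolding of_nat_1 div_by_1 .
  then have "s ^ 4 / 24 * (?c * (min (real n powr (-(2 * \<alpha>) / (2 * \<alpha> + 1))) (real d / real n) / 8)) \<le>
      s ^ 4 / 24 * (min (2 powr (-2 * \<alpha> - 2) * real k powr (-2 * \<alpha> - 2)) y * (real k)\<^sup>2 / real 1)"
    by (rule mult_left_mono) simp
  then have "ennreal (s ^ 4 / 24 * ?c / 8 * min (real n powr (-(2 * \<alpha>) / (2 * \<alpha> + 1))) (real d / real n)) \<le>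
      ennreal (s ^ 4 / 24 * (min (2 powr (-2 * \<alpha> - 2) * real k powr (-2 * \<alpha> - 2)) y * (real k)\<^sup>2 / real 1))"
    by (intro ennreal_leI) (simp only: mult.assoc times_divide_eq_left times_divide_eq_right)
  also have "\<dots> \<le> (SUP P\<in>subgauss_model K d (\<J> \<alpha> M0 M d). risk n d A P)"
  proof (rule block_design_risk[OF _ _ _ y \<alpha> K s \<J> A n])
    show "2 * k \<le> d" by (simp add: k_def)
    \<comment> \<open>any positive upper bound for the chi-square divergence will do, as the first alternative holds\<close>
    show "0 < max 1 (exp (2 * \<rho>) - 1)" "exp (2 * \<rho>) - 1 \<le> max 1 (exp (2 * \<rho>) - 1)" by auto
    show "48 * real n * y * real (k div 1) \<le> 1 \<or>
      48 * (real n)\<^sup>2 * max 1 (exp (2 * \<rho>) - 1) * y * real (k div 1) \<le> real (d div (2 * k)) * real k * real 1"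
      using n k by (simp add: y_def)
  qed (use k in auto)
  finally show ?thesis .
qed

text \<open>
The number of parameters \<open>B k r\<close> is at least \<open>d r / 4\<close>, so information of order
\<open>d r / (\<rho> n\<^sup>2)\<close> per parameter is not enough for a private estimator. Solving \<open>a\<^sup>2 m\<close> equal to this
for \<open>a\<^sup>2\<close>, with \<open>m\<close> of order \<open>k / r\<close>, gives the value of \<open>y\<close>.
\<close>

lemma privacy_lower_bound:
  assumes \<alpha>: "0 < \<alpha>" and K: "0 < K"
    and s: "s \<noteq> 0" "s\<^sup>2 \<le> K\<^sup>2 / 8" "3 * s\<^sup>2 \<le> M0" "2 * s\<^sup>2 \<le> M"
    and \<J>: "\<J> \<in> {row_tail_class, decay_class}"
    and A: "A \<in> zcdp_estimators \<rho> n d" and n: "0 < n"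
    and \<rho>: "0 < \<rho>" "\<rho> \<le> b"
    and kr: "1 \<le> k" "k \<le> d div 4" "1 \<le> r" "r \<le> k"
  shows "ennreal (s ^ 4 / 24 * min (2 powr (-2 * \<alpha> - 2)) (1 / (384 * exp (2 * b))) *
      min (real k powr (-2 * \<alpha>) / real r) (real d / (\<rho> * (real n)\<^sup>2) * real k * real r))
    \<le> (SUP P\<in>subgauss_model K d (\<J> \<alpha> M0 M d). risk n d A P)"
proof -
  define C where "C = 384 * exp (2 * b)"
  define u where "u = real d / (\<rho> * (real n)\<^sup>2)"
  define y where "y = u * (real r)\<^sup>2 / (C * real k)"
  define \<kappa> where "\<kappa> = 2 * \<rho> * exp (2 * b)"
  let ?c = "min (2 powr (-2 * \<alpha> - 2)) (1 / C)"
  let ?z = "2 powr (-2 * \<alpha> - 2) * real k powr (-2 * \<alpha> - 2)"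
  have d: "4 * k \<le> d" using kr by simp
  have C: "0 < C" by (simp add: C_def)
  have u: "0 < u" using d kr n \<rho> by (simp add: u_def)
  have y: "0 < y" using u C kr by (simp add: y_def)
  have z: "?z * (real k)\<^sup>2 / real r = 2 powr (-2 * \<alpha> - 2) * (real k powr (-2 * \<alpha>) / real r)"
  proof -
    have "real k powr (-2 * \<alpha>) = real k powr (-2 * \<alpha> - 2) * real k powr 2"
      unfolding powr_add[symmetric] by simp
    then show ?thesis using kr by simp
  qed
  have yk: "y * (real k)\<^sup>2 / real r = 1 / C * (u * real k * real r)"
    using C kr by (simp add: y_def field_simps power2_eq_square)
  have "?c * min (real k powr (-2 * \<alpha>) / real r) (u * real k * real r) \<le> min ?z y * (real k)\<^sup>2 / real r"
  proof -
    have "min ?z y * (real k)\<^sup>2 / real r = min (?z * (real k)\<^sup>2 / real r) (y * (real k)\<^sup>2 / real r)"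
      by (simp add: min_mult_distrib_right min_divide_distrib_right)
    also have "\<dots> = min (2 powr (-2 * \<alpha> - 2) * (real k powr (-2 * \<alpha>) / real r)) (1 / C * (u * real k * real r))"
      unfolding z yk ..
    also have "\<dots> \<ge> ?c * min (real k powr (-2 * \<alpha>) / real r) (u * real k * real r)"
      using C u by (intro min.boundedI mult_mono) auto
    finally show ?thesis .
  qed
  then have "s ^ 4 / 24 * (?c * min (real k powr (-2 * \<alpha>) / real r) (u * real k * real r)) \<le>
      s ^ 4 / 24 * (min ?z y * (real k)\<^sup>2 / real r)"
    by (rule mult_left_mono) simp
  then have "ennreal (s ^ 4 / 24 * ?c * min (real k powr (-2 * \<alpha>) / real r) (u * real k * real r)) \<le>
      ennreal (s ^ 4 / 24 * (min ?z y * (real k)\<^sup>2 / real r))"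
    by (intro ennreal_leI) (simp only: mult.assoc)
  also have "\<dots> \<le> (SUP P\<in>subgauss_model K d (\<J> \<alpha> M0 M d). risk n d A P)"
  proof (rule block_design_risk[OF kr(3,4) _ y \<alpha> K s \<J> A n])
    show "2 * k \<le> d" using d by simp
    show "0 < \<kappa>" using \<rho> by (simp add: \<kappa>_def)
    show "exp (2 * \<rho>) - 1 \<le> \<kappa>" unfolding \<kappa>_def using \<rho> by (intro exp_minus_one_le) auto
    have "48 * (real n)\<^sup>2 * \<kappa> * y * real (k div r) = real d * real r / (4 * real k) * (real r * real (k div r))"
      using n \<rho> kr by (simp add: \<kappa>_def y_def u_def C_def field_simps power2_eq_square)
    also have "\<dots> \<le> real d * real r / (4 * real k) * real k"
    proof (rule mult_left_mono)
      have "r * (k div r) \<le> k" by simp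
      then show "real r * real (k div r) \<le> real k" by (metis of_nat_le_iff of_nat_mult)
    qed simp
    also have "\<dots> = real d / 4 * real r" using kr by simp
    also have "\<dots> \<le> real (d div (2 * k)) * real k * real r"
    proof (rule mult_right_mono)
      have "d = 2 * k * (d div (2 * k)) + d mod (2 * k)" by simp
      moreover have "d mod (2 * k) < 2 * k" using kr by simp
      moreover have "2 * k \<le> 2 * k * (d div (2 * k))"
        using d kr by (simp add: Suc_le_eq div_greater_zero_iff)
      ultimately have "d \<le> 4 * (k * (d div (2 * k)))" by linarith
      then have "real d \<le> real (4 * (k * (d div (2 * k))))" by (simp only: of_nat_le_iff)
      then show "real d / 4 \<le> real (d div (2 * k)) * real k" by (simp add: mult.commute)
    qed simp
    finally show "48 * real n * y * real (k div r) \<le> 1 \<or>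
      48 * (real n)\<^sup>2 * \<kappa> * y * real (k div r) \<le> real (d div (2 * k)) * real k * real r" by blast
  qed
  finally show ?thesis unfolding u_def C_def .
qed

text \<open>
A risk that dominates both terms separately dominates half their sum. An infinite supremum of the
risk is a separate case, since \<open>Q_fun\<close> is a supremum of real numbers.
\<close>

lemma rate_lower_bound:
  assumes \<alpha>: "0 < \<alpha>" and K: "0 < K" and s: "s \<noteq> 0" "s\<^sup>2 \<le> K\<^sup>2 / 8" "3 * s\<^sup>2 \<le> M0" "2 * s\<^sup>2 \<le> M"
    and \<J>: "\<J> \<in> {row_tail_class, decay_class}"
    and n: "0 < n" and d: "4 \<le> d" and \<rho>: "0 < \<rho>" "\<rho> \<le> b"
    and c: "0 < c" "2 * c \<le> s ^ 4 / 24 * min (2 powr (-2 * \<alpha> - 2)) (1/48) / 8"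
      "2 * c \<le> s ^ 4 / 24 * min (2 powr (-2 * \<alpha> - 2)) (1 / (384 * exp (2 * b)))"
  shows "ennreal (c * (min (real n powr (-(2 * \<alpha>) / (2 * \<alpha> + 1))) (real d / real n)
      + Q_fun \<alpha> d (real d / (\<rho> * (real n)\<^sup>2)))) \<le> minimax_risk \<rho> n d (subgauss_model K d (\<J> \<alpha> M0 M d))"
  unfolding minimax_risk_def
proof (rule INF_greatest)
  fix A assume A: "A \<in> zcdp_estimators \<rho> n d"
  let ?R = "SUP P\<in>subgauss_model K d (\<J> \<alpha> M0 M d). risk n d A P"
  let ?x = "min (real n powr (-(2 * \<alpha>) / (2 * \<alpha> + 1))) (real d / real n)"
  let ?u = "real d / (\<rho> * (real n)\<^sup>2)"
  let ?f = "\<lambda>(k, r). min (real k powr (-2 * \<alpha>) / real r) (?u * real k * real r)"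
  show "ennreal (c * (?x + Q_fun \<alpha> d ?u)) \<le> ?R"
  proof (cases ?R)
    case (real R)
    have "ennreal (2 * c * ?x) \<le> ?R"
      by (rule order_trans[OF ennreal_leI[OF mult_right_mono[OF c(2)]] sampling_lower_bound[OF \<alpha> K s \<J> A n d]]) simp
    then have 1: "2 * c * ?x \<le> R" using real by (simp add: ennreal_le_iff)
    have 2: "Q_fun \<alpha> d ?u \<le> R / (2 * c)"
      unfolding Q_fun_def
    proof (rule cSUP_least)
      show "{(k, r). 1 \<le> k \<and> k \<le> d div 4 \<and> 1 \<le> r \<and> r \<le> k} \<noteq> {}"
        using d by (auto intro!: exI[of _ 1])
      fix z assume "z \<in> {(k, r). 1 \<le> k \<and> k \<le> d div 4 \<and> 1 \<le> r \<and> r \<le> k}"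
      then obtain k r where z: "z = (k, r)" and kr: "1 \<le> k" "k \<le> d div 4" "1 \<le> r" "r \<le> k" by auto
      have "0 \<le> min (real k powr (-2 * \<alpha>) / real r) (?u * real k * real r)" using \<rho> by simp
      from order_trans[OF ennreal_leI[OF mult_right_mono[OF c(3) this]] privacy_lower_bound[OF \<alpha> K s \<J> A n \<rho> kr]]
      have "2 * c * min (real k powr (-2 * \<alpha>) / real r) (?u * real k * real r) \<le> R"
        using real by (simp add: ennreal_le_iff)
      then show "(case z of (k, r) \<Rightarrow> min (real k powr (-2 * \<alpha>) / real r) (?u * real k * real r)) \<le> R / (2 * c)"
        using c(1) by (simp add: z pos_le_divide_eq mult.commute)
    qed
    then have "2 * c * Q_fun \<alpha> d ?u \<le> R" using c(1) by (simp add: pos_le_divide_eq mult.commute)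
    with 1 have "c * (?x + Q_fun \<alpha> d ?u) \<le> R" by (simp add: algebra_simps)
    then show ?thesis using real by (simp add: ennreal_leI)
  next
    case top
    show ?thesis unfolding top by simp
  qed
qed

theorem theorem4p3:
  fixes \<alpha> K M0 M a b :: real
  assumes "\<alpha> > 0" and "K > 0" and "M0 > 0" and "M > 0" and "a > 0" and "b > 0"
  shows "\<forall>\<J>\<in>{row_tail_class, decay_class}.
    \<exists>c>0. \<forall>d \<rho>. regime a b d \<rho> \<longrightarrow>
      (\<forall>\<^sub>F n in sequentially.
         minimax_risk (\<rho> n) n (d n) (subgauss_model K (d n) (\<J> \<alpha> M0 M (d n)))
         \<ge> ennreal (c * (min (real n powr (-(2 * \<alpha>) / (2 * \<alpha> + 1))) (real (d n) / real n)
                        + Q_fun \<alpha> (d n) (real (d n) / (\<rho> n * (real n)\<^sup>2)))))"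
proof
  fix \<J> :: "real \<Rightarrow> real \<Rightarrow> real \<Rightarrow> nat \<Rightarrow> rmat set"
  assume \<J>: "\<J> \<in> {row_tail_class, decay_class}"
  \<comment> \<open>the largest scale that \<open>law_in_model\<close> allows\<close>
  define s where "s = sqrt (min (K\<^sup>2 / 8) (min (M0 / 3) (M / 2)))"
  have s2: "s\<^sup>2 = min (K\<^sup>2 / 8) (min (M0 / 3) (M / 2))" "0 < s"
    using assms by (auto simp: s_def)
  then have s: "s \<noteq> 0" "s\<^sup>2 \<le> K\<^sup>2 / 8" "3 * s\<^sup>2 \<le> M0" "2 * s\<^sup>2 \<le> M" by auto
  define c1 where "c1 = s ^ 4 / 24 * min (2 powr (-2 * \<alpha> - 2)) (1/48) / 8"
  define c2 where "c2 = s ^ 4 / 24 * min (2 powr (-2 * \<alpha> - 2)) (1 / (384 * exp (2 * b)))"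
  define c where "c = min c1 c2 / 2"
  have "0 < c1" "0 < c2" using s2(2) by (auto simp: c1_def c2_def)
  then have c: "0 < c" "2 * c \<le> c1" "2 * c \<le> c2" by (auto simp: c_def)
  show "\<exists>c>0. \<forall>d \<rho>. regime a b d \<rho> \<longrightarrow>
      (\<forall>\<^sub>F n in sequentially.
         minimax_risk (\<rho> n) n (d n) (subgauss_model K (d n) (\<J> \<alpha> M0 M (d n)))
         \<ge> ennreal (c * (min (real n powr (-(2 * \<alpha>) / (2 * \<alpha> + 1))) (real (d n) / real n)
                        + Q_fun \<alpha> (d n) (real (d n) / (\<rho> n * (real n)\<^sup>2)))))"
  proof (intro exI[of _ c] conjI allI impI c(1))
    fix d :: "nat \<Rightarrow> nat" and \<rho> :: "nat \<Rightarrow> real"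
    assume "regime a b d \<rho>"
    then have dn: "\<forall>\<^sub>F n in sequentially. real (d n) \<ge> a * ln (real n)"
      and \<rho>: "\<forall>\<^sub>F n in sequentially. 0 < \<rho> n \<and> \<rho> n \<le> b" by (auto simp: regime_def)
    \<comment> \<open>from here on \<open>d n \<ge> 4\<close>, so that the index set of the supremum in \<open>Q_fun\<close> is nonempty\<close>
    have "\<forall>\<^sub>F n in sequentially. nat \<lceil>exp (4 / a)\<rceil> \<le> n" by (rule eventually_ge_at_top)
    with dn \<rho> show "\<forall>\<^sub>F n in sequentially.
         minimax_risk (\<rho> n) n (d n) (subgauss_model K (d n) (\<J> \<alpha> M0 M (d n)))
         \<ge> ennreal (c * (min (real n powr (-(2 * \<alpha>) / (2 * \<alpha> + 1))) (real (d n) / real n)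
                        + Q_fun \<alpha> (d n) (real (d n) / (\<rho> n * (real n)\<^sup>2))))"
    proof eventually_elim
      case (elim n)
      have n: "exp (4 / a) \<le> real n" using elim(3) by linarith
      then have n0: "0 < n" using exp_gt_zero[of "4 / a"] by (metis gr0I not_le of_nat_0)
      have "4 / a \<le> ln (real n)" using n n0 by (simp add: ln_ge_iff)
      then have "4 \<le> a * ln (real n)" using assms(5) by (simp add: divide_le_eq mult.commute)
      then have d4: "4 \<le> d n" using elim(1) by linarith
      show ?case
        using elim(2) c by (intro rate_lower_bound[OF assms(1,2) s \<J> n0 d4, where b = b]) (auto simp: c1_def c2_def)
    qed
  qed
qed

end
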